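(* Let $n\ge 1$, let $E$ be a real linear subspace of the vector space $\operatorname{Sym}(n)$ of symmetric $n\times n$ real matrices, and let $\exp(E)=\{\exp u : u\in E\}$ be its image under the matrix exponential. Let $F:=E^\perp=\{Y\in\operatorname{Sym}(n) : \operatorname{Tr}(XY)=0 \text{ for all } X\in E\}$ and $\exp(F)=\{\exp v : v\in F\}$. Endow the manifold $\operatorname{SPD}(n)$ of symmetric positive-definite real $n\times n$ matrices with the affine-invariant Riemannian metric $\langle X,Y\rangle_x=\operatorname{Tr}(x^{-1}Xx^{-1}Y)$ and denote by $\operatorname{dist}$ the associated geodesic distance. Then: 1. $\exp(E)$ is a totally geodesic submanifold of $\operatorname{SPD}(n)$ and geodesically convex in $\operatorname{SPD}(n)$ if and only if $$[X,[X,Y]]\in E\qquad\text{for all } X,Y\in E. \qquad ( * )$$ 2. If $( * )$ holds, then every $x\in\operatorname{SPD}(n)$ can be decomposed uniquely as a product $x=e\cdot f\cdot e$ with $e\in\exp(E)$ and $f\in\exp(F)$. Moreover, $x$ admits a unique projection $\pi(x)$ onto $\exp(E)$ which minimises the geodesic distance from $x$ to $\exp(E)$, i.e. there is a unique $\pi(x)\in \exp(E)$ with $\operatorname{dist}(x,\exp(E))=\operatorname{dist}(x,\pi(x))$, and the matrix $e$ in the decomposition satisfies $e=\pi(x)^{1/2}$. 3. If $( * )$ holds, then every $g\in\operatorname{GL}(n,\mathbb{R})$ can be decomposed uniquely as a product $g=k\cdot\exp V\cdot\exp W$, where $k\in\operatorname{O}(n)$ is an orthogonal matrix, $V\in F$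 and $W\in E$. The Lie group $\operatorname{GL}(n,\mathbb{R})$ is diffeomorphic to the product $\operatorname{O}(n)\times\exp(F)\times\exp(E)$.
   Context: $[A,B]=AB-BA$ is the matrix commutator. The tangent space of $\operatorname{SPD}(n)$ at each point $x$ is identified with $\operatorname{Sym}(n)$; $X,Y$ in the metric formula are tangent vectors at $x$. $\operatorname{O}(n)=\{M\in\operatorname{GL}(n,\mathbb{R}) : M^TM=MM^T=\operatorname{Id}\}$. The matrix exponential is a diffeomorphism from $\operatorname{Sym}(n)$ onto $\operatorname{SPD}(n)$, so $\exp(E)$ and $\exp(F)$ are submanifolds of $\operatorname{SPD}(n)$. For $y\in\operatorname{SPD}(n)$, $y^{1/2}$ is its unique symmetric positive-definite square root. A submanifold $\mathcal{N}$ of a Riemannian manifold $\mathcal{M}$ is totally geodesic if any geodesic of $\mathcal{N}$ for the induced Riemannian metric is also a geodesic of $\mathcal{M}$; it is geodesically convex if for any two points of $\mathcal{N}$ there exists a unique minimizing geodesic of $\mathcal{M}$ connecting them and it is entirely contained in $\mathcal{N}$. $\operatorname{dist}(x,S)=\inf_{y\in S}\operatorname{dist}(x,y)$. *)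

theory Defs
  imports "HOL-Analysis.Analysis"
begin

section \<open>Smooth maps between subsets of Euclidean spaces\<close>

text \<open>Meant for open \<open>S\<close>. Quantifying over all directions \<open>v\<close> keeps the type of the derivative
  fixed; in finite dimension this is the usual notion of a \<open>C\<close>-\<open>k\<close> map.\<close>

primrec Ck_on :: "nat \<Rightarrow> 'a::euclidean_space set \<Rightarrow> ('a \<Rightarrow> 'b::real_normed_vector) \<Rightarrow> bool" where
  "Ck_on 0 S f \<longleftrightarrow> continuous_on S f"
| "Ck_on (Suc k) S f \<longleftrightarrow>
     (\<forall>x\<in>S. f differentiable (at x)) \<and> (\<forall>v. Ck_on k S (\<lambda>x. frechet_derivative f (at x) v))"

text \<open>Smoothness on an arbitrary subset: \<open>f\<close> extends locally to a smooth map on an open set of the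
  ambient space. On embedded submanifolds (and on intervals) this is the usual notion.\<close>

definition smooth_map :: "'a::euclidean_space set \<Rightarrow> ('a \<Rightarrow> 'b::real_normed_vector) \<Rightarrow> bool" where
  "smooth_map S f \<longleftrightarrow>
     (\<forall>x\<in>S. \<exists>U h. open U \<and> x \<in> U \<and> (\<forall>k. Ck_on k U h) \<and> (\<forall>y\<in>S \<inter> U. h y = f y))"

text \<open>Modelled on \<^const>\<open>homeomorphism\<close>; \<open>g\<close> is the inverse of \<open>f\<close>.\<close>

definition diffeomorphism ::
  "'a::euclidean_space set \<Rightarrow> 'b::euclidean_space set \<Rightarrow> ('a \<Rightarrow> 'b) \<Rightarrow> ('b \<Rightarrow> 'a) \<Rightarrow> bool" where
  "diffeomorphism S T f g \<longleftrightarrow>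
     (\<forall>x\<in>S. g (f x) = x) \<and> f ` S = T \<and> smooth_map S f \<and>
     (\<forall>y\<in>T. f (g y) = y) \<and> g ` T = S \<and> smooth_map T g"

definition diffeomorphic :: "'a::euclidean_space set \<Rightarrow> 'b::euclidean_space set \<Rightarrow> bool"
    (infixr \<open>diffeomorphic\<close> 60) where
  "S diffeomorphic T \<longleftrightarrow> (\<exists>f g. diffeomorphism S T f g)"


section \<open>Submanifolds\<close>

text \<open>A chart \<open>\<phi>\<close> of \<open>M\<close> with inverse parametrization \<open>\<psi>\<close>. Since a dimension cannot be a bound
  variable at the type level, a linear subspace \<open>H\<close> of the ambient space serves as the model space.\<close>

definition chart_on ::
  "'a::euclidean_space set \<Rightarrow> 'a set \<Rightarrow> 'a set \<Rightarrow> 'a set \<Rightarrow> ('a \<Rightarrow> 'a) \<Rightarrow> ('a \<Rightarrow> 'a) \<Rightarrow> bool" where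
  "chart_on M U H V \<phi> \<psi> \<longleftrightarrow>
     openin (top_of_set M) U \<and> subspace H \<and> openin (top_of_set H) V \<and> diffeomorphism U V \<phi> \<psi>"

text \<open>Embedded submanifolds, by slice charts of \<open>M\<close>.\<close>

definition submanifold :: "'a::euclidean_space set \<Rightarrow> 'a set \<Rightarrow> bool" where
  "submanifold N M \<longleftrightarrow> N \<subseteq> M \<and>
     (\<exists>d. \<forall>p\<in>N. \<exists>U H V \<phi> \<psi> L. chart_on M U H V \<phi> \<psi> \<and> p \<in> U \<and>
        subspace L \<and> L \<subseteq> H \<and> dim L = d \<and> \<phi> ` (U \<inter> N) = V \<inter> L)"


section \<open>Length and distance\<close>

text \<open>A Riemannian metric is a map \<open>g\<close> sending \<open>x X Y\<close> to the inner product of the tangent vectors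
  \<open>X\<close> and \<open>Y\<close> at \<open>x\<close>. The metric induced on a submanifold is then given by the same \<open>g\<close>.\<close>

definition velocity :: "real set \<Rightarrow> (real \<Rightarrow> 'a::euclidean_space) \<Rightarrow> real \<Rightarrow> 'a" where
  "velocity T \<gamma> t = vector_derivative \<gamma> (at t within T)"

text \<open>\<open>B\<close> is the set of break points. The library's \<^const>\<open>valid_path\<close> is not used, because it
  admits curves with unbounded derivative near a break point, which may have infinite length.\<close>

definition piecewise_smooth :: "(real \<Rightarrow> 'a::euclidean_space) \<Rightarrow> bool" where
  "piecewise_smooth \<gamma> \<longleftrightarrow> continuous_on {0..1} \<gamma> \<and>
     (\<exists>B. finite B \<and>
       (\<forall>a b. 0 \<le> a \<and> a < b \<and> b \<le> 1 \<and> {a<..<b} \<inter> B = {} \<longrightarrow> smooth_map {a..b} \<gamma>))"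

definition riem_length :: "('a \<Rightarrow> 'a \<Rightarrow> 'a \<Rightarrow> real) \<Rightarrow> (real \<Rightarrow> 'a::euclidean_space) \<Rightarrow> real" where
  "riem_length g \<gamma> =
     integral {0..1} (\<lambda>t. sqrt (g (\<gamma> t) (velocity {0..1} \<gamma> t) (velocity {0..1} \<gamma> t)))"

definition riem_dist ::
  "('a \<Rightarrow> 'a \<Rightarrow> 'a \<Rightarrow> real) \<Rightarrow> 'a::euclidean_space set \<Rightarrow> 'a \<Rightarrow> 'a \<Rightarrow> real" where
  "riem_dist g M x y =
     Inf {riem_length g \<gamma> | \<gamma>. piecewise_smooth \<gamma> \<and> \<gamma> ` {0..1} \<subseteq> M \<and> \<gamma> 0 = x \<and> \<gamma> 1 = y}"

definition riem_dist_set ::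
  "('a \<Rightarrow> 'a \<Rightarrow> 'a \<Rightarrow> real) \<Rightarrow> 'a::euclidean_space set \<Rightarrow> 'a \<Rightarrow> 'a set \<Rightarrow> real" where
  "riem_dist_set g M x S = (INF y\<in>S. riem_dist g M x y)"


section \<open>Geodesics\<close>

definition dir_deriv ::
  "('a::euclidean_space \<Rightarrow> 'b::real_normed_vector) \<Rightarrow> 'a \<Rightarrow> 'a \<Rightarrow> 'b" where
  "dir_deriv f u a = vector_derivative (\<lambda>s::real. f (u + s *\<^sub>R a)) (at 0)"

text \<open>The metric in the coordinates given by a parametrization \<open>\<psi>\<close>.\<close>

definition coord_metric ::
  "('a \<Rightarrow> 'a \<Rightarrow> 'a \<Rightarrow> real) \<Rightarrow> ('a::euclidean_space \<Rightarrow> 'a) \<Rightarrow> 'a \<Rightarrow> 'a \<Rightarrow> 'a \<Rightarrow> real" where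
  "coord_metric g \<psi> u a b = g (\<psi> u) (dir_deriv \<psi> u a) (dir_deriv \<psi> u b)"

text \<open>The Christoffel symbols of the first kind of the Levi-Civita connection of \<open>G\<close>, without
  choosing a basis of the model space.\<close>

definition christoffel ::
  "('a \<Rightarrow> 'a \<Rightarrow> 'a \<Rightarrow> real) \<Rightarrow> 'a::euclidean_space \<Rightarrow> 'a \<Rightarrow> 'a \<Rightarrow> 'a \<Rightarrow> real" where
  "christoffel G u a b w =
     (dir_deriv (\<lambda>v. G v b w) u a + dir_deriv (\<lambda>v. G v a w) u b - dir_deriv (\<lambda>v. G v a b) u w) / 2"

text \<open>A smooth curve on a nondegenerate interval whose covariant acceleration for the Levi-Civita
  connection of \<open>(M, g)\<close> vanishes. In a chart, with \<open>u = \<phi> \<circ> \<gamma>\<close>, the covariant acceleration \<open>A\<close>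
  is given by \<open>G(A, w) = G(u'', w) + \<Gamma>(u', u'; w)\<close> for \<open>w\<close> in the model space; whether it vanishes
  does not depend on the chart.\<close>

definition geodesic ::
  "('a \<Rightarrow> 'a \<Rightarrow> 'a \<Rightarrow> real) \<Rightarrow> 'a::euclidean_space set \<Rightarrow> real set \<Rightarrow> (real \<Rightarrow> 'a) \<Rightarrow> bool" where
  "geodesic g M T \<gamma> \<longleftrightarrow>
     is_interval T \<and> (\<exists>a\<in>T. \<exists>b\<in>T. a < b) \<and> smooth_map T \<gamma> \<and> \<gamma> ` T \<subseteq> M \<and>
     (\<forall>t\<in>T. \<exists>U H V \<phi> \<psi>. chart_on M U H V \<phi> \<psi> \<and> \<gamma> t \<in> U \<and>
        (let u = \<phi> \<circ> \<gamma>; u' = velocity T u; u'' = velocity T u'; G = coord_metric g \<psi> in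
           \<forall>w\<in>H. G (u t) (u'' t) w + christoffel G (u t) (u' t) (u' t) w = 0))"

definition minimizing_geodesic ::
  "('a \<Rightarrow> 'a \<Rightarrow> 'a \<Rightarrow> real) \<Rightarrow> 'a::euclidean_space set \<Rightarrow> 'a \<Rightarrow> 'a \<Rightarrow> (real \<Rightarrow> 'a) \<Rightarrow> bool" where
  "minimizing_geodesic g M p q \<gamma> \<longleftrightarrow>
     geodesic g M {0..1} \<gamma> \<and> \<gamma> 0 = p \<and> \<gamma> 1 = q \<and> riem_length g \<gamma> = riem_dist g M p q"

definition totally_geodesic_submanifold ::
  "('a \<Rightarrow> 'a \<Rightarrow> 'a \<Rightarrow> real) \<Rightarrow> 'a::euclidean_space set \<Rightarrow> 'a set \<Rightarrow> bool" where
  "totally_geodesic_submanifold g M N \<longleftrightarrow>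
     submanifold N M \<and> (\<forall>T \<gamma>. geodesic g N T \<gamma> \<longrightarrow> geodesic g M T \<gamma>)"

text \<open>Geodesics are total functions on the reals, so uniqueness is agreement on \<open>{0..1}\<close>.\<close>

definition geodesically_convex ::
  "('a \<Rightarrow> 'a \<Rightarrow> 'a \<Rightarrow> real) \<Rightarrow> 'a::euclidean_space set \<Rightarrow> 'a set \<Rightarrow> bool" where
  "geodesically_convex g M N \<longleftrightarrow>
     (\<forall>p\<in>N. \<forall>q\<in>N. \<exists>\<gamma>. minimizing_geodesic g M p q \<gamma> \<and> \<gamma> ` {0..1} \<subseteq> N \<and>
        (\<forall>\<eta>. minimizing_geodesic g M p q \<eta> \<longrightarrow> (\<forall>t\<in>{0..1}. \<eta> t = \<gamma> t)))"


section \<open>Matrices\<close>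

text \<open>On \<^typ>\<open>real^'n^'n\<close> the operations \<open>*\<close> and \<open>^\<close> act componentwise and \<^const>\<open>exp\<close> is not
  available, hence the power series in terms of \<open>**\<close>.\<close>

definition mexp :: "real^'n^'n \<Rightarrow> real^'n^'n" where
  "mexp A = (\<Sum>k. (1 / fact k) *\<^sub>R (((**) A) ^^ k) (mat 1))"

definition commutator :: "real^'n^'n \<Rightarrow> real^'n^'n \<Rightarrow> real^'n^'n" where
  "commutator A B = A ** B - B ** A"

definition Sym :: "(real^'n^'n) set" where
  "Sym = {A. transpose A = A}"

definition SPD :: "(real^'n^'n) set" where
  "SPD = {A \<in> Sym. \<forall>v. v \<noteq> 0 \<longrightarrow> v \<bullet> (A *v v) > 0}"

definition GL :: "(real^'n^'n) set" where
  "GL = {A. invertible A}"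

definition Orth :: "(real^'n^'n) set" where
  "Orth = {A. orthogonal_matrix A}"

definition sym_perp :: "(real^'n^'n) set \<Rightarrow> (real^'n^'n) set" where
  "sym_perp E = {Y \<in> Sym. \<forall>X\<in>E. trace (X ** Y) = 0}"

definition spd_sqrt :: "real^'n^'n \<Rightarrow> real^'n^'n" where
  "spd_sqrt y = (THE z. z \<in> SPD \<and> z ** z = y)"

definition ai_metric :: "real^'n^'n \<Rightarrow> real^'n^'n \<Rightarrow> real^'n^'n \<Rightarrow> real" where
  "ai_metric x X Y = trace (matrix_inv x ** X ** matrix_inv x ** Y)"

abbreviation spd_dist :: "real^'n^'n \<Rightarrow> real^'n^'n \<Rightarrow> real" where
  "spd_dist \<equiv> riem_dist ai_metric SPD"

definition is_projection :: "(real^'n^'n) set \<Rightarrow> real^'n^'n \<Rightarrow> real^'n^'n \<Rightarrow> bool" where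
  "is_projection S x p \<longleftrightarrow> p \<in> S \<and> riem_dist_set ai_metric SPD x S = spd_dist x p"

end

theory Submission
  imports Defs
begin

text \<open>In logarithmic coordinates the metric at \<open>exp X\<close> is the norm of \<open>dexp_sym X W\<close>, where
  \<open>dexp_sym X = sinh (ad X / 2) / (ad X / 2)\<close> is self-adjoint and at least \<open>1\<close>. So the logarithm does
  not increase lengths of curves, which gives the distance formula, the minimising geodesics and the
  inequality \<open>dist (exp A) (exp B) \<ge> \<bar>A - B\<bar>\<close>.

  The double commutator condition says that \<open>(ad X)\<^sup>2\<close> preserves \<open>E\<close> for \<open>X\<close> in \<open>E\<close>, hence so do all
  even functions of \<open>ad X\<close>. The differential equation of \<open>log (exp (tX) exp Y exp (tX))\<close> is then
  tangent to \<open>E\<close>, so \<open>exp E\<close> is invariant under \<open>y \<mapsto> e y e\<close> for \<open>e\<close> in \<open>exp E\<close>, and convexity and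
  total geodesy can be checked at the identity. Conversely, convexity forces \<open>(dexp_sym X)\<^sup>2\<close> to
  preserve \<open>E\<close>, and its second-order term in \<open>X\<close> is \<open>(ad X)\<^sup>2 / 12\<close>.

  Minimising the distance from \<open>x\<close> to \<open>exp E\<close> gives \<open>x = e f e\<close>; uniqueness follows from
  \<open>\<bar>v - B\<bar>\<^sup>2 = \<bar>v\<bar>\<^sup>2 + \<bar>B\<bar>\<^sup>2\<close> for \<open>v\<close> orthogonal to \<open>B\<close>. Applied to the Gram matrix of \<open>g\<close>, this decomposes
  \<open>g\<close> itself, and the inverse function theorem makes the factors smooth.\<close>

section \<open>Calculus of \<open>C\<close>-\<open>k\<close> maps\<close>

text \<open>Nothing is diagonalised. Functions of \<open>ad X\<close> are averages over
  \<open>s\<close> of \<open>exp (s X) W exp (- s X)\<close>; their positivity comes from the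
  self-adjointness of this operation for symmetric \<open>X\<close>, and their invariant subspaces
  from linear differential equations. Two obstacles shape the rest. \<open>SPD\<close> is open only
  relative to \<open>Sym\<close>, while \<open>Ck_on\<close> is meant for open sets, so maps on
  \<open>Sym\<close> are extended by the identity on antisymmetric matrices before they are
  inverted. And a geodesic is defined through Christoffel symbols in an unspecified chart; this is
  turned once into orthogonality of \<open>\<gamma>'' - \<gamma>' \<gamma>^-1 \<gamma>'\<close> to
  the velocities of all curves in the submanifold. Apart from the identity chart of
  \<open>SPD\<close>, geodesics are then handled without coordinates. The 12 in
  \<open>(ad X)^2 / 12\<close> comes from squaring
  \<open>sinh (x/2) / (x/2) = 1 + x^2 / 24 + ...\<close>; the coefficient is extracted by
  differentiating an integral identity four times. The differential of
  \<open>(u, v) \<mapsto> exp u exp v exp u\<close> involves mixed brackets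
  \<open>[z, [u, w]]\<close>, which polarisation and the Jacobi identity reduce to double
  commutators.\<close>

lemma Ck_on_cong:
  assumes "open S" "\<And>x. x \<in> S \<Longrightarrow> f x = g x"
  shows "Ck_on k S f \<longleftrightarrow> Ck_on k S g"
proof -
  have "Ck_on k S g" if "Ck_on k S f" "\<And>x. x \<in> S \<Longrightarrow> f x = g x" for f g :: "'a \<Rightarrow> 'b"
    using that
  proof (induction k arbitrary: f g)
    case 0
    then show ?case by (auto cong: continuous_on_cong)
  next
    case (Suc k)
    have "g differentiable at x" if "x \<in> S" for x
      using Suc.prems that \<open>open S\<close> unfolding Ck_on.simps differentiable_def
      by (meson has_derivative_transform_within_open)
    moreover have "Ck_on k S (\<lambda>x. frechet_derivative g (at x) v)" for v
    proof (rule Suc.IH)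
      show "Ck_on k S (\<lambda>x. frechet_derivative f (at x) v)" using Suc.prems by simp
      show "frechet_derivative f (at x) v = frechet_derivative g (at x) v" if "x \<in> S" for x
        using frechet_derivative_transform_within_open[of f x S g] Suc.prems that \<open>open S\<close> by auto
    qed
    ultimately show ?case by simp
  qed
  from this[of f g] this[of g f] assms(2) show ?thesis by metis
qed

text \<open>The recursion of \<open>Ck_on\<close> speaks of \<open>frechet_derivative\<close>, a
  choice operator. This rule lets an explicitly given derivative take its place, so that smoothness
  proofs become inductions on formulas.\<close>

lemma Ck_on_SucI:
  assumes "open S" "\<And>x. x \<in> S \<Longrightarrow> (f has_derivative D x) (at x)"
    "\<And>v. Ck_on k S (\<lambda>x. D x v)"
  shows "Ck_on (Suc k) S f"
proof -
  have "frechet_derivative f (at x) = D x" if "x \<in> S" for x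
    using assms(2)[OF that] frechet_derivative_at by fastforce
  then have "Ck_on k S (\<lambda>x. frechet_derivative f (at x) v)" for v
    using Ck_on_cong[OF assms(1), of "\<lambda>x. D x v" "\<lambda>x. frechet_derivative f (at x) v" k] assms(3) by auto
  then show ?thesis
    using assms(2) by (auto intro: differentiableI)
qed

lemma Ck_on_SucD:
  assumes "Ck_on (Suc k) S f" "x \<in> S"
  shows "(f has_derivative frechet_derivative f (at x)) (at x)"
  using assms frechet_derivative_works by auto

lemma Ck_on_Suc_imp: "Ck_on (Suc k) S f \<Longrightarrow> Ck_on k S f"
proof (induction k arbitrary: f)
  case 0
  then show ?case
    by (auto intro!: differentiable_imp_continuous_on differentiable_at_imp_differentiable_on)
next
  case (Suc k)
  from Suc.prems have "Ck_on (Suc k) S (\<lambda>x. frechet_derivative f (at x) v)" for v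
    by simp
  with Suc have "Ck_on k S (\<lambda>x. frechet_derivative f (at x) v)" for v by blast
  with Suc.prems show ?case by auto
qed

lemma Ck_on_subset: "Ck_on k S f \<Longrightarrow> T \<subseteq> S \<Longrightarrow> Ck_on k T f"
  by (induction k arbitrary: f) (auto intro: continuous_on_subset)

lemma Ck_on_const [simp]: "Ck_on k S (\<lambda>x. c)"
proof (induction k arbitrary: c)
  case (Suc k)
  then show ?case by auto
qed auto

lemma Ck_on_linear:
  assumes "bounded_linear f" "open S"
  shows "Ck_on k S f"
proof (cases k)
  case 0
  then show ?thesis using assms by (simp add: linear_continuous_on)
next
  case (Suc m)
  show ?thesis unfolding Suc
    by (rule Ck_on_SucI[OF assms(2), where D="\<lambda>_. f"])
      (auto intro: bounded_linear_imp_has_derivative assms)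
qed

lemma Ck_on_add:
  assumes "open S"
  shows "Ck_on k S f \<Longrightarrow> Ck_on k S g \<Longrightarrow> Ck_on k S (\<lambda>x. f x + g x)"
proof (induction k arbitrary: f g)
  case 0
  then show ?case by (auto intro: continuous_intros)
next
  case (Suc k)
  show ?case
    by (rule Ck_on_SucI[OF assms, where D="\<lambda>x v. frechet_derivative f (at x) v + frechet_derivative g (at x) v"])
      (use Suc in \<open>auto intro!: has_derivative_add Ck_on_SucD\<close>)
qed

lemma Ck_on_sum:
  assumes "open S" "\<And>i. i \<in> I \<Longrightarrow> Ck_on k S (f i)"
  shows "Ck_on k S (\<lambda>x. \<Sum>i\<in>I. f i x)"
  using assms(2) by (induction I rule: infinite_finite_induct) (auto intro: Ck_on_add[OF assms(1)])

lemma Ck_on_bilinear: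
  assumes "bounded_bilinear B" "open S"
  shows "Ck_on k S f \<Longrightarrow> Ck_on k S g \<Longrightarrow> Ck_on k S (\<lambda>x. B (f x) (g x))"
proof (induction k arbitrary: f g)
  case 0
  then show ?case using assms by (auto intro: bounded_bilinear.continuous_on)
next
  case (Suc k)
  show ?case
    by (rule Ck_on_SucI[OF assms(2), where D="\<lambda>x v. B (f x) (frechet_derivative g (at x) v) + B (frechet_derivative f (at x) v) (g x)"])
      (use Suc in \<open>auto intro!: bounded_bilinear.FDERIV[OF assms(1)] Ck_on_SucD Ck_on_add assms(2) Suc.IH simp: Ck_on_Suc_imp\<close>)
qed

lemma Ck_on_compose_linear:
  assumes "bounded_linear h" "open S"
  shows "Ck_on k S f \<Longrightarrow> Ck_on k S (\<lambda>x. h (f x))"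
proof (induction k arbitrary: f)
  case 0
  then show ?case using assms by (auto intro: bounded_linear.continuous_on)
next
  case (Suc k)
  show ?case
    by (rule Ck_on_SucI[OF assms(2), where D="\<lambda>x v. h (frechet_derivative f (at x) v)"])
      (use Suc in \<open>auto intro!: bounded_linear.has_derivative[OF assms(1)] Ck_on_SucD\<close>)
qed

text \<open>\<open>Ck_on\<close> differentiates in a direction that is held fixed. Expanding in
  \<open>Basis\<close> reduces a derivative in a varying direction to finitely many fixed ones with
  scalar coefficients.\<close>

lemma linear_Basis_expansion:
  fixes h :: "'a::euclidean_space \<Rightarrow> 'b::real_normed_vector"
  assumes "linear h"
  shows "h v = (\<Sum>b\<in>Basis. (v \<bullet> b) *\<^sub>R h b)"
proof -
  have "h v = h (\<Sum>b\<in>Basis. (v \<bullet> b) *\<^sub>R b)" by (simp add: euclidean_representation)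
  then show ?thesis using assms by (simp add: linear_sum linear_cmul)
qed

lemma Ck_on_compose:
  assumes "open S" "open T" "f ` S \<subseteq> T"
  shows "Ck_on k S f \<Longrightarrow> Ck_on k T g \<Longrightarrow> Ck_on k S (\<lambda>x. g (f x))"
proof (induction k arbitrary: g)
  case 0
  then show ?case using assms by (auto intro: continuous_on_compose2)
next
  case (Suc k)
  \<comment> \<open>The chain rule with the inner derivative expanded in \<open>Basis\<close>: each
    summand is a scalar function times a derivative of \<open>g\<close> in the fixed direction
    \<open>b\<close>, composed with \<open>f\<close>, and the latter is covered by the induction
    hypothesis.\<close>
  let ?D = "\<lambda>x v. \<Sum>b\<in>Basis. (frechet_derivative f (at x) v \<bullet> b) *\<^sub>R frechet_derivative g (at (f x)) b"
  show ?case
  proof (rule Ck_on_SucI[OF assms(1)])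
    fix x assume x: "x \<in> S"
    have g: "(g has_derivative frechet_derivative g (at (f x))) (at (f x))"
      using Ck_on_SucD[OF Suc.prems(2)] x assms(3) by blast
    from diff_chain_at[OF Ck_on_SucD[OF Suc.prems(1) x] g]
    have "((\<lambda>x. g (f x)) has_derivative (\<lambda>v. frechet_derivative g (at (f x)) (frechet_derivative f (at x) v))) (at x)"
      by (simp add: o_def)
    moreover have "(\<lambda>v. frechet_derivative g (at (f x)) (frechet_derivative f (at x) v)) = ?D x"
      by (rule ext, rule linear_Basis_expansion[OF has_derivative_linear[OF g]])
    ultimately show "((\<lambda>x. g (f x)) has_derivative ?D x) (at x)" by (simp only:)
  next
    fix v
    have "Ck_on k S (\<lambda>x. frechet_derivative f (at x) v \<bullet> b)" for b
      using Suc.prems(1) by (intro Ck_on_compose_linear[OF bounded_linear_inner_left assms(1)]) simp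
    moreover have "Ck_on k S (\<lambda>x. frechet_derivative g (at (f x)) b)" for b
      using Suc.prems by (intro Suc.IH) (auto simp: Ck_on_Suc_imp)
    ultimately show "Ck_on k S (\<lambda>x. ?D x v)"
      by (intro Ck_on_sum assms(1) Ck_on_bilinear[OF bounded_bilinear_scaleR])
  qed
qed

lemma Ck_on_Pair:
  assumes "open S" "Ck_on k S f" "Ck_on k S g"
  shows "Ck_on k S (\<lambda>x. (f x, g x))"
proof -
  have "Ck_on k S (\<lambda>x. (f x, 0) + (0, g x))"
    by (intro Ck_on_add assms Ck_on_compose_linear[of "\<lambda>y. (y, 0)"] Ck_on_compose_linear[of "\<lambda>y. (0, y)"])
      (auto intro!: bounded_linear_Pair bounded_linear_ident bounded_linear_zero)
  then show ?thesis by simp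
qed

text \<open>Differentiation under the integral sign yields the parameter integral of the derivative
  in direction \<open>(v, 0)\<close>, which is of the same kind with one order of smoothness less;
  hence the induction over all \<open>f\<close>.\<close>

lemma Ck_on_param_integral:
  fixes f :: "'a::euclidean_space \<times> real \<Rightarrow> 'b::euclidean_space"
  assumes "open S"
  shows "Ck_on k (S \<times> UNIV) f \<Longrightarrow> Ck_on k S (\<lambda>x. integral {a..b} (\<lambda>s. f (x, s)))"
proof (induction k arbitrary: f)
  case 0
  then have "continuous_on (S \<times> cbox a b) (\<lambda>(x, s). f (x, s))"
    by (auto simp: split_beta intro: continuous_on_subset)
  then show ?case using integral_continuous_on_param[of S a b "\<lambda>x s. f (x, s)"] by simp
next
  case (Suc k)
  let ?d = "\<lambda>x s v. frechet_derivative f (at (x, s)) (v, 0)"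
  have der: "((\<lambda>x. f (x, s)) has_derivative ?d x s) (at x)" if "x \<in> S" for x s
  proof -
    have "((\<lambda>x. (x, s)) has_derivative (\<lambda>v. (v, 0))) (at x)"
      by (auto intro!: derivative_eq_intros)
    from diff_chain_at[OF this Ck_on_SucD[OF Suc.prems]] that show ?thesis by (simp add: o_def)
  qed
  \<comment> \<open>The Leibniz rule asks for the derivative as a bounded linear function that is
    jointly continuous; in finite dimension this can be checked direction by direction. It also asks
    for a convex domain, hence the ball below.\<close>
  define fx where "fx x s = Blinfun (?d x s)" for x s
  have fx: "blinfun_apply (fx x s) = ?d x s" if "x \<in> S" for x s
    unfolding fx_def by (rule bounded_linear_Blinfun_apply) (use der[OF that] has_derivative_bounded_linear in blast)
  have Ckd: "Ck_on k (S \<times> UNIV) (\<lambda>z. frechet_derivative f (at z) (v, 0))" for v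
    using Suc.prems by simp
  have cd: "continuous_on (S \<times> UNIV) (\<lambda>z. frechet_derivative f (at z) (v, 0))" for v
  proof -
    have "Ck_on 0 S' g" if "Ck_on k S' g" for S' and g :: "'a \<times> real \<Rightarrow> 'b"
      using that by (induction k) (auto dest: Ck_on_Suc_imp simp del: Ck_on.simps)
    then show ?thesis using Ckd[of v] by simp
  qed
  have cf: "continuous_on (S \<times> UNIV) f"
    using Suc.prems by (auto intro!: differentiable_imp_continuous_on differentiable_at_imp_differentiable_on)
  show ?case
  proof (rule Ck_on_SucI[OF assms])
    show "Ck_on k S (\<lambda>x. integral {a..b} (\<lambda>s. ?d x s v))" for v
      using Suc.IH[OF Ckd] by simp
  next
    fix x0 assume x0: "x0 \<in> S"
    obtain e where e: "e > 0" "ball x0 e \<subseteq> S" using assms x0 openE by blast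
    have cfx: "continuous_on (ball x0 e \<times> cbox a b) (\<lambda>(x, s). fx x s)"
      unfolding split_beta
    proof (rule continuous_on_blinfun_componentwise)
      fix i :: 'a
      have "continuous_on (ball x0 e \<times> cbox a b) (\<lambda>z. frechet_derivative f (at z) (i, 0))"
        by (rule continuous_on_subset[OF cd]) (use e in auto)
      then show "continuous_on (ball x0 e \<times> cbox a b) (\<lambda>z. blinfun_apply (fx (fst z) (snd z)) i)"
        by (rule continuous_on_eq) (use e fx in auto)
    qed
    have ci: "continuous_on (cbox a b) (\<lambda>s. f (x, s))" if "x \<in> S" for x
      by (rule continuous_on_compose2[OF cf]) (use that in \<open>auto intro!: continuous_intros\<close>)
    have "((\<lambda>x. integral (cbox a b) (\<lambda>s. f (x, s))) has_derivative integral (cbox a b) (fx x0)) (at x0 within ball x0 e)"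
    proof (rule leibniz_rule[where fx=fx])
      show "((\<lambda>x. f (x, t)) has_derivative blinfun_apply (fx x t)) (at x within ball x0 e)"
        if "x \<in> ball x0 e" "t \<in> cbox a b" for x t
      proof -
        have "x \<in> S" using that e by auto
        then show ?thesis using der fx by (simp add: has_derivative_at_withinI)
      qed
      show "(\<lambda>s. f (x, s)) integrable_on cbox a b" if "x \<in> ball x0 e" for x
        by (rule integrable_continuous[OF ci]) (use that e in auto)
    qed (use e cfx in auto)
    then have "((\<lambda>x. integral (cbox a b) (\<lambda>s. f (x, s))) has_derivative integral (cbox a b) (fx x0)) (at x0)"
      using at_within_open[of x0 "ball x0 e"] e by (simp only: centre_in_ball open_ball)
    moreover have "blinfun_apply (integral (cbox a b) (fx x0)) = (\<lambda>v. integral {a..b} (\<lambda>s. ?d x0 s v))"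
    proof
      fix v
      have "fx x0 integrable_on cbox a b"
        using continuous_on_compose2[OF cfx, of "cbox a b" "\<lambda>s. (x0, s)"] e
        by (intro integrable_continuous) (simp add: continuous_on_Pair image_subset_iff)
      then show "blinfun_apply (integral (cbox a b) (fx x0)) v = integral {a..b} (\<lambda>s. ?d x0 s v)"
        using blinfun_apply_integral[of "fx x0" "cbox a b" v] by (simp add: fx[OF x0])
    qed
    ultimately show "((\<lambda>x. integral {a..b} (\<lambda>s. f (x, s))) has_derivative (\<lambda>v. integral {a..b} (\<lambda>s. ?d x0 s v))) (at x0)"
      by simp
  qed
qed

text \<open>A product rule in which \<open>g\<close> is merely continuous: the term with the
  derivative of \<open>g\<close> would carry the factor \<open>f x = 0\<close>. It gives the
  derivative of any map whose increment is a known small factor times a continuous coefficient, as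
  for the inverse of a linear map and for the exponential.\<close>

lemma has_derivative_scaleR_vanishing:
  fixes f :: "'a::real_normed_vector \<Rightarrow> real" and g :: "'a \<Rightarrow> 'b::real_normed_vector"
  assumes f: "(f has_derivative f') (at x)" and "f x = 0" and g: "continuous (at x) g"
  shows "((\<lambda>y. f y *\<^sub>R g y) has_derivative (\<lambda>h. f' h *\<^sub>R g x)) (at x)"
proof -
  obtain K where K: "\<And>h. norm (f' h) \<le> norm h * K"
    using has_derivative_bounded_linear[OF f] bounded_linear.bounded by blast
  have r: "((\<lambda>y. (f y - f x - f' (y - x)) /\<^sub>R norm (y - x)) \<longlongrightarrow> 0) (at x)"
    using f by (simp add: has_derivative_at_within)
  have lim: "((\<lambda>y. (f y *\<^sub>R (g y - g x)) /\<^sub>R norm (y - x)) \<longlongrightarrow> 0) (at x)"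
  proof (rule Lim_null_comparison)
    have "((\<lambda>y. (K + norm ((f y - f x - f' (y - x)) /\<^sub>R norm (y - x))) * norm (g y - g x)) \<longlongrightarrow> (K + norm (0::real)) * norm (g x - g x)) (at x)"
      by (intro tendsto_intros r) (use g in \<open>simp add: continuous_at\<close>)
    then show "((\<lambda>y. (K + norm ((f y - f x - f' (y - x)) /\<^sub>R norm (y - x))) * norm (g y - g x)) \<longlongrightarrow> 0) (at x)"
      by simp
    have "norm ((f y *\<^sub>R (g y - g x)) /\<^sub>R norm (y - x)) \<le> (K + norm ((f y - f x - f' (y - x)) /\<^sub>R norm (y - x))) * norm (g y - g x)"
      if "y \<noteq> x" for y
    proof -
      have n: "norm (y - x) > 0" using that by simp
      have "\<bar>f y\<bar> \<le> \<bar>f y - f x - f' (y - x)\<bar> + norm (y - x) * K"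
        using K[of "y - x"] \<open>f x = 0\<close> by simp
      then have "\<bar>f y\<bar> / norm (y - x) \<le> (\<bar>f y - f x - f' (y - x)\<bar> + norm (y - x) * K) / norm (y - x)"
        using n by (intro divide_right_mono) auto
      also have "\<dots> = K + \<bar>f y - f x - f' (y - x)\<bar> / norm (y - x)"
        using n by (simp add: field_simps)
      finally have "\<bar>f y\<bar> / norm (y - x) * norm (g y - g x) \<le> (K + \<bar>f y - f x - f' (y - x)\<bar> / norm (y - x)) * norm (g y - g x)"
        by (rule mult_right_mono) simp
      then show ?thesis by (simp add: divide_inverse_commute mult.assoc abs_mult)
    qed
    then show "\<forall>\<^sub>F y in at x. norm ((f y *\<^sub>R (g y - g x)) /\<^sub>R norm (y - x)) \<le> (K + norm ((f y - f x - f' (y - x)) /\<^sub>R norm (y - x))) * norm (g y - g x)"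
      by (simp add: eventually_at_filter)
  qed
  have "((\<lambda>y. f y *\<^sub>R (g y - g x)) has_derivative (\<lambda>h. 0)) (at x)"
    unfolding has_derivative_at_within using lim \<open>f x = 0\<close> by simp
  moreover have "((\<lambda>y. f y *\<^sub>R g x) has_derivative (\<lambda>h. f' h *\<^sub>R g x)) (at x)"
    by (rule has_derivative_scaleR_left[OF f])
  ultimately have "((\<lambda>y. f y *\<^sub>R (g y - g x) + f y *\<^sub>R g x) has_derivative (\<lambda>h. 0 + f' h *\<^sub>R g x)) (at x)"
    by (rule has_derivative_add)
  then show ?thesis by (simp add: algebra_simps)
qed

section \<open>Inverses of smooth families of linear maps, and smooth inverse maps\<close>

context
  fixes L :: "'b::euclidean_space \<Rightarrow> 'a::euclidean_space \<Rightarrow> 'a" and S :: "'b set"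
  assumes S: "open S" and lin: "\<And>x. x \<in> S \<Longrightarrow> linear (L x)" and inj: "\<And>x. x \<in> S \<Longrightarrow> inj (L x)"
begin

lemma inv_linear_family:
  assumes "x \<in> S"
  shows "linear (inv (L x))" "L x (inv (L x) v) = v" "inv (L x) (L x v) = v"
proof -
  have "surj (L x)" using lin inj assms linear_injective_imp_surjective by blast
  then show "L x (inv (L x) v) = v" by (simp add: surj_f_inv_f)
  show "inv (L x) (L x v) = v" using inj assms by simp
  show "linear (inv (L x))"
    using lin inj assms \<open>surj (L x)\<close> by (metis bij_def inj_linear_imp_inv_linear linear_injective_imp_surjective)
qed

lemma continuous_on_inv_linear_family:
  assumes "\<And>w. continuous_on S (\<lambda>x. L x w)"
  shows "continuous_on S (\<lambda>x. inv (L x) v)"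
proof -
  have "((\<lambda>x. inv (L x) v) \<longlongrightarrow> inv (L x0) v) (at x0)" if x0: "x0 \<in> S" for x0
  proof -
    define M where "M = inv (L x0)"
    have M: "linear M" unfolding M_def by (rule inv_linear_family[OF x0])
    \<comment> \<open>\<open>\<eta> x\<close> bounds the operator norm of
      \<open>M (L x) - id\<close>. Once it is below 1/2, the usual Neumann-type estimate gives
      \<open>norm (inv (L x) v) \<le> 2 * norm (M v)\<close>.\<close>
    define \<eta> where "\<eta> x = (\<Sum>b\<in>Basis. norm (M (L x b) - b))" for x
    have \<eta>: "norm (M (L x w) - w) \<le> \<eta> x * norm w" if x: "x \<in> S" for x w
    proof -
      have l: "linear (\<lambda>w. M (L x w) - w)"
        using linear_compose[OF lin[OF x] M] by (auto simp: o_def intro!: linear_compose_sub linear_id[unfolded id_def])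
      have "norm (M (L x w) - w) = norm (\<Sum>b\<in>Basis. (w \<bullet> b) *\<^sub>R (M (L x b) - b))"
        using linear_Basis_expansion[OF l, of w] by simp
      also have "\<dots> \<le> (\<Sum>b\<in>Basis. \<bar>w \<bullet> b\<bar> * norm (M (L x b) - b))"
        by (rule norm_sum[THEN order_trans]) simp
      also have "\<dots> \<le> (\<Sum>b\<in>Basis. norm w * norm (M (L x b) - b))"
        by (intro sum_mono mult_right_mono Basis_le_norm) auto
      finally show ?thesis by (simp add: \<eta>_def sum_distrib_left mult.commute)
    qed
    have "((\<lambda>x. L x b) \<longlongrightarrow> L x0 b) (at x0)" for b
      using assms[of b] x0 S by (simp add: continuous_on_eq_continuous_at isCont_def)
    from bounded_linear.tendsto[OF M[unfolded linear_conv_bounded_linear] this] have "((\<lambda>x. M (L x b)) \<longlongrightarrow> b) (at x0)" for b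
      using inv_linear_family(3)[OF x0] by (simp add: M_def)
    then have "(\<eta> \<longlongrightarrow> (\<Sum>b\<in>Basis. norm ((b::'a) - b))) (at x0)"
      unfolding \<eta>_def by (intro tendsto_intros)
    then have \<eta>0: "(\<eta> \<longlongrightarrow> 0) (at x0)" by simp
    have ev: "\<forall>\<^sub>F x in at x0. x \<in> S \<and> \<eta> x < 1/2"
      using order_tendstoD(2)[OF \<eta>0, of "1/2"] eventually_at_in_open'[OF S x0] by (auto elim: eventually_elim2)
    have "((\<lambda>x. inv (L x) v - M v) \<longlongrightarrow> 0) (at x0)"
    proof (rule Lim_null_comparison)
      show "\<forall>\<^sub>F x in at x0. norm (inv (L x) v - M v) \<le> 2 * \<eta> x * norm (M v)"
        using ev
      proof eventually_elim
        case (elim x)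
        let ?y = "inv (L x) v"
        have 1: "norm (M v - ?y) \<le> \<eta> x * norm ?y"
          using \<eta>[of x ?y] inv_linear_family(2)[of x v] elim by simp
        have "\<eta> x \<ge> 0" by (simp add: \<eta>_def sum_nonneg)
        have "\<eta> x * norm ?y \<le> 1/2 * norm ?y" using elim by (intro mult_right_mono) auto
        moreover have "norm ?y \<le> norm (M v) + norm (M v - ?y)"
          using norm_triangle_sub[of ?y "M v"] by (simp add: norm_minus_commute)
        ultimately have "norm ?y \<le> 2 * norm (M v)" using 1 by simp
        then have "\<eta> x * norm ?y \<le> \<eta> x * (2 * norm (M v))" using \<open>\<eta> x \<ge> 0\<close> by (rule mult_left_mono)
        then show ?case using 1 by (simp add: norm_minus_commute)
      qed
      show "((\<lambda>x. 2 * \<eta> x * norm (M v)) \<longlongrightarrow> 0) (at x0)"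
        by (auto intro!: tendsto_eq_intros \<eta>0)
    qed
    then show ?thesis by (simp add: Lim_null[symmetric] M_def)
  qed
  then show ?thesis by (simp add: S continuous_on_eq_continuous_at isCont_def)
qed

lemma Ck_on_inv_linear_family:
  "(\<And>w. Ck_on k S (\<lambda>x. L x w)) \<Longrightarrow> Ck_on k S (\<lambda>x. inv (L x) v)"
proof (induction k arbitrary: v)
  case 0
  then show ?case using continuous_on_inv_linear_family by simp
next
  case (Suc k)
  have cont: "continuous_on S (\<lambda>x. inv (L x) v)" for v
    by (rule continuous_on_inv_linear_family)
      (use Suc.prems in \<open>auto intro!: differentiable_imp_continuous_on differentiable_at_imp_differentiable_on\<close>)
  let ?y = "\<lambda>x. inv (L x) v" and ?dL = "\<lambda>x w h. frechet_derivative (\<lambda>x. L x w) (at x) h"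
  let ?D = "\<lambda>x h. - (\<Sum>b\<in>Basis. \<Sum>c\<in>Basis. ((?y x \<bullet> c) * (?dL x c h \<bullet> b)) *\<^sub>R inv (L x) b)"
  have dL: "((\<lambda>x. L x w) has_derivative ?dL x w) (at x)" if "x \<in> S" for x w
    using Ck_on_SucD[OF Suc.prems that] .
  show ?case
  proof (rule Ck_on_SucI[OF S])
    fix x0 assume x0: "x0 \<in> S"
    define y where "y = ?y x0"
    have Lexp: "L x y = (\<Sum>c\<in>Basis. (y \<bullet> c) *\<^sub>R L x c)" if "x \<in> S" for x
      using linear_Basis_expansion[OF lin[OF that]] by blast
    \<comment> \<open>The resolvent identity with \<open>y\<close> frozen at \<open>x0\<close>. The
      factor \<open>v - L x y\<close> vanishes at \<open>x0\<close>, so continuity of the inverse,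
      already known, suffices to differentiate it.\<close>
    have eq: "?y x = y + (\<Sum>b\<in>Basis. ((v - (\<Sum>c\<in>Basis. (y \<bullet> c) *\<^sub>R L x c)) \<bullet> b) *\<^sub>R inv (L x) b)" if "x \<in> S" for x
    proof -
      have "?y x = y + inv (L x) (v - L x y)"
        using inv_linear_family[OF that] by (simp add: linear_diff)
      then show ?thesis
        using linear_Basis_expansion[OF inv_linear_family(1)[OF that], of "v - L x y"] Lexp[OF that] by simp
    qed
    have "((\<lambda>x. ((v - (\<Sum>c\<in>Basis. (y \<bullet> c) *\<^sub>R L x c)) \<bullet> b) *\<^sub>R inv (L x) b) has_derivative
          (\<lambda>h. ((0 - (\<Sum>c\<in>Basis. (y \<bullet> c) *\<^sub>R ?dL x0 c h)) \<bullet> b) *\<^sub>R inv (L x0) b)) (at x0)" for b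
    proof (rule has_derivative_scaleR_vanishing)
      show "((\<lambda>x. (v - (\<Sum>c\<in>Basis. (y \<bullet> c) *\<^sub>R L x c)) \<bullet> b) has_derivative (\<lambda>h. (0 - (\<Sum>c\<in>Basis. (y \<bullet> c) *\<^sub>R ?dL x0 c h)) \<bullet> b)) (at x0)"
        by (intro has_derivative_inner_left has_derivative_diff has_derivative_const has_derivative_sum has_derivative_scaleR_right dL x0)
      show "(v - (\<Sum>c\<in>Basis. (y \<bullet> c) *\<^sub>R L x0 c)) \<bullet> b = 0"
        using Lexp[OF x0] inv_linear_family(2)[OF x0, of v] by (simp add: y_def)
      show "continuous (at x0) (\<lambda>x. inv (L x) b)"
        using cont[of b] x0 S by (simp add: continuous_on_eq_continuous_at)
    qed
    then have "((\<lambda>x. y + (\<Sum>b\<in>Basis. ((v - (\<Sum>c\<in>Basis. (y \<bullet> c) *\<^sub>R L x c)) \<bullet> b) *\<^sub>R inv (L x) b)) has_derivative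
      (\<lambda>h. 0 + (\<Sum>b\<in>Basis. ((0 - (\<Sum>c\<in>Basis. (y \<bullet> c) *\<^sub>R ?dL x0 c h)) \<bullet> b) *\<^sub>R inv (L x0) b))) (at x0)"
      by (intro has_derivative_add has_derivative_const has_derivative_sum)
    moreover have "(\<lambda>h. 0 + (\<Sum>b\<in>Basis. ((0 - (\<Sum>c\<in>Basis. (y \<bullet> c) *\<^sub>R ?dL x0 c h)) \<bullet> b) *\<^sub>R inv (L x0) b)) = ?D x0"
      by (simp add: y_def inner_sum_left scaleR_sum_left sum_negf)
    ultimately have "((\<lambda>x. y + (\<Sum>b\<in>Basis. ((v - (\<Sum>c\<in>Basis. (y \<bullet> c) *\<^sub>R L x c)) \<bullet> b) *\<^sub>R inv (L x) b)) has_derivative ?D x0) (at x0)"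
      by simp
    then show "(?y has_derivative ?D x0) (at x0)"
      by (rule has_derivative_transform_within_open[OF _ S x0]) (rule eq[symmetric])
  next
    fix h
    have IH: "Ck_on k S (\<lambda>x. inv (L x) b)" for b
      by (rule Suc.IH, rule Ck_on_Suc_imp, rule Suc.prems)
    have "Ck_on k S (\<lambda>x. ?y x \<bullet> c)" for c
      by (rule Ck_on_compose_linear[OF bounded_linear_inner_left S IH])
    moreover have "Ck_on k S (\<lambda>x. ?dL x c h \<bullet> b)" for c b
      by (rule Ck_on_compose_linear[OF bounded_linear_inner_left S]) (use Suc.prems in simp)
    ultimately have "Ck_on k S (\<lambda>x. \<Sum>b\<in>Basis. \<Sum>c\<in>Basis. ((?y x \<bullet> c) * (?dL x c h \<bullet> b)) *\<^sub>R inv (L x) b)"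
      by (intro Ck_on_sum S Ck_on_bilinear[OF bounded_bilinear_scaleR S] Ck_on_bilinear[OF bounded_bilinear_mult S] IH)
    then show "Ck_on k S (\<lambda>x. ?D x h)"
      by (rule Ck_on_compose_linear[OF bounded_linear_minus[OF bounded_linear_ident] S])
  qed
qed

end

text \<open>A global inverse \<open>g\<close> is at hand in every application, so only its
  regularity is at stake. Invariance of domain makes the image open and \<open>g\<close> continuous;
  the derivative of \<open>g\<close> is then the pointwise inverse of that of \<open>f\<close>, and
  the order of smoothness climbs by \<open>Ck_on_inv_linear_family\<close>.\<close>

lemma smooth_inverse:
  fixes f g :: "'a::euclidean_space \<Rightarrow> 'a"
  assumes S: "open S" and f: "\<And>k. Ck_on k S f" and gf: "\<And>x. x \<in> S \<Longrightarrow> g (f x) = x"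
    and inj: "\<And>x. x \<in> S \<Longrightarrow> inj (frechet_derivative f (at x))"
  shows "open (f ` S)" "Ck_on k (f ` S) g"
proof -
  have cf: "continuous_on S f" using f[of 0] by simp
  show o: "open (f ` S)"
    by (rule invariance_of_domain[OF cf S]) (use gf in \<open>metis inj_on_inverseI\<close>)
  have cg: "continuous_on (f ` S) g"
    by (rule continuous_on_inverse_open[OF S cf]) (use gf in auto)
  have gS: "g ` f ` S \<subseteq> S" using gf by auto
  have df: "(f has_derivative frechet_derivative f (at x)) (at x)" if "x \<in> S" for x
    using Ck_on_SucD[OF f that] .
  have lin: "linear (frechet_derivative f (at x))" if "x \<in> S" for x
    using has_derivative_linear[OF df[OF that]] .
  let ?L = "\<lambda>y. frechet_derivative f (at (g y))"
  have fam: "linear (?L y)" "inj (?L y)" if "y \<in> f ` S" for y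
    using that gS lin inj by blast+
  have dg: "(g has_derivative inv (?L y)) (at y)" if y: "y \<in> f ` S" for y
  proof (rule has_derivative_inverse_basic[where f=f and f'="?L y" and T="f ` S"])
    show "(f has_derivative ?L y) (at (g y))" using df gS y by blast
    show "bounded_linear (inv (?L y))"
      using inv_linear_family(1)[of "f ` S" ?L, OF o fam y] linear_conv_bounded_linear by blast
    show "inv (?L y) \<circ> ?L y = id" using fam[OF y] by (simp add: inv_o_cancel)
    show "continuous (at y) g" using cg y o continuous_on_eq_continuous_at by blast
    show "f (g z) = z" if "z \<in> f ` S" for z using that gf by auto
  qed (use o y in auto)
  show "Ck_on k (f ` S) g"
  proof (induction k)
    case 0
    then show ?case using cg by simp
  next
    case (Suc k)
    have fd: "Ck_on k S (\<lambda>x. frechet_derivative f (at x) w)" for w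
      using f[of "Suc k"] by simp
    show ?case
      by (rule Ck_on_SucI[OF o dg], assumption)
        (rule Ck_on_inv_linear_family[OF o fam Ck_on_compose[OF o S gS Suc fd]])
  qed
qed

section \<open>Symmetry of second derivatives\<close>

lemma has_vector_derivative_along_line:
  assumes "(f has_derivative f') (at (x + s *\<^sub>R a))"
  shows "((\<lambda>s. f (x + s *\<^sub>R a)) has_vector_derivative f' a) (at s within T)"
proof -
  have "((\<lambda>s. x + s *\<^sub>R a) has_derivative (\<lambda>h. h *\<^sub>R a)) (at s within T)"
    by (auto intro!: derivative_eq_intros)
  from has_derivative_compose[OF this assms]
  show ?thesis
    by (simp add: has_vector_derivative_def linear_cmul[OF has_derivative_linear[OF assms]])
qed

text \<open>The increment of \<open>f\<close> along \<open>a\<close> is the integral of its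
  \<open>a\<close>-derivative. Differentiating this in direction \<open>b\<close> under the
  integral, and then along \<open>a\<close> by the fundamental theorem of calculus, exchanges the
  two directions.\<close>

lemma second_derivative_symmetric:
  fixes f :: "'a::euclidean_space \<Rightarrow> 'b::banach"
  assumes S: "open S" and f: "Ck_on (Suc (Suc 0)) S f" and x: "x \<in> S"
  shows "frechet_derivative (\<lambda>y. frechet_derivative f (at y) a) (at x) b =
    frechet_derivative (\<lambda>y. frechet_derivative f (at y) b) (at x) a"
proof -
  let ?d = "\<lambda>a y. frechet_derivative f (at y) a"
  let ?dd = "\<lambda>a b y. frechet_derivative (?d a) (at y) b"
  have df: "(f has_derivative (\<lambda>a. ?d a y)) (at y)" if "y \<in> S" for y
    using Ck_on_SucD[OF f that] .
  have ddf: "(?d a has_derivative (\<lambda>b. ?dd a b y)) (at y)" if "y \<in> S" for y a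
    using f that by (intro Ck_on_SucD[of 0 S]) simp
  have cdd: "continuous_on S (?dd a b)" for a b
    using f by simp
  have cd: "continuous_on S (?d a)" for a
    using ddf by (metis S continuous_on_eq_continuous_at has_derivative_continuous)
  obtain r where r: "r > 0" "ball x r \<subseteq> S" using S x openE by blast
  \<comment> \<open>Small enough that \<open>x + s a + t b\<close> stays in the ball of radius
    \<open>r\<close>; the summand 1 keeps the denominator positive when \<open>a\<close> and
    \<open>b\<close> vanish.\<close>
  define e where "e = r / (norm a + norm b + 1)"
  have pos: "norm a + norm b + 1 > 0" by (smt (verit) norm_ge_zero)
  have e: "e > 0" using r pos by (simp add: e_def)
  have inS: "x + s *\<^sub>R a + t *\<^sub>R b \<in> S" if "s \<in> {0..e}" "t \<in> {-e..e}" for s t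
  proof -
    have "norm (s *\<^sub>R a + t *\<^sub>R b) \<le> \<bar>s\<bar> * norm a + \<bar>t\<bar> * norm b"
      by (metis norm_scaleR norm_triangle_ineq)
    also have "\<dots> \<le> e * norm a + e * norm b"
      using that by (intro add_mono mult_right_mono) auto
    also have "\<dots> < e * (norm a + norm b + 1)" using e by (simp add: algebra_simps)
    also have "\<dots> = r" using pos by (simp add: e_def)
    finally have "dist x (x + s *\<^sub>R a + t *\<^sub>R b) < r"
      by (simp add: dist_norm norm_minus_commute add.assoc add.commute)
    then show ?thesis using r by auto
  qed
  have inS0: "x + s *\<^sub>R a \<in> S" if "s \<in> {0..e}" for s
    using inS[OF that, of 0] e by simp
  have cc: "continuous_on ({-e..e} \<times> {0..e}) (\<lambda>(t, s). g (x + s *\<^sub>R a + t *\<^sub>R b))" if "continuous_on S g" for g :: "'a \<Rightarrow> 'b"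
    unfolding split_beta
    by (rule continuous_on_compose2[OF that]) (use inS in \<open>auto intro!: continuous_intros\<close>)
  have cc1: "continuous_on {0..e} (\<lambda>s. g (x + s *\<^sub>R a + t *\<^sub>R b))" if "continuous_on S g" "t \<in> {-e..e}" for g :: "'a \<Rightarrow> 'b" and t
    by (rule continuous_on_compose2[OF that(1)]) (use inS that in \<open>auto intro!: continuous_intros\<close>)
  have int_t: "f (x + s *\<^sub>R a + t *\<^sub>R b) - f (x + t *\<^sub>R b) = integral {0..s} (\<lambda>\<sigma>. ?d a (x + \<sigma> *\<^sub>R a + t *\<^sub>R b))"
    if "s \<in> {0..e}" "t \<in> {-e..e}" for s t
  proof -
    have "((\<lambda>\<sigma>. ?d a (x + \<sigma> *\<^sub>R a + t *\<^sub>R b)) has_integral f (x + s *\<^sub>R a + t *\<^sub>R b) - f (x + 0 *\<^sub>R a + t *\<^sub>R b)) {0..s}"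
    proof (rule fundamental_theorem_of_calculus)
      fix \<sigma> assume "\<sigma> \<in> {0..s}"
      then have "x + t *\<^sub>R b + \<sigma> *\<^sub>R a \<in> S" using inS[of \<sigma> t] that by (auto simp: algebra_simps)
      from has_vector_derivative_along_line[OF df[OF this]]
      show "((\<lambda>\<sigma>. f (x + \<sigma> *\<^sub>R a + t *\<^sub>R b)) has_vector_derivative ?d a (x + \<sigma> *\<^sub>R a + t *\<^sub>R b)) (at \<sigma> within {0..s})"
        by (simp add: algebra_simps)
    qed (use that in auto)
    then show ?thesis by (simp add: has_integral_integrable_integral)
  qed
  have eq: "?d b (x + s *\<^sub>R a) - ?d b x = integral {0..s} (\<lambda>\<sigma>. ?dd a b (x + \<sigma> *\<^sub>R a))" if s: "s \<in> {0..e}" for s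
  proof -
    have "((\<lambda>t. integral (cbox 0 s) (\<lambda>\<sigma>. ?d a (x + \<sigma> *\<^sub>R a + t *\<^sub>R b))) has_vector_derivative
         integral (cbox 0 s) (\<lambda>\<sigma>. ?dd a b (x + \<sigma> *\<^sub>R a + 0 *\<^sub>R b))) (at 0 within {-e..e})"
    proof (rule leibniz_rule_vector_derivative[where fx = "\<lambda>t \<sigma>. ?dd a b (x + \<sigma> *\<^sub>R a + t *\<^sub>R b)"])
      fix t \<sigma> assume "t \<in> {-e..e}" "\<sigma> \<in> cbox 0 s"
      then have "x + \<sigma> *\<^sub>R a + t *\<^sub>R b \<in> S" using inS[of \<sigma> t] s by auto
      from has_vector_derivative_along_line[OF ddf[OF this]]
      show "((\<lambda>t. ?d a (x + \<sigma> *\<^sub>R a + t *\<^sub>R b)) has_vector_derivative ?dd a b (x + \<sigma> *\<^sub>R a + t *\<^sub>R b)) (at t within {-e..e})" .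
    next
      fix t assume "t \<in> {-e..e}"
      from continuous_on_subset[OF cc1[OF cd this], of "cbox 0 s"]
      show "(\<lambda>\<sigma>. ?d a (x + \<sigma> *\<^sub>R a + t *\<^sub>R b)) integrable_on cbox 0 s"
        by (rule integrable_continuous) (use s in auto)
    next
      show "continuous_on ({-e..e} \<times> cbox 0 s) (\<lambda>(t, \<sigma>). ?dd a b (x + \<sigma> *\<^sub>R a + t *\<^sub>R b))"
        by (rule continuous_on_subset[OF cc[OF cdd]]) (use s in auto)
      show "0 \<in> {-e..e}" "convex {-e..e}" using e by auto
    qed
    moreover have "((\<lambda>t. integral (cbox 0 s) (\<lambda>\<sigma>. ?d a (x + \<sigma> *\<^sub>R a + t *\<^sub>R b))) has_vector_derivative
         ?d b (x + s *\<^sub>R a) - ?d b x) (at 0 within {-e..e})"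
    proof (rule has_vector_derivative_transform)
      have "((\<lambda>t. f (x + s *\<^sub>R a + t *\<^sub>R b)) has_vector_derivative ?d b (x + s *\<^sub>R a)) (at 0 within {-e..e})"
        using has_vector_derivative_along_line[of f "\<lambda>b. ?d b (x + s *\<^sub>R a)" "x + s *\<^sub>R a" 0 b] df[OF inS0[OF s]] by simp
      moreover have "((\<lambda>t. f (x + t *\<^sub>R b)) has_vector_derivative ?d b x) (at 0 within {-e..e})"
        using has_vector_derivative_along_line[of f "\<lambda>b. ?d b x" x 0 b] df[OF x] by simp
      ultimately have "((\<lambda>t. f (x + s *\<^sub>R a + t *\<^sub>R b) - f (x + t *\<^sub>R b)) has_vector_derivative ?d b (x + s *\<^sub>R a) - ?d b x) (at 0 within {-e..e})"
        by (rule has_vector_derivative_diff)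
      then show "((\<lambda>t. f (x + s *\<^sub>R a + t *\<^sub>R b) - f (x + t *\<^sub>R b)) has_vector_derivative ?d b (x + s *\<^sub>R a) - ?d b x) (at 0 within {-e..e})" .
    qed (use e s int_t in auto)
    moreover have "at 0 within {-e..e} \<noteq> bot"
      using e by (simp add: trivial_limit_within islimpt_Icc)
    ultimately have "?d b (x + s *\<^sub>R a) - ?d b x = integral (cbox 0 s) (\<lambda>\<sigma>. ?dd a b (x + \<sigma> *\<^sub>R a + 0 *\<^sub>R b))"
      by (metis vector_derivative_unique_within)
    then show ?thesis by simp
  qed
  have "((\<lambda>s. integral {0..s} (\<lambda>\<sigma>. ?dd a b (x + \<sigma> *\<^sub>R a))) has_vector_derivative ?dd a b (x + 0 *\<^sub>R a)) (at 0 within {0..e})"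
    by (rule integral_has_vector_derivative) (use cc1[OF cdd, of 0] e in auto)
  then have 1: "((\<lambda>s. ?d b (x + s *\<^sub>R a) - ?d b x) has_vector_derivative ?dd a b x) (at 0 within {0..e})"
    using e eq by (auto intro: has_vector_derivative_transform)
  have 2: "((\<lambda>s. ?d b (x + s *\<^sub>R a) - ?d b x) has_vector_derivative ?dd b a x - 0) (at 0 within {0..e})"
    by (rule has_vector_derivative_diff[OF _ has_vector_derivative_const])
      (use has_vector_derivative_along_line[of "?d b" "\<lambda>a. ?dd b a x" x 0 a] ddf[OF x] in simp)
  have "at 0 within {0..e} \<noteq> bot"
    using e by (simp add: trivial_limit_within islimpt_Icc)
  from vector_derivative_unique_within[OF this 1 2] show ?thesis by simp
qed

section \<open>The matrix exponential\<close>

lemma bounded_bilinear_matrix_mult: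
  "bounded_bilinear ((**) :: real^'n^'m \<Rightarrow> real^'p^'n \<Rightarrow> real^'p^'m)"
proof -
  have "bilinear ((**) :: real^'n^'m \<Rightarrow> real^'p^'n \<Rightarrow> real^'p^'m)"
    unfolding bilinear_def
    by (auto intro!: linearI simp: matrix_add_ldistrib matrix_scalar_ac scalar_matrix_assoc)
      (simp add: matrix_matrix_mult_def vec_eq_iff distrib_right sum.distrib)
  then show ?thesis by (simp add: bilinear_conv_bounded_bilinear)
qed

interpretation mm: bounded_bilinear "(**) :: real^'n^'m \<Rightarrow> real^'p^'n \<Rightarrow> real^'p^'m"
  by (rule bounded_bilinear_matrix_mult)

lemma linear_transpose: "linear (transpose :: real^'n^'m \<Rightarrow> real^'m^'n)"
  by (rule linearI) (auto simp: transpose_def vec_eq_iff)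

lemma bounded_linear_transpose: "bounded_linear (transpose :: real^'n^'m \<Rightarrow> real^'m^'n)"
  using linear_transpose linear_conv_bounded_linear by blast

lemma bounded_linear_trace: "bounded_linear (trace :: real^'n^'n \<Rightarrow> real)"
  unfolding linear_conv_bounded_linear[symmetric]
  by (rule linearI) (auto simp: trace_def sum.distrib sum_distrib_left)

abbreviation mpow :: "real^'n^'n \<Rightarrow> nat \<Rightarrow> real^'n^'n" where
  "mpow A k \<equiv> (((**) A) ^^ k) (mat 1)"

lemma mpow_commute: "mpow A k ** A = A ** mpow A k"
  by (induction k) (auto simp: matrix_mul_assoc[symmetric])

lemma mpow_scaleR: "mpow (s *\<^sub>R A) k = s ^ k *\<^sub>R mpow A k"
  by (induction k) (auto simp: mm.scaleR_left mm.scaleR_right)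

lemma mpow_transpose: "transpose (mpow A k) = mpow (transpose A) k"
  by (induction k) (auto simp: matrix_transpose_mul mpow_commute)

lemma mpow_conj:
  fixes A P Q :: "real^'n^'n"
  assumes "Q ** P = mat 1" "P ** Q = mat 1"
  shows "mpow (P ** A ** Q) k = P ** mpow A k ** Q"
proof (induction k)
  case 0
  then show ?case using assms by simp
next
  case (Suc k)
  have "P ** A ** Q ** (P ** mpow A k ** Q) = P ** A ** (Q ** P) ** mpow A k ** Q"
    by (simp add: matrix_mul_assoc)
  then show ?case using Suc assms by (simp add: matrix_mul_assoc)
qed

lemma mpow_norm_bound:
  obtains K where "K > 0" "\<And>(A :: real^'n^'n) k. norm (mpow A k) \<le> norm (mat 1 :: real^'n^'n) * (K * norm A) ^ k"
proof -
  obtain K where K: "K > 0" "\<And>(A :: real^'n^'n) (B :: real^'n^'n). norm (A ** B) \<le> norm A * norm B * K"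
    using mm.pos_bounded by blast
  have "norm (mpow A k) \<le> norm (mat 1 :: real^'n^'n) * (K * norm A) ^ k" for A :: "real^'n^'n" and k
  proof (induction k)
    case (Suc k)
    have "norm (mpow A (Suc k)) \<le> norm A * norm (mpow A k) * K"
      using K(2)[of A "mpow A k"] by simp
    also have "\<dots> \<le> norm A * (norm (mat 1 :: real^'n^'n) * (K * norm A) ^ k) * K"
      using Suc K(1) by (intro mult_right_mono mult_left_mono) auto
    finally show ?case by (simp add: mult_ac)
  qed simp
  then show thesis using K(1) that by blast
qed

text \<open>The bound is uniform on balls, so one majorant serves both the convergence of the series
  and the continuity of its sum.\<close>

lemma mexp_term_norm_bound:
  obtains K C where "K > 0" "C \<ge> 0" "\<And>(A :: real^'n^'n) k r. norm A \<le> r \<Longrightarrow> norm ((1 / fact k) *\<^sub>R mpow A k) \<le> C * ((K * r) ^ k / fact k)"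
proof -
  obtain K where K: "K > 0" "\<And>(A :: real^'n^'n) k. norm (mpow A k) \<le> norm (mat 1 :: real^'n^'n) * (K * norm A) ^ k"
    using mpow_norm_bound by blast
  have "norm ((1 / fact k) *\<^sub>R mpow A k) \<le> norm (mat 1 :: real^'n^'n) * ((K * r) ^ k / fact k)"
    if "norm A \<le> r" for A :: "real^'n^'n" and k r
  proof -
    have "norm (mpow A k) \<le> norm (mat 1 :: real^'n^'n) * (K * r) ^ k"
      using K(1) that by (intro order_trans[OF K(2)] mult_left_mono power_mono) auto
    then show ?thesis by (simp add: divide_right_mono)
  qed
  then show thesis using that[of K "norm (mat 1 :: real^'n^'n)"] K(1) by simp
qed

lemma summable_pow_fact: "summable (\<lambda>k. C * (x ^ k / fact k :: real))"
  using summable_exp[of x] by (intro summable_mult) (simp add: field_simps)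

lemma mexp_sums: "(\<lambda>k. (1 / fact k) *\<^sub>R mpow A k) sums mexp (A :: real^'n^'n)"
proof -
  obtain K C where K: "K > 0" "C \<ge> 0" "\<And>(A :: real^'n^'n) k r. norm A \<le> r \<Longrightarrow> norm ((1 / fact k) *\<^sub>R mpow A k) \<le> C * ((K * r) ^ k / fact k)"
    using mexp_term_norm_bound by blast
  have "summable (\<lambda>k. (1 / fact k) *\<^sub>R mpow A k)"
    by (rule summable_comparison_test'[OF summable_pow_fact[of C "K * norm A"], of 0]) (rule K(3), simp)
  then show ?thesis by (simp add: mexp_def summable_sums)
qed

lemma mexp_0 [simp]: "mexp (0 :: real^'n^'n) = mat 1"
proof (rule sums_unique2[OF mexp_sums])
  have "(\<lambda>k. (1 / fact k) *\<^sub>R mpow 0 k) = (\<lambda>k. if k = 0 then mat 1 else (0 :: real^'n^'n))"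
    by (rule ext) (auto simp: gr0_conv_Suc mm.zero_left)
  then show "(\<lambda>k. (1 / fact k) *\<^sub>R mpow 0 k) sums (mat 1 :: real^'n^'n)"
    using sums_single[of 0 "\<lambda>_. mat 1 :: real^'n^'n"] by simp
qed

lemma mexp_commute_general:
  fixes A B :: "real^'n^'n"
  assumes "A ** B = B ** A"
  shows "mexp A ** B = B ** mexp A"
proof (rule sums_unique2)
  have "mpow A k ** B = B ** mpow A k" for k
    by (induction k) (auto simp: matrix_mul_assoc[symmetric], metis assms matrix_mul_assoc)
  moreover show "(\<lambda>k. ((1 / fact k) *\<^sub>R mpow A k) ** B) sums (mexp A ** B)"
    by (rule bounded_linear.sums[OF mm.bounded_linear_left mexp_sums])
  have "(\<lambda>k. B ** ((1 / fact k) *\<^sub>R mpow A k)) sums (B ** mexp A)"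
    by (rule bounded_linear.sums[OF mm.bounded_linear_right mexp_sums])
  ultimately show "(\<lambda>k. ((1 / fact k) *\<^sub>R mpow A k) ** B) sums (B ** mexp A)"
    by (simp add: mm.scaleR_left mm.scaleR_right)
qed

lemma mexp_transpose: "transpose (mexp A) = mexp (transpose A)"
  using bounded_linear.sums[OF bounded_linear_transpose mexp_sums[of A]] mexp_sums[of "transpose A"]
  by (simp add: mpow_transpose transpose_scalar sums_unique2)

lemma mexp_conj:
  fixes A P Q :: "real^'n^'n"
  assumes "Q ** P = mat 1"
  shows "mexp (P ** A ** Q) = P ** mexp A ** Q"
proof (rule sums_unique2[OF mexp_sums])
  have "P ** Q = mat 1" using assms matrix_left_right_inverse by metis
  have "bounded_linear (\<lambda>A. P ** A ** Q)"
    by (rule bounded_linear_compose[OF mm.bounded_linear_left mm.bounded_linear_right])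
  from bounded_linear.sums[OF this mexp_sums[of A]]
  show "(\<lambda>k. (1 / fact k) *\<^sub>R mpow (P ** A ** Q) k) sums (P ** mexp A ** Q)"
    using mpow_conj[OF assms \<open>P ** Q = mat 1\<close>] by (simp add: mm.scaleR_left mm.scaleR_right)
qed

text \<open>Along a line each component of the exponential is a scalar power series in
  \<open>s\<close>, which may be differentiated term by term; passing to \<open>diffs\<close> shifts
  the coefficients by one factor \<open>A\<close>.\<close>

lemma mexp_has_vector_derivative:
  "((\<lambda>s. mexp (s *\<^sub>R A)) has_vector_derivative A ** mexp (s *\<^sub>R A)) (at s within T)"
proof -
  have "((\<lambda>s. mexp (s *\<^sub>R A) \<bullet> b) has_real_derivative (A ** mexp (s *\<^sub>R A)) \<bullet> b) (at s)" for b s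
  proof -
    define c where "c k = (mpow A k \<bullet> b) / fact k" for k
    have c: "(\<lambda>k. c k * s ^ k) sums (mexp (s *\<^sub>R A) \<bullet> b)" for s
      using bounded_linear.sums[OF bounded_linear_inner_left mexp_sums[of "s *\<^sub>R A"], of b]
      by (simp add: c_def mpow_scaleR mult.commute)
    have "diffs c = (\<lambda>k. ((A ** mpow A k) \<bullet> b) / fact k)"
      unfolding diffs_def c_def by (rule ext) (simp add: field_simps del: of_nat_Suc)
    moreover have "(\<lambda>k. (A ** ((1 / fact k) *\<^sub>R mpow (s *\<^sub>R A) k)) \<bullet> b) sums ((A ** mexp (s *\<^sub>R A)) \<bullet> b)"
      by (intro bounded_linear.sums[OF bounded_linear_inner_left] bounded_linear.sums[OF mm.bounded_linear_right] mexp_sums)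
    ultimately have "(\<lambda>k. diffs c k * s ^ k) sums ((A ** mexp (s *\<^sub>R A)) \<bullet> b)"
      by (simp add: mpow_scaleR mm.scaleR_right mult.commute)
    moreover have "((\<lambda>s. \<Sum>k. c k * s ^ k) has_real_derivative (\<Sum>k. diffs c k * s ^ k)) (at s)"
      by (rule termdiffs_strong_converges_everywhere) (use c in \<open>auto simp: sums_iff\<close>)
    ultimately show ?thesis using c by (simp add: sums_iff)
  qed
  then have "((\<lambda>s. mexp (s *\<^sub>R A) \<bullet> b) has_derivative (\<lambda>h. (h *\<^sub>R (A ** mexp (s *\<^sub>R A))) \<bullet> b)) (at s within T)" for b
    by (simp add: has_field_derivative_def has_derivative_at_withinI mult_commute_abs)
  then show ?thesis
    unfolding has_vector_derivative_def by (subst has_derivative_componentwise_within) simp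
qed

lemma mexp_has_vector_derivative':
  "((\<lambda>s. mexp (s *\<^sub>R A)) has_vector_derivative mexp (s *\<^sub>R A) ** A) (at s within T)"
proof -
  have "mexp (s *\<^sub>R A) ** A = A ** mexp (s *\<^sub>R A)"
    by (rule mexp_commute_general) (simp add: mm.scaleR_left mm.scaleR_right)
  then show ?thesis using mexp_has_vector_derivative[of A s T] by simp
qed

lemma mexp_has_vector_derivative_chain:
  fixes f :: "real \<Rightarrow> real"
  assumes "(f has_vector_derivative f') (at s within T)"
  shows "((\<lambda>s. mexp (f s *\<^sub>R A)) has_vector_derivative f' *\<^sub>R (A ** mexp (f s *\<^sub>R A))) (at s within T)"
    "((\<lambda>s. mexp (f s *\<^sub>R A)) has_vector_derivative f' *\<^sub>R (mexp (f s *\<^sub>R A) ** A)) (at s within T)"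
  using vector_diff_chain_within[OF assms mexp_has_vector_derivative, of A]
    vector_diff_chain_within[OF assms mexp_has_vector_derivative', of A] by (simp_all add: o_def)

lemma mexp_minus_scaled: "mexp (- (s *\<^sub>R A)) ** mexp (s *\<^sub>R A) = mat 1"
proof -
  have "((\<lambda>s. mexp ((- s) *\<^sub>R A) ** mexp (s *\<^sub>R A)) has_vector_derivative 0) (at s within UNIV)" for s
  proof -
    have "((\<lambda>s. mexp ((- s) *\<^sub>R A) ** mexp (s *\<^sub>R A)) has_vector_derivative
       mexp ((- s) *\<^sub>R A) ** (A ** mexp (s *\<^sub>R A)) + ((- 1) *\<^sub>R (mexp ((- s) *\<^sub>R A) ** A)) ** mexp (s *\<^sub>R A)) (at s within UNIV)"
      by (intro mm.has_vector_derivative mexp_has_vector_derivative mexp_has_vector_derivative_chain)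
        (auto intro!: derivative_eq_intros)
    then show ?thesis by (simp add: matrix_mul_assoc mm.minus_left)
  qed
  from has_vector_derivative_zero_constant[OF convex_UNIV this]
  obtain c where c: "\<And>s. mexp ((- s) *\<^sub>R A) ** mexp (s *\<^sub>R A) = c" by auto
  from c[of 0] have "c = mat 1" by simp
  with c[of s] show ?thesis by simp
qed

lemma mexp_minus [simp]: "mexp (- A) ** mexp A = mat 1" "mexp A ** mexp (- A) = mat 1"
  using mexp_minus_scaled[of 1 A] mexp_minus_scaled[of 1 "- A"] by simp_all

lemma mexp_minus_cancel [simp]:
  "mexp A ** (mexp (- A) ** B) = B" "mexp (- A) ** (mexp A ** B) = B"
  "B ** mexp A ** mexp (- A) = B" "B ** mexp (- A) ** mexp A = B"
  by (simp_all add: matrix_mul_assoc) (simp_all add: matrix_mul_assoc[symmetric])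

text \<open>The factor \<open>exp (- s A)\<close> makes \<open>Y s ** exp (- s A)\<close> constant.
  Besides the law of exponents, this gives the uniqueness of geodesics.\<close>

lemma mexp_ode_unique:
  fixes Y :: "real \<Rightarrow> real^'n^'n"
  assumes "is_interval T" "0 \<in> T" "t \<in> T"
    "\<And>s. s \<in> T \<Longrightarrow> (Y has_vector_derivative Y s ** A) (at s within T)"
  shows "Y t = Y 0 ** mexp (t *\<^sub>R A)"
proof -
  have "((\<lambda>s. Y s ** mexp ((- s) *\<^sub>R A)) has_vector_derivative 0) (at s within T)" if "s \<in> T" for s
  proof -
    have "((\<lambda>s. Y s ** mexp ((- s) *\<^sub>R A)) has_vector_derivative
       Y s ** ((- 1) *\<^sub>R (A ** mexp ((- s) *\<^sub>R A))) + Y s ** A ** mexp ((- s) *\<^sub>R A)) (at s within T)"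
      by (intro mm.has_vector_derivative assms that mexp_has_vector_derivative_chain)
        (auto intro!: derivative_eq_intros)
    then show ?thesis by (simp add: matrix_mul_assoc mm.minus_right)
  qed
  from has_vector_derivative_zero_constant[OF _ this] assms(1)
  obtain c where c: "\<And>s. s \<in> T \<Longrightarrow> Y s ** mexp ((- s) *\<^sub>R A) = c"
    using is_interval_convex by blast
  from c[OF assms(2)] c[OF assms(3)] have "Y t ** mexp (- (t *\<^sub>R A)) = Y 0" by simp
  then have "Y t ** mexp (- (t *\<^sub>R A)) ** mexp (t *\<^sub>R A) = Y 0 ** mexp (t *\<^sub>R A)" by (rule arg_cong)
  then show ?thesis by (simp only: mexp_minus_cancel)
qed

lemma mexp_add_scaled: "mexp ((s + t) *\<^sub>R A) = mexp (s *\<^sub>R A) ** mexp (t *\<^sub>R A)"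
proof -
  have "(\<lambda>t. mexp ((s + t) *\<^sub>R A)) t = (\<lambda>t. mexp ((s + t) *\<^sub>R A)) 0 ** mexp (t *\<^sub>R A)"
  proof (rule mexp_ode_unique[of UNIV])
    fix t :: real
    have "((\<lambda>t. mexp ((s + t) *\<^sub>R A)) has_vector_derivative 1 *\<^sub>R (mexp ((s + t) *\<^sub>R A) ** A)) (at t within UNIV)"
      by (intro mexp_has_vector_derivative_chain) (auto intro!: derivative_eq_intros)
    then show "((\<lambda>t. mexp ((s + t) *\<^sub>R A)) has_vector_derivative mexp ((s + t) *\<^sub>R A) ** A) (at t within UNIV)"
      by simp
  qed auto
  then show ?thesis by simp
qed

lemma continuous_on_mexp: "continuous_on S (mexp :: real^'n^'n \<Rightarrow> _)"
proof -
  obtain K C where K: "K > 0" "C \<ge> 0" "\<And>(A :: real^'n^'n) k r. norm A \<le> r \<Longrightarrow> norm ((1 / fact k) *\<^sub>R mpow A k) \<le> C * ((K * r) ^ k / fact k)"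
    using mexp_term_norm_bound by blast
  have mp: "continuous_on T (\<lambda>A::real^'n^'n. mpow A k)" for k T
    by (induction k) (auto intro!: continuous_intros mm.continuous_on)
  have "continuous_on (ball 0 r) (\<lambda>A. \<Sum>k. (1 / fact k) *\<^sub>R mpow (A :: real^'n^'n) k)" for r :: real
  proof (rule uniform_limit_theorem)
    show "uniform_limit (ball 0 r) (\<lambda>n A. \<Sum>k<n. (1 / fact k) *\<^sub>R mpow (A :: real^'n^'n) k) (\<lambda>A. \<Sum>k. (1 / fact k) *\<^sub>R mpow A k) sequentially"
      by (rule Weierstrass_m_test[OF _ summable_pow_fact[of C "K * r"]]) (use K(3) in auto)
    show "\<forall>\<^sub>F n in sequentially. continuous_on (ball 0 r) (\<lambda>A. \<Sum>k<n. (1 / fact k) *\<^sub>R mpow (A :: real^'n^'n) k)"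
      by (intro always_eventually allI continuous_intros mp)
  qed simp
  then have "isCont (mexp :: real^'n^'n \<Rightarrow> _) A" for A
    unfolding mexp_def[abs_def]
    by (rule continuous_on_interior[of "ball 0 (norm A + 1)"]) simp
  then show ?thesis by (simp add: continuous_at_imp_continuous_on)
qed

section \<open>The differential of the exponential\<close>

definition dexp :: "real^'n^'n \<Rightarrow> real^'n^'n \<Rightarrow> real^'n^'n" where
  "dexp X W = integral {0..1} (\<lambda>s. mexp ((1 - s) *\<^sub>R X) ** W ** mexp (s *\<^sub>R X))"

text \<open>Duhamel's formula: \<open>exp ((1 - s) X) exp (s Y)\<close> runs from
  \<open>exp X\<close> to \<open>exp Y\<close>, and the integrand is its derivative. The formula is
  exact, not just of first order.\<close>

lemma mexp_diff_eq:
  "mexp Y - mexp X = integral {0..1} (\<lambda>s. mexp ((1 - s) *\<^sub>R X) ** (Y - X) ** mexp (s *\<^sub>R Y))"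
proof -
  have "((\<lambda>s. mexp ((1 - s) *\<^sub>R X) ** (Y - X) ** mexp (s *\<^sub>R Y)) has_integral
     (mexp ((1 - 1) *\<^sub>R X) ** mexp (1 *\<^sub>R Y)) - (mexp ((1 - 0) *\<^sub>R X) ** mexp (0 *\<^sub>R Y))) {0..1}"
  proof (rule fundamental_theorem_of_calculus)
    fix s :: real
    have "((\<lambda>s. mexp ((1 - s) *\<^sub>R X) ** mexp (s *\<^sub>R Y)) has_vector_derivative
      mexp ((1 - s) *\<^sub>R X) ** (Y ** mexp (s *\<^sub>R Y)) + ((- 1) *\<^sub>R (mexp ((1 - s) *\<^sub>R X) ** X)) ** mexp (s *\<^sub>R Y)) (at s within {0..1})"
      by (intro mm.has_vector_derivative mexp_has_vector_derivative mexp_has_vector_derivative_chain)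
        (auto intro!: derivative_eq_intros)
    then show "((\<lambda>s. mexp ((1 - s) *\<^sub>R X) ** mexp (s *\<^sub>R Y)) has_vector_derivative
      mexp ((1 - s) *\<^sub>R X) ** (Y - X) ** mexp (s *\<^sub>R Y)) (at s within {0..1})"
      by (simp add: matrix_mul_assoc mm.minus_left mm.diff_left mm.diff_right)
  qed simp
  then show ?thesis by (simp add: has_integral_integrable_integral)
qed

lemma Ck_on_mexp_scaled:
  assumes "Ck_on k UNIV (mexp :: real^'n^'n \<Rightarrow> _)" "Ck_on k S f" "Ck_on k S r" "open S"
  shows "Ck_on k S (\<lambda>p. mexp (r p *\<^sub>R (f p :: real^'n^'n)))"
  by (rule Ck_on_compose[OF assms(4) open_UNIV _ Ck_on_bilinear[OF bounded_bilinear_scaleR assms(4,3,2)] assms(1)]) simp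

lemma Ck_on_dexp_step:
  assumes "Ck_on k UNIV (mexp :: real^'n^'n \<Rightarrow> _)"
  shows "Ck_on k UNIV (\<lambda>Y :: real^'n^'n. integral {0..1} (\<lambda>s. mexp ((1 - s) *\<^sub>R X) ** W ** mexp (s *\<^sub>R Y)))"
    "Ck_on k UNIV (\<lambda>X :: real^'n^'n. dexp X W)"
proof -
  have fst: "Ck_on k UNIV (fst :: (real^'n^'n) \<times> real \<Rightarrow> _)" and snd: "Ck_on k UNIV (snd :: (real^'n^'n) \<times> real \<Rightarrow> _)"
    by (auto intro!: Ck_on_linear bounded_linear_fst bounded_linear_snd)
  have snd': "Ck_on k UNIV (\<lambda>p :: (real^'n^'n) \<times> real. 1 - snd p)"
  proof -
    have "Ck_on k UNIV (\<lambda>p :: (real^'n^'n) \<times> real. 1 + - snd p)"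
      by (intro Ck_on_add Ck_on_const Ck_on_compose_linear[OF bounded_linear_minus[OF bounded_linear_ident] open_UNIV snd] open_UNIV)
    then show ?thesis by simp
  qed
  have 1: "Ck_on k UNIV (\<lambda>p. mexp ((1 - snd p) *\<^sub>R X) ** W ** mexp (snd p *\<^sub>R fst p))"
    by (intro Ck_on_bilinear[OF bounded_bilinear_matrix_mult open_UNIV] Ck_on_mexp_scaled[OF assms] Ck_on_const fst snd snd' open_UNIV)
  have 2: "Ck_on k UNIV (\<lambda>p. mexp ((1 - snd p) *\<^sub>R fst p) ** W ** mexp (snd p *\<^sub>R fst p))"
    by (intro Ck_on_bilinear[OF bounded_bilinear_matrix_mult open_UNIV] Ck_on_mexp_scaled[OF assms] Ck_on_const fst snd snd' open_UNIV)
  show "Ck_on k UNIV (\<lambda>Y :: real^'n^'n. integral {0..1} (\<lambda>s. mexp ((1 - s) *\<^sub>R X) ** W ** mexp (s *\<^sub>R Y)))"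
    using Ck_on_param_integral[OF open_UNIV, of k "\<lambda>p. mexp ((1 - snd p) *\<^sub>R X) ** W ** mexp (snd p *\<^sub>R fst p)" 0 1] 1 by simp
  show "Ck_on k UNIV (\<lambda>X :: real^'n^'n. dexp X W)"
    using Ck_on_param_integral[OF open_UNIV, of k "\<lambda>p. mexp ((1 - snd p) *\<^sub>R fst p) ** W ** mexp (snd p *\<^sub>R fst p)" 0 1] 2
    unfolding dexp_def by simp
qed

lemma continuous_on_dexp_integrand:
  "continuous_on T (\<lambda>s. mexp ((1 - s) *\<^sub>R X) ** W ** mexp (s *\<^sub>R Y))"
  by (intro mm.continuous_on continuous_on_compose2[OF continuous_on_mexp[of UNIV]] continuous_intros) auto

lemma mexp_has_derivative: "(mexp has_derivative dexp X) (at (X :: real^'n^'n) within T)"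
proof -
  \<comment> \<open>By Duhamel's formula the increment of \<open>mexp\<close> is exactly
    \<open>h (Y - X) Y\<close>. Linear in the first argument and continuous in the second, it can be
    differentiated at \<open>Y = X\<close> by
    \<open>has_derivative_scaleR_vanishing\<close>.\<close>
  define h where "h b Y = integral {0..1} (\<lambda>s. mexp ((1 - s) *\<^sub>R X) ** b ** mexp (s *\<^sub>R Y))" for b Y :: "real^'n^'n"
  have lin: "linear (\<lambda>b. h b Y)" for Y
  proof (rule linearI)
    show "h (b + c) Y = h b Y + h c Y" for b c unfolding h_def
      by (subst integral_add[symmetric])
        (auto intro!: integrable_continuous_interval continuous_on_dexp_integrand simp: mm.add_left mm.add_right)
    show "h (r *\<^sub>R b) Y = r *\<^sub>R h b Y" for r b unfolding h_def
      by (subst integral_cmul[symmetric]) (simp add: mm.scaleR_left mm.scaleR_right)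
  qed
  have hexp: "h W Y = (\<Sum>b\<in>Basis. (W \<bullet> b) *\<^sub>R h b Y)" for W Y
    by (rule linear_Basis_expansion[OF lin])
  have cont: "continuous (at X) (h b)" for b
  proof -
    have "Ck_on 0 UNIV (mexp :: real^'n^'n \<Rightarrow> _)" by (simp add: continuous_on_mexp)
    from Ck_on_dexp_step(1)[OF this, of X b] show ?thesis
      by (simp add: h_def[abs_def] continuous_on_eq_continuous_at)
  qed
  have eq: "mexp Y = mexp X + (\<Sum>b\<in>Basis. ((Y - X) \<bullet> b) *\<^sub>R h b Y)" for Y
  proof -
    have "mexp Y - mexp X = h (Y - X) Y" using mexp_diff_eq by (simp add: h_def)
    then have "mexp Y = mexp X + h (Y - X) Y" by (simp only: diff_eq_eq add.commute)
    then show ?thesis using hexp[of "Y - X" Y] by simp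
  qed
  have "((\<lambda>Y. mexp X + (\<Sum>b\<in>Basis. ((Y - X) \<bullet> b) *\<^sub>R h b Y)) has_derivative (\<lambda>W. 0 + (\<Sum>b\<in>Basis. (W \<bullet> b) *\<^sub>R h b X))) (at X)"
    by (intro has_derivative_add has_derivative_const has_derivative_sum has_derivative_scaleR_vanishing cont)
      (auto intro!: derivative_eq_intros)
  moreover have "(\<lambda>W. 0 + (\<Sum>b\<in>Basis. (W \<bullet> b) *\<^sub>R h b X)) = dexp X"
    by (rule ext) (simp only: add_0 hexp[symmetric], simp add: dexp_def h_def)
  ultimately have "((\<lambda>Y. mexp X + (\<Sum>b\<in>Basis. ((Y - X) \<bullet> b) *\<^sub>R h b Y)) has_derivative dexp X) (at X)"
    by simp
  then have "(mexp has_derivative dexp X) (at X)" by (simp only: eq[symmetric])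
  then show ?thesis by (rule has_derivative_at_withinI)
qed

text \<open>A bootstrap: \<open>dexp\<close> is a parameter integral of products of exponentials, so
  \<open>k\<close> orders of smoothness for \<open>mexp\<close> give \<open>k\<close> orders for its
  derivative.\<close>

lemma Ck_on_mexp_UNIV: "Ck_on k UNIV (mexp :: real^'n^'n \<Rightarrow> _)"
proof (induction k)
  case 0
  then show ?case by (simp add: continuous_on_mexp)
next
  case (Suc k)
  show ?case
    by (rule Ck_on_SucI[OF open_UNIV mexp_has_derivative Ck_on_dexp_step(2)[OF Suc]])
qed

lemma Ck_on_mexp: "open S \<Longrightarrow> Ck_on k S f \<Longrightarrow> Ck_on k S (\<lambda>x. mexp (f x))"
  by (rule Ck_on_compose[OF _ open_UNIV _ _ Ck_on_mexp_UNIV]) auto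

lemma Ck_on_dexp: "Ck_on k UNIV (\<lambda>X. dexp X W)"
  by (rule Ck_on_dexp_step(2)[OF Ck_on_mexp_UNIV])

lemma mexp_compose_has_vector_derivative:
  assumes "(f has_vector_derivative f') (at s within T)"
  shows "((\<lambda>s. mexp (f s)) has_vector_derivative dexp (f s) f') (at s within T)"
  using vector_derivative_diff_chain_within[OF assms mexp_has_derivative] by (simp add: o_def)

section \<open>Hyperbolic functions of the adjoint action\<close>

lemmas mat_algebra = matrix_mul_assoc mm.add_left mm.add_right mm.diff_left mm.diff_right
  mm.minus_left mm.minus_right mm.scaleR_left mm.scaleR_right

section \<open>Orthogonal projections and curves in a subspace\<close>

lemma obtain_projection:
  fixes S :: "'a::euclidean_space set"
  assumes "subspace S"
  obtains Q where "bounded_linear Q" "\<And>x. Q x \<in> S" "\<And>x y. y \<in> S \<Longrightarrow> (x - Q x) \<bullet> y = 0" "\<And>x. Q x = x \<longleftrightarrow> x \<in> S"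
proof -
  obtain B where B: "B \<subseteq> S" "pairwise orthogonal B" "\<And>x. x \<in> B \<Longrightarrow> norm x = 1" "independent B" "span B = S"
    using orthonormal_basis_subspace[OF assms] by metis
  have fin: "finite B" using B(4) independent_imp_finite by blast
  define Q where "Q x = (\<Sum>b\<in>B. (x \<bullet> b) *\<^sub>R b)" for x
  have QS: "Q x \<in> S" for x
    unfolding Q_def using assms B(1) by (auto intro!: subspace_sum subspace_scale)
  have lin: "bounded_linear Q"
    unfolding Q_def[abs_def] by (intro bounded_linear_sum bounded_linear_scaleR_left bounded_linear_compose[OF bounded_linear_scaleR_left bounded_linear_inner_left])
  have orth: "(x - Q x) \<bullet> c = 0" if "c \<in> B" for x c
  proof -
    have "Q x \<bullet> c = (\<Sum>b\<in>B. (x \<bullet> b) * (b \<bullet> c))" by (simp add: Q_def inner_sum_left)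
    also have "\<dots> = (\<Sum>b\<in>B. if b = c then x \<bullet> c else 0)"
    proof (rule sum.cong[OF refl])
      fix b assume "b \<in> B"
      then show "(x \<bullet> b) * (b \<bullet> c) = (if b = c then x \<bullet> c else 0)"
        using B(2,3) that by (auto simp: pairwise_def orthogonal_def norm_eq_1)
    qed
    also have "\<dots> = x \<bullet> c" using fin that by simp
    finally show ?thesis by (simp add: inner_diff_left)
  qed
  have orthS: "(x - Q x) \<bullet> y = 0" if "y \<in> S" for x y
  proof -
    have "y \<in> span B" using that B(5) by simp
    then have "orthogonal (x - Q x) y"
      by (rule orthogonal_to_span) (use orth in \<open>auto simp: orthogonal_def\<close>)
    then show ?thesis by (simp add: orthogonal_def)
  qed
  have "Q x = x" if "x \<in> S" for x
  proof -
    have "x - Q x \<in> S" using that QS assms by (simp add: subspace_diff)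
    then have "(x - Q x) \<bullet> (x - Q x) = 0" by (rule orthS)
    then show ?thesis by simp
  qed
  then show thesis using that[of Q] lin QS orthS by metis
qed

text \<open>Membership is tested by the linear functionals vanishing on \<open>S\<close>. As these
  commute with integrals and derivatives, integrals and velocities of curves in \<open>S\<close>
  stay in \<open>S\<close>.\<close>

lemma mem_subspace_iff_orthogonal:
  fixes S :: "'a::euclidean_space set"
  assumes "subspace S"
  shows "x \<in> S \<longleftrightarrow> (\<forall>v. (\<forall>y\<in>S. y \<bullet> v = 0) \<longrightarrow> x \<bullet> v = 0)"
proof
  obtain Q where Q: "\<And>x. Q x \<in> S" "\<And>x y. y \<in> S \<Longrightarrow> (x - Q x) \<bullet> y = 0" "\<And>x. Q x = x \<longleftrightarrow> x \<in> S"
    using obtain_projection[OF assms] by metis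
  assume *: "\<forall>v. (\<forall>y\<in>S. y \<bullet> v = 0) \<longrightarrow> x \<bullet> v = 0"
  have "x \<bullet> (x - Q x) = 0" by (metis * Q(2) inner_commute)
  moreover have "Q x \<bullet> (x - Q x) = 0" by (metis Q(1,2) inner_commute)
  ultimately have "(x - Q x) \<bullet> (x - Q x) = 0" by (simp only: inner_diff_left)
  then show "x \<in> S" by (metis Q(3) inner_eq_zero_iff right_minus_eq)
qed auto

lemma has_integral_inner_right:
  fixes f :: "real \<Rightarrow> 'a::euclidean_space"
  assumes "(f has_integral i) S"
  shows "((\<lambda>s. f s \<bullet> v) has_integral i \<bullet> v) S"
  using has_integral_linear[OF assms bounded_linear_inner_left] by (simp add: o_def)

lemma integral_mem_subspace:
  fixes f :: "real \<Rightarrow> 'a::euclidean_space"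
  assumes "subspace S" "f integrable_on T" "\<And>s. s \<in> T \<Longrightarrow> f s \<in> S"
  shows "integral T f \<in> S"
proof -
  have "integral T f \<bullet> v = 0" if "\<forall>y\<in>S. y \<bullet> v = 0" for v
  proof -
    have "((\<lambda>s. f s \<bullet> v) has_integral integral T f \<bullet> v) T"
      by (rule has_integral_inner_right) (use assms in auto)
    moreover have "((\<lambda>s. f s \<bullet> v) has_integral 0) T"
      by (rule has_integral_is_0) (use assms that in auto)
    ultimately show ?thesis by (rule has_integral_unique)
  qed
  then show ?thesis using mem_subspace_iff_orthogonal[OF assms(1)] by blast
qed

lemma has_vector_derivative_mem_subspace:
  fixes f :: "real \<Rightarrow> 'a::euclidean_space"
  assumes S: "subspace S" and f: "(f has_vector_derivative f') (at t within T)"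
    and mem: "\<And>s. s \<in> T \<Longrightarrow> f s \<in> S" and t: "t \<in> T" "at t within T \<noteq> bot"
  shows "f' \<in> S"
proof -
  have "f' \<bullet> v = 0" if v: "\<forall>y\<in>S. y \<bullet> v = 0" for v
  proof -
    have "((\<lambda>s. f s \<bullet> v) has_vector_derivative f' \<bullet> v) (at t within T)"
      by (rule bounded_linear.has_vector_derivative[OF bounded_linear_inner_left f])
    moreover have "((\<lambda>s. f s \<bullet> v) has_vector_derivative 0) (at t within T)"
      by (rule has_vector_derivative_transform[OF t(1) _ has_vector_derivative_const[of 0]]) (use mem v in auto)
    ultimately show ?thesis using t(2) by (metis vector_derivative_unique_within)
  qed
  then show ?thesis using mem_subspace_iff_orthogonal[OF S] by blast
qed

lemma gronwall_zero:
  fixes g :: "real \<Rightarrow> real"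
  assumes d: "\<And>t. t \<in> {0..b} \<Longrightarrow> (g has_vector_derivative g' t) (at t within {0..b})"
    and le: "\<And>t. t \<in> {0..b} \<Longrightarrow> g' t \<le> M * g t" and "g 0 = 0" and "\<And>t. t \<in> {0..b} \<Longrightarrow> g t \<ge> 0" and t: "t \<in> {0..b}"
  shows "g t = 0"
proof -
  define h where "h t = exp (- (M * t)) * g t" for t
  define h' where "h' t = exp (- (M * t)) * (g' t - M * g t)" for t
  have e: "((\<lambda>t. exp (- (M * t))) has_vector_derivative - (M * exp (- (M * s)))) (at s within {0..b})" for s
    by (auto intro!: derivative_eq_intros simp: has_real_derivative_iff_has_vector_derivative[symmetric])
  have "(h' has_integral h t - h 0) {0..t}"
  proof (rule fundamental_theorem_of_calculus)
    fix s assume "s \<in> {0..t}"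
    then have s: "s \<in> {0..b}" using t by auto
    have "(h has_vector_derivative h' s) (at s within {0..b})"
      unfolding h_def using bounded_bilinear.has_vector_derivative[OF bounded_bilinear_mult e[of s] d[OF s]]
      by (simp add: h'_def algebra_simps)
    then show "(h has_vector_derivative h' s) (at s within {0..t})"
      by (rule has_vector_derivative_within_subset) (use t in auto)
  qed (use t in auto)
  moreover have "h' s \<le> 0" if "s \<in> {0..t}" for s
    unfolding h'_def using le[of s] t that by (intro mult_nonneg_nonpos) auto
  ultimately have "h t - h 0 \<le> 0"
    by (rule has_integral_le[OF _ has_integral_0])
  then have "exp (- (M * t)) * g t \<le> 0" using \<open>g 0 = 0\<close> by (simp add: h_def)
  then have "g t \<le> 0" by (simp add: mult_le_0_iff)
  then show ?thesis using assms(4)[OF t] by simp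
qed

section \<open>The trace inner product and the adjoint action\<close>

lemma inner_trace: "X \<bullet> Y = trace (transpose X ** Y)" for X Y :: "real^'n^'n"
  unfolding trace_def matrix_matrix_mult_def transpose_def inner_vec_def
  by simp (rule sum.swap)

lemma inner_mult_left: "(A ** X) \<bullet> Y = X \<bullet> (transpose A ** Y)" for X Y :: "real^'n^'n"
  by (simp add: inner_trace matrix_transpose_mul matrix_mul_assoc)

lemma inner_mult_right: "(X ** B) \<bullet> Y = X \<bullet> (Y ** transpose B)" for X Y :: "real^'n^'n"
  by (metis (no_types, lifting) inner_trace matrix_mul_assoc matrix_transpose_mul trace_mul_sym)

lemma inner_transpose: "transpose X \<bullet> transpose Y = X \<bullet> Y" for X Y :: "real^'n^'n"
  by (metis inner_commute inner_trace trace_mul_sym transpose_transpose)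

lemma subspace_Sym: "subspace Sym"
  unfolding Sym_def subspace_def
  by (auto simp: linear_add[OF linear_transpose] transpose_scalar linear_0[OF linear_transpose])

lemma Sym_transpose: "X \<in> Sym \<Longrightarrow> transpose X = X" by (simp add: Sym_def)

lemma mexp_Sym: "X \<in> Sym \<Longrightarrow> mexp X \<in> Sym"
  by (simp add: Sym_def mexp_transpose)

text \<open>The operator \<open>exp (s ad X)\<close>. For symmetric \<open>X\<close> the bracket
  with \<open>X\<close> exchanges symmetric and antisymmetric matrices, so it is the even part
  \<open>cosh_ad\<close> that acts on \<open>Sym\<close>.\<close>

definition Ad :: "real^'n^'n \<Rightarrow> real \<Rightarrow> real^'n^'n \<Rightarrow> real^'n^'n" where
  "Ad X s W = mexp (s *\<^sub>R X) ** W ** mexp (- (s *\<^sub>R X))"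

definition cosh_ad :: "real^'n^'n \<Rightarrow> real \<Rightarrow> real^'n^'n \<Rightarrow> real^'n^'n" where
  "cosh_ad X s W = (1/2) *\<^sub>R (Ad X s W + Ad X (- s) W)"

definition sinh_ad :: "real^'n^'n \<Rightarrow> real \<Rightarrow> real^'n^'n \<Rightarrow> real^'n^'n" where
  "sinh_ad X s W = (1/2) *\<^sub>R (Ad X s W - Ad X (- s) W)"

lemma bounded_linear_Ad: "bounded_linear (Ad X s)"
  unfolding Ad_def by (intro bounded_linear_compose[OF mm.bounded_linear_left mm.bounded_linear_right])

lemmas Ad_linear = linear_add[OF bounded_linear.linear[OF bounded_linear_Ad]]
  linear_diff[OF bounded_linear.linear[OF bounded_linear_Ad]]
  linear_cmul[OF bounded_linear.linear[OF bounded_linear_Ad]]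
  linear_0[OF bounded_linear.linear[OF bounded_linear_Ad]]

lemma bounded_linear_cosh_ad: "bounded_linear (cosh_ad X s)"
  unfolding cosh_ad_def by (intro bounded_linear_compose[OF bounded_linear_scaleR_right bounded_linear_add] bounded_linear_Ad)

lemmas cosh_ad_linear = linear_add[OF bounded_linear.linear[OF bounded_linear_cosh_ad]]
  linear_diff[OF bounded_linear.linear[OF bounded_linear_cosh_ad]]
  linear_cmul[OF bounded_linear.linear[OF bounded_linear_cosh_ad]]
  linear_0[OF bounded_linear.linear[OF bounded_linear_cosh_ad]]

lemma Ad_0 [simp]: "Ad X 0 W = W" by (simp add: Ad_def)
lemma cosh_ad_0 [simp]: "cosh_ad X 0 W = W" by (simp add: cosh_ad_def scaleR_2[symmetric])
lemma sinh_ad_0 [simp]: "sinh_ad X 0 W = 0" by (simp add: sinh_ad_def)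

lemma Ad_Ad: "Ad X s (Ad X t W) = Ad X (s + t) W"
proof -
  have "mexp (- ((s + t) *\<^sub>R X)) = mexp (- (t *\<^sub>R X)) ** mexp (- (s *\<^sub>R X))"
    using mexp_add_scaled[of t s "- X"] by (simp add: add.commute)
  then show ?thesis by (simp add: Ad_def mexp_add_scaled matrix_mul_assoc)
qed

lemma Ad_scaleR: "Ad (t *\<^sub>R X) s W = Ad X (s * t) W" by (simp add: Ad_def)
lemma Ad_minus: "Ad (- X) s W = Ad X (- s) W" by (simp add: Ad_def)

lemma Ad_adjoint:
  assumes "X \<in> Sym"
  shows "Ad X s W \<bullet> V = W \<bullet> Ad X s V"
proof -
  have t: "transpose (mexp (s *\<^sub>R X)) = mexp (s *\<^sub>R X)" "transpose (mexp (- (s *\<^sub>R X))) = mexp (- (s *\<^sub>R X))"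
    using assms by (simp_all add: mexp_transpose transpose_scalar Sym_transpose linear_neg[OF linear_transpose])
  have "Ad X s W \<bullet> V = (mexp (s *\<^sub>R X) ** W) \<bullet> (V ** mexp (- (s *\<^sub>R X)))"
    unfolding Ad_def using inner_mult_right t(2) by metis
  also have "\<dots> = W \<bullet> Ad X s V"
    unfolding Ad_def using inner_mult_left t(1) matrix_mul_assoc by metis
  finally show ?thesis .
qed

lemma Ad_transpose: "X \<in> Sym \<Longrightarrow> transpose (Ad X s W) = Ad X (- s) (transpose W)"
  by (simp add: Ad_def matrix_transpose_mul mexp_transpose transpose_scalar Sym_transpose matrix_mul_assoc linear_neg[OF linear_transpose])

lemma Ad_has_vector_derivative:
  "((\<lambda>s. Ad X s W) has_vector_derivative commutator X (Ad X s W)) (at s within T)"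
proof -
  have "((\<lambda>s. mexp (s *\<^sub>R X) ** W ** mexp ((- s) *\<^sub>R X)) has_vector_derivative
     mexp (s *\<^sub>R X) ** W ** ((- 1) *\<^sub>R (mexp ((- s) *\<^sub>R X) ** X)) + (mexp (s *\<^sub>R X) ** 0 + X ** mexp (s *\<^sub>R X) ** W) ** mexp ((- s) *\<^sub>R X)) (at s within T)"
    by (intro mm.has_vector_derivative mexp_has_vector_derivative mexp_has_vector_derivative_chain has_vector_derivative_const)
      (auto intro!: derivative_eq_intros)
  then show ?thesis by (simp add: Ad_def commutator_def mat_algebra mm.zero_right)
qed

lemma bounded_bilinear_commutator: "bounded_bilinear (commutator :: real^'n^'n \<Rightarrow> _)"
proof -
  have "bilinear (commutator :: real^'n^'n \<Rightarrow> _)"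
    unfolding bilinear_def commutator_def
    by (auto intro!: linearI simp: mat_algebra algebra_simps)
  then show ?thesis by (simp add: bilinear_conv_bounded_bilinear)
qed

interpretation cm: bounded_bilinear "commutator :: real^'n^'n \<Rightarrow> _" by (rule bounded_bilinear_commutator)

lemma Ad_has_vector_derivative_minus:
  "((\<lambda>s. Ad X (- s) W) has_vector_derivative - commutator X (Ad X (- s) W)) (at s within T)"
proof -
  have "((\<lambda>s::real. - s) has_vector_derivative - 1) (at s within T)"
    by (auto intro!: derivative_eq_intros)
  from vector_diff_chain_within[OF this Ad_has_vector_derivative, of X W] show ?thesis by (simp add: o_def)
qed

lemma cosh_ad_has_vector_derivative:
  "((\<lambda>s. cosh_ad X s W) has_vector_derivative commutator X (sinh_ad X s W)) (at s within T)"
proof -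
  have "((\<lambda>s. (1/2) *\<^sub>R (Ad X s W + Ad X (- s) W)) has_vector_derivative (1/2) *\<^sub>R (commutator X (Ad X s W) + - commutator X (Ad X (- s) W))) (at s within T)"
    by (intro bounded_linear.has_vector_derivative[OF bounded_linear_scaleR_right] has_vector_derivative_add Ad_has_vector_derivative Ad_has_vector_derivative_minus)
  then show ?thesis by (simp add: cosh_ad_def sinh_ad_def cm.scaleR_right cm.diff_right)
qed

lemma sinh_ad_has_vector_derivative:
  "((\<lambda>s. sinh_ad X s W) has_vector_derivative commutator X (cosh_ad X s W)) (at s within T)"
proof -
  have "((\<lambda>s. (1/2) *\<^sub>R (Ad X s W - Ad X (- s) W)) has_vector_derivative (1/2) *\<^sub>R (commutator X (Ad X s W) - - commutator X (Ad X (- s) W))) (at s within T)"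
    by (intro bounded_linear.has_vector_derivative[OF bounded_linear_scaleR_right] has_vector_derivative_diff Ad_has_vector_derivative Ad_has_vector_derivative_minus)
  then show ?thesis by (simp add: cosh_ad_def sinh_ad_def cm.scaleR_right cm.add_right)
qed

lemma continuous_on_cosh_ad: "continuous_on T (\<lambda>s. cosh_ad X s W)"
  by (rule continuous_on_vector_derivative) (rule cosh_ad_has_vector_derivative)

lemma integrable_cosh_ad: "(\<lambda>s. cosh_ad X s W) integrable_on {a..b}"
  by (rule integrable_continuous_interval[OF continuous_on_cosh_ad])

lemma cosh_ad_even: "cosh_ad X (- s) W = cosh_ad X s W"
  by (simp add: cosh_ad_def add.commute)

lemma cosh_ad_minus: "cosh_ad (- X) s W = cosh_ad X s W"
  by (simp add: cosh_ad_def Ad_minus add.commute)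

lemma cosh_ad_adjoint: "X \<in> Sym \<Longrightarrow> cosh_ad X s W \<bullet> V = W \<bullet> cosh_ad X s V"
  by (simp add: cosh_ad_def inner_add_left inner_add_right Ad_adjoint)

lemma cosh_ad_Sym: "X \<in> Sym \<Longrightarrow> W \<in> Sym \<Longrightarrow> cosh_ad X s W \<in> Sym"
  by (simp add: Sym_def cosh_ad_def transpose_scalar linear_add[OF linear_transpose] Ad_transpose add.commute)

text \<open>Arithmetic-geometric mean inequality for \<open>Ad X (s/2) W\<close> and \<open>Ad X (-s/2) W\<close>.\<close>

lemma cosh_ad_ge:
  assumes "X \<in> Sym"
  shows "cosh_ad X s W \<bullet> W \<ge> W \<bullet> W"
proof -
  let ?a = "Ad X (s/2) W" and ?b = "Ad X (- (s/2)) W"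
  have "Ad X s W \<bullet> W = ?a \<bullet> ?a" using Ad_adjoint[OF assms, of "s/2" ?a W] by (simp add: Ad_Ad)
  moreover have "Ad X (-s) W \<bullet> W = ?b \<bullet> ?b" using Ad_adjoint[OF assms, of "-(s/2)" ?b W] by (simp add: Ad_Ad)
  moreover have "?a \<bullet> ?b = W \<bullet> W" using Ad_adjoint[OF assms, of "s/2" W ?b] by (simp add: Ad_Ad)
  moreover have "(?a - ?b) \<bullet> (?a - ?b) \<ge> 0" by simp
  ultimately show ?thesis by (simp add: cosh_ad_def inner_add_left inner_add_right inner_diff_left inner_diff_right inner_commute)
qed

lemma cosh_ad_cosh_ad: "cosh_ad X s (cosh_ad X t W) = (1/2) *\<^sub>R (cosh_ad X (s + t) W + cosh_ad X (s - t) W)"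
  by (simp add: cosh_ad_def Ad_linear Ad_Ad algebra_simps)

text \<open>Folds the interval from -1/2 to 1/2 at 0, so that an average of \<open>Ad X s\<close>
  over it becomes one of its even part.\<close>

lemma integral_symmetric:
  fixes f :: "real \<Rightarrow> 'a::euclidean_space"
  assumes "continuous_on UNIV f"
  shows "integral {0..1} (\<lambda>s. f (1/2 - s)) = integral {0..1/2} (\<lambda>s. f s + f (- s))"
proof -
  have "continuous_on {-1..1} f" using assms continuous_on_subset by blast
  from antiderivative_continuous[OF this]
  obtain G where G: "\<And>u. u \<in> {-1..1} \<Longrightarrow> (G has_vector_derivative f u) (at u within {-1..1})" by auto
  have chain: "((\<lambda>s. G (c - s)) has_vector_derivative - f (c - s)) (at s within T)"
    if "s \<in> T" "(\<lambda>s. c - s) ` T \<subseteq> {-1..1}" for c s T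
  proof -
    have 1: "((\<lambda>s::real. c - s) has_vector_derivative - 1) (at s within T)"
      by (auto intro!: derivative_eq_intros)
    have "(G has_vector_derivative f (c - s)) (at (c - s) within (\<lambda>s. c - s) ` T)"
      by (rule has_vector_derivative_within_subset[OF G]) (use that in auto)
    from vector_diff_chain_within[OF 1 this] show ?thesis by (simp add: o_def)
  qed
  have "((\<lambda>s. f (1/2 - s)) has_integral (- G (1/2 - 1)) - (- G (1/2 - 0))) {0..1}"
  proof (rule fundamental_theorem_of_calculus)
    fix s :: real assume "s \<in> {0..1}"
    from has_vector_derivative_minus[OF chain[OF this, of "1/2"]]
    show "((\<lambda>s. - G (1/2 - s)) has_vector_derivative f (1/2 - s)) (at s within {0..1})" by auto
  qed simp
  moreover have "((\<lambda>s. f s + f (- s)) has_integral (G (1/2) - G (0 - 1/2)) - (G 0 - G (0 - 0))) {0..1/2}"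
  proof (rule fundamental_theorem_of_calculus)
    fix s :: real assume s: "s \<in> {0..1/2}"
    have "(G has_vector_derivative f s) (at s within {0..1/2})"
      by (rule has_vector_derivative_within_subset[OF G]) (use s in auto)
    from has_vector_derivative_diff[OF this chain[OF s, of 0]]
    show "((\<lambda>s. G s - G (0 - s)) has_vector_derivative f s + f (- s)) (at s within {0..1/2})" by auto
  qed simp
  ultimately show ?thesis by (simp add: has_integral_integrable_integral)
qed

text \<open>The differential of the exponential at \<open>X\<close>, translated to the identity by
  \<open>Y \<mapsto> exp (-X/2) Y exp (-X/2)\<close>; in terms of \<open>ad X\<close> it is \<open>sinh (ad X / 2) / (ad X / 2)\<close>.\<close>

definition dexp_sym :: "real^'n^'n \<Rightarrow> real^'n^'n \<Rightarrow> real^'n^'n" where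
  "dexp_sym X W = 2 *\<^sub>R integral {0..1/2} (\<lambda>s. cosh_ad X s W)"

text \<open>Splitting \<open>exp (X/2)\<close> off both sides of the Duhamel integrand leaves
  \<open>Ad X (1/2 - s) W\<close>. Its parameter runs symmetrically around 0, which is why only the
  hyperbolic cosine survives.\<close>

lemma dexp_eq: "dexp X W = mexp ((1/2) *\<^sub>R X) ** dexp_sym X W ** mexp ((1/2) *\<^sub>R X)"
proof -
  have c: "continuous_on UNIV (\<lambda>s. Ad X s W)"
    by (rule continuous_on_vector_derivative) (rule Ad_has_vector_derivative)
  have "dexp_sym X W = integral {0..1/2} (\<lambda>s. Ad X s W + Ad X (- s) W)"
    unfolding dexp_sym_def by (subst integral_cmul[symmetric]) (simp add: cosh_ad_def)
  also have "\<dots> = integral {0..1} (\<lambda>s. Ad X (1/2 - s) W)"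
    using integral_symmetric[OF c] by simp
  finally have 1: "dexp_sym X W = integral {0..1} (\<lambda>s. Ad X (1/2 - s) W)" .
  have bl: "bounded_linear (\<lambda>Y. mexp ((1/2) *\<^sub>R X) ** Y ** mexp ((1/2) *\<^sub>R X))"
    by (rule bounded_linear_compose[OF mm.bounded_linear_left mm.bounded_linear_right])
  have "continuous_on {0..1} (\<lambda>s. Ad X (1/2 - s) W)"
    by (rule continuous_on_compose2[OF c]) (auto intro!: continuous_intros)
  then have "(\<lambda>s. Ad X (1/2 - s) W) integrable_on {0..1}" by (rule integrable_continuous_interval)
  from integral_linear[OF this bl] 1
  have "mexp ((1/2) *\<^sub>R X) ** dexp_sym X W ** mexp ((1/2) *\<^sub>R X) =
    integral {0..1} (\<lambda>s. mexp ((1/2) *\<^sub>R X) ** Ad X (1/2 - s) W ** mexp ((1/2) *\<^sub>R X))"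
    by (simp add: o_def)
  also have "\<dots> = dexp X W"
    unfolding dexp_def
  proof (rule integral_cong)
    fix s :: real
    have "mexp ((1 - s) *\<^sub>R X) = mexp ((1/2) *\<^sub>R X) ** mexp ((1/2 - s) *\<^sub>R X)"
      using mexp_add_scaled[of "1/2" "1/2 - s" X] by simp
    moreover have "- ((1/2 - s) *\<^sub>R X) = (s - 1/2) *\<^sub>R X" by (simp add: algebra_simps)
    then have "mexp (s *\<^sub>R X) = mexp (- ((1/2 - s) *\<^sub>R X)) ** mexp ((1/2) *\<^sub>R X)"
      using mexp_add_scaled[of "s - 1/2" "1/2" X] by simp
    ultimately show "mexp ((1/2) *\<^sub>R X) ** Ad X (1/2 - s) W ** mexp ((1/2) *\<^sub>R X) = mexp ((1 - s) *\<^sub>R X) ** W ** mexp (s *\<^sub>R X)"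
      by (simp add: Ad_def matrix_mul_assoc)
  qed
  finally show ?thesis ..
qed

section \<open>Self-adjointness and positivity of the symmetrised differential\<close>

lemma dexp_sym_inner: "dexp_sym X W \<bullet> V = 2 * integral {0..1/2} (\<lambda>s. cosh_ad X s W \<bullet> V)"
  using has_integral_inner_right[OF integrable_integral[OF integrable_cosh_ad[of X W 0 "1/2"]], of V]
  by (simp add: dexp_sym_def has_integral_integrable_integral)

lemma bounded_linear_dexp_sym: "bounded_linear (dexp_sym X)"
proof -
  have "linear (dexp_sym X)"
  proof (rule linearI)
    show "dexp_sym X (V + W) = dexp_sym X V + dexp_sym X W" for V W
      by (simp add: dexp_sym_def cosh_ad_linear integral_add integrable_cosh_ad scaleR_add_right)
    show "dexp_sym X (r *\<^sub>R W) = r *\<^sub>R dexp_sym X W" for r W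
      by (simp add: dexp_sym_def cosh_ad_linear)
  qed
  then show ?thesis using linear_conv_bounded_linear by blast
qed

lemmas dexp_sym_linear = linear_add[OF bounded_linear.linear[OF bounded_linear_dexp_sym]]
  linear_diff[OF bounded_linear.linear[OF bounded_linear_dexp_sym]]
  linear_cmul[OF bounded_linear.linear[OF bounded_linear_dexp_sym]]
  linear_0[OF bounded_linear.linear[OF bounded_linear_dexp_sym]]

lemma dexp_sym_adjoint:
  assumes "X \<in> Sym"
  shows "dexp_sym X W \<bullet> V = W \<bullet> dexp_sym X V"
proof -
  have "(\<lambda>s. cosh_ad X s W \<bullet> V) = (\<lambda>s. cosh_ad X s V \<bullet> W)"
    using cosh_ad_adjoint[OF assms] by (metis inner_commute)
  then show ?thesis
    using dexp_sym_inner[of X W V] dexp_sym_inner[of X V W] by (simp only: inner_commute[of W])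
qed

lemma dexp_sym_ge:
  assumes "X \<in> Sym"
  shows "dexp_sym X W \<bullet> W \<ge> W \<bullet> W"
proof -
  have "integral {0..1/2::real} (\<lambda>s. W \<bullet> W) \<le> integral {0..1/2} (\<lambda>s. cosh_ad X s W \<bullet> W)"
    by (rule integral_le) (auto intro!: integrable_continuous_interval continuous_intros continuous_on_cosh_ad cosh_ad_ge assms)
  then show ?thesis by (simp add: dexp_sym_inner)
qed

text \<open>The form in which nonpositive curvature enters: through it the logarithm does not
  increase lengths, \<open>dexp_sym X\<close> is injective, and equations for
  \<open>dexp_sym X\<close> have bounded solutions.\<close>

lemma norm_dexp_sym_ge:
  assumes "X \<in> Sym"
  shows "norm W \<le> norm (dexp_sym X W)"
proof -
  have "norm W * norm W \<le> dexp_sym X W \<bullet> W"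
    using dexp_sym_ge[OF assms, of W] by (simp add: dot_square_norm power2_eq_square)
  also have "\<dots> \<le> norm (dexp_sym X W) * norm W" by (rule norm_cauchy_schwarz)
  finally show ?thesis by (cases "norm W = 0") auto
qed

lemma dexp_sym_eq_0: "X \<in> Sym \<Longrightarrow> dexp_sym X W = 0 \<longleftrightarrow> W = 0"
  using norm_dexp_sym_ge[of X W] by (auto simp: dexp_sym_linear)

lemma dexp_sym_inj: "X \<in> Sym \<Longrightarrow> dexp_sym X V = dexp_sym X W \<longleftrightarrow> V = W"
  using dexp_sym_eq_0[of X "V - W"] by (simp add: dexp_sym_linear)

lemma dexp_sym_self: "dexp_sym X X = X"
proof -
  have "Ad X s X = X" for s
  proof -
    have "mexp (s *\<^sub>R X) ** X = X ** mexp (s *\<^sub>R X)" by (rule mexp_commute_general) (simp add: mat_algebra)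
    then show ?thesis by (simp add: Ad_def)
  qed
  then show ?thesis by (simp add: dexp_sym_def cosh_ad_def scaleR_2[symmetric])
qed

lemma dexp_sym_minus: "dexp_sym (- X) W = dexp_sym X W"
  by (simp add: dexp_sym_def cosh_ad_minus)

lemma dexp_sym_mem:
  assumes "subspace S" "\<And>s. cosh_ad X s W \<in> S"
  shows "dexp_sym X W \<in> S"
  unfolding dexp_sym_def
  by (intro subspace_scale assms integral_mem_subspace integrable_cosh_ad)

lemma dexp_sym_Sym: "X \<in> Sym \<Longrightarrow> W \<in> Sym \<Longrightarrow> dexp_sym X W \<in> Sym"
  by (intro dexp_sym_mem subspace_Sym cosh_ad_Sym)

text \<open>Moves the scaling of \<open>X\<close> into the upper limit of the integral. With
  \<open>X\<close> fixed, the dependence on \<open>t\<close> can be differentiated.\<close>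

lemma dexp_sym_scaled: "t *\<^sub>R dexp_sym (t *\<^sub>R X) W = 2 *\<^sub>R integral {0..t/2} (\<lambda>s. cosh_ad X s W)" if "t > 0"
proof -
  have "((\<lambda>s. cosh_ad X s W) has_integral integral {0..t/2} (\<lambda>s. cosh_ad X s W)) (cbox 0 (t/2))"
    using integrable_integral[OF integrable_cosh_ad] by simp
  from has_integral_affinity'[OF this that, of 0]
  have "((\<lambda>s. cosh_ad X (t * s + 0) W) has_integral integral {0..t/2} (\<lambda>s. cosh_ad X s W) /\<^sub>R t) {0..1/2}"
    using that by simp
  moreover have "cosh_ad X (t * s + 0) W = cosh_ad (t *\<^sub>R X) s W" for s
    by (simp add: cosh_ad_def Ad_scaleR mult.commute)
  ultimately show ?thesis using that by (simp add: dexp_sym_def has_integral_integrable_integral)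
qed

text \<open>The curve \<open>cosh_ad X s W\<close> solves \<open>y'' = (ad X)^2 y\<close>. Since
  \<open>(ad X)^2\<close> preserves \<open>E\<close>, the component of \<open>y\<close> orthogonal
  to \<open>E\<close> solves a closed linear equation of second order with zero initial values; its
  energy \<open>g\<close> vanishes by Gronwall. Negative times follow from evenness.\<close>

lemma cosh_ad_mem:
  assumes E: "subspace E" and ad: "\<And>W. W \<in> E \<Longrightarrow> commutator X (commutator X W) \<in> E" and W: "W \<in> E"
  shows "cosh_ad X s W \<in> E"
proof -
  obtain Q where Q: "bounded_linear Q" "\<And>x. Q x \<in> E" "\<And>x. Q x = x \<longleftrightarrow> x \<in> E"
    using obtain_projection[OF E] by metis
  define P where "P x = x - Q x" for x
  have P: "bounded_linear P" unfolding P_def by (intro bounded_linear_sub bounded_linear_ident Q)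
  interpret P: bounded_linear P by (rule P)
  have P0: "P x = 0 \<longleftrightarrow> x \<in> E" for x using Q(3)[of x] by (auto simp: P_def)
  define A where "A x = P (commutator X (commutator X x))" for x
  have "bounded_linear A" unfolding A_def
    by (intro bounded_linear_compose[OF P] bounded_linear_compose[OF cm.bounded_linear_right] cm.bounded_linear_right)
  then obtain K where K: "K > 0" "\<And>x. norm (A x) \<le> norm x * K" using bounded_linear.pos_bounded by blast
  \<comment> \<open>Invariance of \<open>E\<close> enters only here: the part of \<open>x\<close> in
    \<open>E\<close> is mapped into \<open>E\<close>, where \<open>P\<close> vanishes, so the
    equation for \<open>r\<close> closes.\<close>
  have AP: "A (P x) = A x" for x
    using P0[of "commutator X (commutator X (Q x))"] ad[OF Q(2)]
    by (simp add: A_def P_def[of x] cm.diff_right P.diff)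
  define r where "r s = P (cosh_ad X s W)" for s
  define q where "q s = P (commutator X (sinh_ad X s W))" for s
  define g where "g s = r s \<bullet> r s + q s \<bullet> q s" for s
  define g' where "g' s = 2 * (r s \<bullet> q s) + 2 * (q s \<bullet> A (r s))" for s
  have r': "(r has_vector_derivative q s) (at s within T)" for s T
    unfolding r_def q_def by (rule P.has_vector_derivative[OF cosh_ad_has_vector_derivative])
  have q': "(q has_vector_derivative A (r s)) (at s within T)" for s T
    unfolding r_def AP unfolding q_def A_def
    by (intro P.has_vector_derivative bounded_linear.has_vector_derivative[OF cm.bounded_linear_right] sinh_ad_has_vector_derivative)
  have "g t = 0" if t: "t \<in> {0..t}" for t
  proof (rule gronwall_zero[OF _ _ _ _ t])
    fix s
    have "(g has_vector_derivative (r s \<bullet> q s + q s \<bullet> r s) + (q s \<bullet> A (r s) + A (r s) \<bullet> q s)) (at s within {0..t})"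
      unfolding g_def by (intro has_vector_derivative_add bounded_bilinear.has_vector_derivative[OF bounded_bilinear_inner] r' q')
    then show "(g has_vector_derivative g' s) (at s within {0..t})"
      by (simp add: g'_def inner_commute)
    have 1: "2 * (r s \<bullet> q s) \<le> r s \<bullet> r s + q s \<bullet> q s"
      using inner_ge_zero[of "r s - q s"] by (simp add: inner_diff_left inner_diff_right inner_commute)
    have "2 * (q s \<bullet> A (r s)) \<le> 2 * (norm (q s) * (norm (r s) * K))"
      using norm_cauchy_schwarz[of "q s" "A (r s)"] mult_left_mono[OF K(2)[of "r s"], of "norm (q s)"] by simp
    also have "\<dots> = K * (2 * norm (q s) * norm (r s))" by simp
    also have "\<dots> \<le> K * (norm (q s) ^ 2 + norm (r s) ^ 2)"
      using K(1) sum_squares_bound[of "norm (q s)" "norm (r s)"] by (intro mult_left_mono) auto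
    finally show "g' s \<le> (1 + K) * g s" using 1
      by (simp add: g'_def g_def dot_square_norm algebra_simps)
    show "g s \<ge> 0" by (simp add: g_def)
  next
    show "g 0 = 0" using W P0 by (simp add: g_def r_def q_def cm.zero_right P.zero)
  qed
  from this[of "\<bar>s\<bar>"] have "r \<bar>s\<bar> \<bullet> r \<bar>s\<bar> = 0"
    by (simp add: g_def add_nonneg_eq_0_iff)
  then have "cosh_ad X \<bar>s\<bar> W \<in> E" using P0 by (simp add: r_def)
  then show ?thesis using cosh_ad_even[of X s W] by (cases "s \<ge> 0") auto
qed

section \<open>Positive definite matrices and the matrix logarithm\<close>

lemma matrix_inv_works:
  assumes "invertible (A :: real^'n^'n)"
  shows "matrix_inv A ** A = mat 1" "A ** matrix_inv A = mat 1"
proof -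
  have "A ** matrix_inv A = mat 1 \<and> matrix_inv A ** A = mat 1"
    unfolding matrix_inv_def by (rule someI_ex) (use assms in \<open>simp add: invertible_def\<close>)
  then show "matrix_inv A ** A = mat 1" "A ** matrix_inv A = mat 1" by auto
qed

lemma matrix_inv_unique:
  assumes "(A :: real^'n^'n) ** B = mat 1"
  shows "invertible A" "matrix_inv A = B"
proof -
  show inv: "invertible A" using assms invertible_right_inverse by blast
  have "matrix_inv A = matrix_inv A ** (A ** B)" using assms by simp
  also have "\<dots> = B" using matrix_inv_works[OF inv] by (simp add: matrix_mul_assoc)
  finally show "matrix_inv A = B" .
qed

lemma invertible_mexp [simp]: "invertible (mexp A)"
  using matrix_inv_unique(1)[OF mexp_minus(2)] .

lemma matrix_inv_mexp [simp]: "matrix_inv (mexp A) = mexp (- A)"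
  using matrix_inv_unique(2)[OF mexp_minus(2)] .

lemma open_GL: "open (GL :: (real^'n^'n) set)"
proof -
  have "continuous_on UNIV (det :: real^'n^'n \<Rightarrow> real)"
    unfolding det_def[abs_def] by (intro continuous_intros)
  then have "open {A :: real^'n^'n. det A \<noteq> 0}"
    by (intro open_Collect_neq continuous_intros)
  then show ?thesis by (simp add: GL_def invertible_det_nz)
qed

text \<open>The inverse of \<open>A\<close> is the solution \<open>B\<close> of
  \<open>A ** B = mat 1\<close>, an instance of inverting a linear family that depends smoothly on
  \<open>A\<close>.\<close>

lemma Ck_on_matrix_inv: "Ck_on k GL (matrix_inv :: real^'n^'n \<Rightarrow> _)"
proof -
  have lin: "linear ((**) A)" for A :: "real^'n^'n"
    by (rule bounded_linear.linear[OF mm.bounded_linear_right])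
  have inj: "inj ((**) A)" if "A \<in> GL" for A :: "real^'n^'n"
    by (rule inj_on_inverseI[of _ "(**) (matrix_inv A)"]) (use that in \<open>simp add: matrix_mul_assoc matrix_inv_works GL_def\<close>)
  have "Ck_on k GL (\<lambda>A :: real^'n^'n. A ** W)" for W :: "real^'n^'n"
    by (rule Ck_on_linear[OF mm.bounded_linear_left open_GL])
  from Ck_on_inv_linear_family[OF open_GL lin inj this]
  have "Ck_on k GL (\<lambda>A :: real^'n^'n. inv ((**) A) (mat 1))" by blast
  moreover have "matrix_inv A = inv ((**) A) (mat 1)" if "A \<in> GL" for A :: "real^'n^'n"
    using that by (intro inv_f_eq[symmetric] inj) (auto simp: GL_def matrix_inv_works)
  ultimately show ?thesis
    by (subst Ck_on_cong[OF open_GL, where g = "\<lambda>A. inv ((**) A) (mat 1)"]) auto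
qed

section \<open>The cone of positive definite matrices and injectivity of the exponential on
  \<open>Sym\<close>\<close>

lemma SPD_Sym: "A \<in> SPD \<Longrightarrow> A \<in> Sym" by (simp add: SPD_def)

lemma SPD_invertible: "A \<in> SPD \<Longrightarrow> invertible (A :: real^'n^'n)"
  unfolding invertible_left_inverse matrix_left_invertible_ker SPD_def
  by (metis (mono_tags, lifting) inner_zero_right less_irrefl mem_Collect_eq)

lemma SPD_subset_GL: "SPD \<subseteq> GL" using SPD_invertible by (auto simp: GL_def)

lemma SPD_congruence:
  fixes A g :: "real^'n^'n"
  assumes "A \<in> SPD" "invertible g"
  shows "g ** A ** transpose g \<in> SPD"
proof -
  have "v \<bullet> ((g ** A ** transpose g) *v v) > 0" if "v \<noteq> 0" for v
  proof -
    have "v \<bullet> ((g ** A ** transpose g) *v v) = (transpose g *v v) \<bullet> (A *v (transpose g *v v))"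
      by (simp add: matrix_vector_mul_assoc[symmetric] dot_lmul_matrix del: transpose_matrix_vector)
        (simp add: dot_lmul_matrix)
    moreover have "invertible (transpose g)" using assms(2) transpose_invertible by blast
    then have "transpose g *v v \<noteq> 0"
      using that unfolding invertible_left_inverse matrix_left_invertible_ker by blast
    ultimately show ?thesis using assms(1) by (simp add: SPD_def)
  qed
  then show ?thesis
    using assms(1) by (auto simp: SPD_def Sym_def matrix_transpose_mul matrix_mul_assoc)
qed

lemma mat_1_SPD [simp]: "mat 1 \<in> SPD" by (simp add: SPD_def Sym_def)

lemma mexp_double: "mexp ((1/2) *\<^sub>R X) ** mexp ((1/2) *\<^sub>R X) = mexp X"
  using mexp_add_scaled[of "1/2" "1/2" X] by simp

lemma mexp_SPD: "X \<in> Sym \<Longrightarrow> mexp X \<in> SPD"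
  using SPD_congruence[OF mat_1_SPD invertible_mexp[of "(1/2) *\<^sub>R X"]]
  by (simp add: mexp_transpose transpose_scalar Sym_transpose mexp_double)

text \<open>Keeps \<open>1 + s (y - 1)\<close> invertible along the whole path on which the
  logarithm of \<open>y\<close> is obtained as an integral.\<close>

lemma SPD_convex_comb:
  assumes "A \<in> SPD" "B \<in> SPD" "s \<in> {0..1}"
  shows "(1 - s) *\<^sub>R A + s *\<^sub>R B \<in> SPD"
proof -
  have "v \<bullet> (((1 - s) *\<^sub>R A + s *\<^sub>R B) *v v) > 0" if "v \<noteq> 0" for v
  proof -
    have a: "v \<bullet> (A *v v) > 0" and b: "v \<bullet> (B *v v) > 0" using assms that by (auto simp: SPD_def)
    have "v \<bullet> (((1 - s) *\<^sub>R A + s *\<^sub>R B) *v v) = (1 - s) * (v \<bullet> (A *v v)) + s * (v \<bullet> (B *v v))"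
      by (simp add: matrix_vector_mult_add_rdistrib inner_add_right scaleR_matrix_vector_assoc[symmetric])
    moreover have "\<dots> > 0"
    proof (cases "s = 0")
      case True then show ?thesis using a by simp
    next
      case False
      then have "s * (v \<bullet> (B *v v)) > 0" using b assms(3) by simp
      moreover have "(1 - s) * (v \<bullet> (A *v v)) \<ge> 0" using a assms(3) by simp
      ultimately show ?thesis by simp
    qed
    ultimately show ?thesis by simp
  qed
  moreover have "(1 - s) *\<^sub>R A + s *\<^sub>R B \<in> Sym"
    using assms by (intro subspace_add subspace_scale subspace_Sym SPD_Sym)
  ultimately show ?thesis by (simp add: SPD_def)
qed

text \<open>The inner product is the sum over the rows \<open>d\<close> of \<open>D\<close> of the
  values \<open>d \<bullet> Q d\<close>.\<close>

lemma inner_mult_SPD: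
  fixes D Q :: "real^'n^'n"
  assumes "Q \<in> SPD"
  shows "D \<bullet> (D ** Q) \<ge> 0" "D \<bullet> (D ** Q) = 0 \<Longrightarrow> D = 0"
proof -
  have sym: "Q $ i $ j = Q $ j $ i" for i j
    using Sym_transpose[OF SPD_Sym[OF assms]] by (metis transpose_def vec_lambda_beta)
  have "(D ** Q) $ i = Q *v (D $ i)" for i
    by (simp add: vec_eq_iff matrix_matrix_mult_def matrix_vector_mult_def sym mult.commute)
  then have eq: "D \<bullet> (D ** Q) = (\<Sum>i\<in>UNIV. (D $ i) \<bullet> (Q *v (D $ i)))"
    by (simp add: inner_vec_def[of D])
  have nn: "v \<bullet> (Q *v v) \<ge> 0" for v
    using assms by (cases "v = 0") (auto simp: SPD_def less_imp_le)
  show "D \<bullet> (D ** Q) \<ge> 0" unfolding eq by (intro sum_nonneg nn)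
  assume "D \<bullet> (D ** Q) = 0"
  then have "(D $ i) \<bullet> (Q *v (D $ i)) = 0" for i
    unfolding eq by (subst (asm) sum_nonneg_eq_0_iff) (auto simp: nn)
  then have "D $ i = 0" for i
    using assms unfolding SPD_def by (metis (mono_tags, lifting) less_irrefl mem_Collect_eq)
  then show "D = 0" by (simp add: vec_eq_iff)
qed

text \<open>With \<open>D = P - Q\<close>, equality of the squares reads
  \<open>P D + D Q = 0\<close>. Pairing with \<open>D\<close> gives two nonnegative terms with sum
  zero.\<close>

lemma SPD_square_inj:
  fixes P Q :: "real^'n^'n"
  assumes "P \<in> SPD" "Q \<in> SPD" "P ** P = Q ** Q"
  shows "P = Q"
proof -
  let ?D = "P - Q"
  have tD: "transpose ?D = ?D" and tP: "transpose P = P"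
    using assms by (simp_all add: linear_diff[OF linear_transpose] Sym_transpose[OF SPD_Sym])
  have "P ** ?D + ?D ** Q = 0" using assms(3) by (simp add: mm.diff_left mm.diff_right)
  then have "?D \<bullet> (P ** ?D) + ?D \<bullet> (?D ** Q) = 0" by (metis inner_add_right inner_zero_right)
  moreover have "?D \<bullet> (P ** ?D) = ?D \<bullet> (?D ** P)"
    using inner_transpose[of ?D "P ** ?D"] tD tP by (simp add: matrix_transpose_mul)
  ultimately have "?D \<bullet> (?D ** Q) = 0"
    using inner_mult_SPD(1)[OF assms(1), of ?D] inner_mult_SPD(1)[OF assms(2), of ?D] by linarith
  then have "?D = 0" by (rule inner_mult_SPD(2)[OF assms(2)])
  then show ?thesis by simp
qed

text \<open>Uniqueness of square roots can be iterated: \<open>exp (A / 2^k) = exp (B / 2^k)\<close>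
  for every \<open>k\<close>. Thus the difference quotients at \<open>2^-k\<close> of
  \<open>exp (s A) - exp (s B)\<close> vanish, while they converge to \<open>A - B\<close>.\<close>

lemma mexp_inj_on_Sym: "inj_on mexp (Sym :: (real^'n^'n) set)"
proof (rule inj_onI)
  fix A B :: "real^'n^'n" assume A: "A \<in> Sym" and B: "B \<in> Sym" and eq: "mexp A = mexp B"
  have k: "mexp ((1/2)^k *\<^sub>R A) = mexp ((1/2)^k *\<^sub>R B)" for k
  proof (induction k)
    case (Suc k)
    show ?case
    proof (rule SPD_square_inj)
      show "mexp ((1/2) ^ Suc k *\<^sub>R A) ** mexp ((1/2) ^ Suc k *\<^sub>R A) = mexp ((1/2) ^ Suc k *\<^sub>R B) ** mexp ((1/2) ^ Suc k *\<^sub>R B)"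
        using Suc mexp_double[of "(1/2)^k *\<^sub>R A"] mexp_double[of "(1/2)^k *\<^sub>R B"] by simp
    qed (intro mexp_SPD subspace_scale subspace_Sym A B)+
  qed (simp add: eq)
  define f where "f s = mexp (s *\<^sub>R A) - mexp (s *\<^sub>R B)" for s
  have "(f has_vector_derivative A ** mexp (0 *\<^sub>R A) - B ** mexp (0 *\<^sub>R B)) (at 0)"
    unfolding f_def by (intro has_vector_derivative_diff mexp_has_vector_derivative)
  then have f': "(f has_vector_derivative A - B) (at 0)" by simp
  have "(A - B) \<bullet> b = 0" for b
  proof -
    have "((\<lambda>s. f s \<bullet> b) has_real_derivative (A - B) \<bullet> b) (at 0)"
      using bounded_linear.has_vector_derivative[OF bounded_linear_inner_left f']
      by (simp add: has_real_derivative_iff_has_vector_derivative)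
    then have "((\<lambda>h. (f (0 + h) \<bullet> b - f 0 \<bullet> b) / h) \<longlongrightarrow> (A - B) \<bullet> b) (at 0)"
      by (simp add: DERIV_def)
    moreover have "filterlim (\<lambda>k. (1/2::real)^k) (at 0) sequentially"
      by (rule filterlim_atI) (auto intro!: LIMSEQ_power_zero)
    ultimately have "(\<lambda>k. (f (0 + (1/2)^k) \<bullet> b - f 0 \<bullet> b) / (1/2)^k) \<longlonglongrightarrow> (A - B) \<bullet> b"
      by (rule filterlim_compose)
    then have "(\<lambda>k. 0) \<longlonglongrightarrow> (A - B) \<bullet> b" by (simp add: f_def k)
    then show ?thesis using LIMSEQ_unique tendsto_const by blast
  qed
  then have "A - B = 0" by (metis inner_eq_zero_iff)
  then show "A = B" by simp
qed

lemma dexp_commute: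
  assumes "X ** W = W ** X"
  shows "dexp X W = W ** mexp X"
proof -
  have "mexp ((1 - s) *\<^sub>R X) ** W ** mexp (s *\<^sub>R X) = W ** mexp X" for s
  proof -
    have "mexp ((1 - s) *\<^sub>R X) ** W = W ** mexp ((1 - s) *\<^sub>R X)"
      by (rule mexp_commute_general) (simp add: mat_algebra assms)
    moreover have "mexp ((1 - s) *\<^sub>R X) ** mexp (s *\<^sub>R X) = mexp X"
      using mexp_add_scaled[of "1 - s" s X] by simp
    ultimately show ?thesis by (metis matrix_mul_assoc)
  qed
  then show ?thesis by (simp add: dexp_def)
qed

lemma matrix_inv_commute:
  assumes "invertible (A :: real^'n^'n)" "A ** B = B ** A"
  shows "matrix_inv A ** B = B ** matrix_inv A"
proof -
  have "matrix_inv A ** B = matrix_inv A ** (B ** A) ** matrix_inv A"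
    using matrix_inv_works[OF assms(1)] by (simp add: matrix_mul_assoc[symmetric])
  also have "\<dots> = B ** matrix_inv A"
    using matrix_inv_works[OF assms(1)] by (simp add: assms(2)[symmetric] matrix_mul_assoc)
  finally show ?thesis .
qed

text \<open>The logarithm of \<open>y\<close> is the integral of \<open>(y - 1) (1 + s (y - 1))\<^sup>-\<^sup>1\<close> over \<open>0 \<le> s \<le> 1\<close>.\<close>

lemma mexp_surj_SPD:
  fixes y :: "real^'n^'n"
  assumes y: "y \<in> SPD"
  shows "\<exists>X\<in>Sym. mexp X = y"
proof -
  define M where "M s = mat 1 + s *\<^sub>R (y - mat 1)" for s :: real
  define N where "N s = (y - mat 1) ** matrix_inv (M s)" for s
  have M: "M s \<in> SPD" if "s \<in> {0..1}" for s
    using SPD_convex_comb[OF mat_1_SPD y that] by (simp add: M_def algebra_simps)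
  have invM: "invertible (M s)" if "s \<in> {0..1}" for s using M[OF that] by (rule SPD_invertible)
  have comM: "M s ** (y - mat 1) = (y - mat 1) ** M s" "M s ** M t = M t ** M s" for s t
    by (simp_all add: M_def mat_algebra algebra_simps)
  have com1: "matrix_inv (M s) ** (y - mat 1) = (y - mat 1) ** matrix_inv (M s)" if "s \<in> {0..1}" for s
    by (rule matrix_inv_commute[OF invM[OF that] comM(1)])
  have com2: "matrix_inv (M s) ** matrix_inv (M t) = matrix_inv (M t) ** matrix_inv (M s)" if "s \<in> {0..1}" "t \<in> {0..1}" for s t
    by (intro matrix_inv_commute[OF invM] matrix_inv_commute[OF invM, symmetric] comM that)
  have comN: "N s ** N t = N t ** N s" if "s \<in> {0..1}" "t \<in> {0..1}" for s t
  proof -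
    have "N s ** N t = (y - mat 1) ** (matrix_inv (M s) ** (y - mat 1)) ** matrix_inv (M t)"
      by (simp add: N_def matrix_mul_assoc)
    also have "\<dots> = (y - mat 1) ** (y - mat 1) ** (matrix_inv (M s) ** matrix_inv (M t))"
      unfolding com1[OF that(1)] by (simp add: matrix_mul_assoc)
    also have "\<dots> = (y - mat 1) ** ((y - mat 1) ** matrix_inv (M t)) ** matrix_inv (M s)"
      unfolding com2[OF that] by (simp add: matrix_mul_assoc)
    also have "\<dots> = N t ** N s"
      unfolding com1[OF that(2), symmetric] by (simp add: N_def matrix_mul_assoc)
    finally show ?thesis .
  qed
  have "continuous_on GL (matrix_inv :: real^'n^'n \<Rightarrow> _)" using Ck_on_matrix_inv[of 0] by simp
  then have "continuous_on {0..1} (\<lambda>s. matrix_inv (M s))"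
    by (rule continuous_on_compose2) (use invM in \<open>auto simp: GL_def M_def intro!: continuous_intros\<close>)
  then have cN: "continuous_on {0..1} N"
    unfolding N_def by (intro mm.continuous_on continuous_intros)
  have iN: "N integrable_on {0..t}" if "t \<in> {0..1}" for t
    by (rule integrable_continuous_interval[OF continuous_on_subset[OF cN]]) (use that in auto)
  define L where "L t = integral {0..t} N" for t
  have L': "(L has_vector_derivative N t) (at t within {0..1})" if "t \<in> {0..1}" for t
    unfolding L_def by (rule integral_has_vector_derivative[OF cN that])
  have NSym: "N s \<in> Sym" if "s \<in> {0..1}" for s
  proof -
    have "M s ** transpose (matrix_inv (M s)) = mat 1"
      using matrix_inv_works(1)[OF invM[OF that]] Sym_transpose[OF SPD_Sym[OF M[OF that]]]
      by (metis matrix_transpose_mul transpose_mat)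
    then have "transpose (matrix_inv (M s)) = matrix_inv (M s)" by (rule matrix_inv_unique(2)[symmetric])
    then show ?thesis
      using com1[OF that] Sym_transpose[OF SPD_Sym[OF y]]
      by (simp add: Sym_def N_def matrix_transpose_mul linear_diff[OF linear_transpose])
  qed
  have LSym: "L 1 \<in> Sym"
    unfolding L_def by (intro integral_mem_subspace subspace_Sym iN NSym) auto
  have comL: "L t ** N t = N t ** L t" if t: "t \<in> {0..1}" for t
  proof -
    have "subspace {Z. Z ** N t = N t ** Z}"
      by (auto simp: subspace_def mat_algebra mm.zero_left mm.zero_right)
    from integral_mem_subspace[OF this iN[OF t]] comN t show ?thesis by (auto simp: L_def)
  qed
  \<comment> \<open>All matrices in question commute, so \<open>exp (- L)\<close> has derivative
    \<open>- exp (- L) N\<close> as in the scalar case; it cancels against the derivative of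
    \<open>M\<close> because \<open>N M = y - 1\<close>.\<close>
  have "((\<lambda>t. mexp (- L t) ** M t) has_vector_derivative 0) (at t within {0..1})" if t: "t \<in> {0..1}" for t
  proof -
    have "dexp (- L t) (- N t) = (- N t) ** mexp (- L t)"
      by (rule dexp_commute) (simp add: mat_algebra comL[OF t])
    moreover have "mexp (- L t) ** N t = N t ** mexp (- L t)"
      by (rule mexp_commute_general) (simp add: mat_algebra comL[OF t])
    ultimately have d: "dexp (- L t) (- N t) = - (mexp (- L t) ** N t)" by (simp add: mat_algebra)
    have "((\<lambda>t. mexp (- L t) ** M t) has_vector_derivative mexp (- L t) ** (y - mat 1) + dexp (- L t) (- N t) ** M t) (at t within {0..1})"
      by (intro mm.has_vector_derivative mexp_compose_has_vector_derivative has_vector_derivative_minus L' t)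
        (auto simp: M_def intro!: derivative_eq_intros)
    moreover have "N t ** M t = y - mat 1"
      using matrix_inv_works(1)[OF invM[OF t]] by (simp add: N_def matrix_mul_assoc[symmetric])
    ultimately show ?thesis unfolding d by (simp add: mm.minus_left matrix_mul_assoc[symmetric])
  qed
  from has_vector_derivative_zero_constant[OF convex_real_interval(5) this]
  obtain c where c: "\<And>t. t \<in> {0..1} \<Longrightarrow> mexp (- L t) ** M t = c" by blast
  have "mexp (- L 1) ** y = mat 1" using c[of 0] c[of 1] by (simp add: L_def M_def)
  then have "mexp (L 1) ** (mexp (- L 1) ** y) = mexp (L 1)" by simp
  then show ?thesis using LSym by auto
qed

section \<open>The matrix logarithm and its smoothness\<close>

definition mlog :: "real^'n^'n \<Rightarrow> real^'n^'n" where
  "mlog = inv_into Sym mexp"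

lemma mlog_Sym: "y \<in> SPD \<Longrightarrow> mlog y \<in> Sym"
  unfolding mlog_def by (rule inv_into_into) (use mexp_surj_SPD in blast)

lemma mexp_mlog [simp]: "y \<in> SPD \<Longrightarrow> mexp (mlog y) = y"
  unfolding mlog_def by (rule f_inv_into_f) (use mexp_surj_SPD in blast)

lemma mlog_mexp [simp]: "X \<in> Sym \<Longrightarrow> mlog (mexp X) = X"
  unfolding mlog_def by (rule inv_into_f_f[OF mexp_inj_on_Sym])

lemma mexp_eq_iff: "X \<in> Sym \<Longrightarrow> Y \<in> Sym \<Longrightarrow> mexp X = mexp Y \<longleftrightarrow> X = Y"
  by (metis mlog_mexp)

lemma image_mexp_Sym: "mexp ` Sym = SPD"
  using mexp_surj_SPD mexp_SPD by fastforce

lemma dexp_eq_0: "X \<in> Sym \<Longrightarrow> dexp X W = 0 \<longleftrightarrow> W = 0"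
proof -
  assume X: "X \<in> Sym"
  have "dexp_sym X W = mexp (- ((1/2) *\<^sub>R X)) ** dexp X W ** mexp (- ((1/2) *\<^sub>R X))"
    by (simp add: dexp_eq matrix_mul_assoc)
  then show ?thesis using dexp_sym_eq_0[OF X, of W] by (auto simp: dexp_eq mm.zero_left mm.zero_right)
qed

definition symm :: "real^'n^'n \<Rightarrow> real^'n^'n" where
  "symm Z = (1/2) *\<^sub>R (Z + transpose Z)"

lemma bounded_linear_symm: "bounded_linear symm"
  unfolding symm_def by (intro bounded_linear_compose[OF bounded_linear_scaleR_right bounded_linear_add] bounded_linear_ident bounded_linear_transpose)

lemmas symm_linear = linear_add[OF bounded_linear.linear[OF bounded_linear_symm]]
  linear_diff[OF bounded_linear.linear[OF bounded_linear_symm]]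

lemma symm_Sym [simp]: "symm Z \<in> Sym"
  by (simp add: symm_def Sym_def transpose_scalar linear_add[OF linear_transpose] add.commute)

lemma symm_ident [simp]: "Z \<in> Sym \<Longrightarrow> symm Z = Z"
  by (simp add: symm_def Sym_def scaleR_2[symmetric])

text \<open>The extension \<open>F\<close> acts as \<open>f\<close> on the symmetric part and as the
  identity on the antisymmetric part. It is an injective map of the full matrix space onto an open
  set, so \<open>smooth_inverse\<close> applies; the inverse of \<open>f\<close> is recovered from
  that of \<open>F\<close>.\<close>

lemma smooth_inverse_Sym:
  fixes f g :: "real^'n^'n \<Rightarrow> real^'n^'n"
  assumes f: "\<And>k. Ck_on k UNIV f" and fS: "f ` Sym = A" "A \<subseteq> Sym" and gf: "\<And>X. X \<in> Sym \<Longrightarrow> g (f X) = X"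
    and inj: "\<And>X W. X \<in> Sym \<Longrightarrow> W \<in> Sym \<Longrightarrow> frechet_derivative f (at X) W = 0 \<Longrightarrow> W = 0"
  shows "open {Y. symm Y \<in> A}" "Ck_on k {Y. symm Y \<in> A} (\<lambda>Y. g (symm Y))"
proof -
  define F where "F Z = f (symm Z) + (Z - symm Z)" for Z
  define G where "G Y = g (symm Y) + (Y - symm Y)" for Y
  have bl: "bounded_linear (\<lambda>Z. Z - symm Z)" by (intro bounded_linear_sub bounded_linear_ident bounded_linear_symm)
  have CF: "Ck_on k UNIV F" for k
    unfolding F_def
    by (intro Ck_on_add open_UNIV Ck_on_linear[OF bl] Ck_on_compose[OF open_UNIV open_UNIV _ Ck_on_linear[OF bounded_linear_symm open_UNIV] f]) simp
  have fSym: "f (symm Z) \<in> Sym" for Z using fS by auto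
  have ss: "symm (Z - symm Z) = 0" for Z by (simp add: symm_linear)
  have sF: "symm (F Z) = f (symm Z)" for Z
    using fSym[of Z] by (simp add: F_def symm_linear)
  have GF: "G (F Z) = Z" for Z
    using gf[OF symm_Sym, of Z] sF[of Z] by (simp add: G_def) (simp add: F_def)
  have rF: "range F = {Y. symm Y \<in> A}"
  proof (intro equalityI subsetI)
    fix Y assume "Y \<in> range F"
    then show "Y \<in> {Y. symm Y \<in> A}" using sF fS by auto
  next
    fix Y assume "Y \<in> {Y. symm Y \<in> A}"
    then obtain X where X: "X \<in> Sym" "f X = symm Y" using fS by auto
    have "F (X + (Y - symm Y)) = Y"
      using X by (simp add: F_def symm_linear)
    then show "Y \<in> range F" by (metis rangeI)
  qed
  have DF: "frechet_derivative F (at Z) = (\<lambda>W. frechet_derivative f (at (symm Z)) (symm W) + (W - symm W))" for Z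
  proof (rule frechet_derivative_at[symmetric])
    have "(f has_derivative frechet_derivative f (at (symm Z))) (at (symm Z))"
      using Ck_on_SucD[OF f UNIV_I] .
    from has_derivative_compose[OF bounded_linear_imp_has_derivative[OF bounded_linear_symm] this]
    show "(F has_derivative (\<lambda>W. frechet_derivative f (at (symm Z)) (symm W) + (W - symm W))) (at Z)"
      unfolding F_def by (intro has_derivative_add bounded_linear_imp_has_derivative[OF bl])
  qed
  have injF: "inj (frechet_derivative F (at Z))" for Z
  proof -
    have lin: "linear (frechet_derivative F (at Z))"
      using has_derivative_linear[OF Ck_on_SucD[OF CF UNIV_I]] .
    have "W = 0" if "frechet_derivative F (at Z) W = 0" for W
    proof -
      let ?D = "frechet_derivative f (at (symm Z)) (symm W)"
      \<comment> \<open>Since \<open>f\<close> maps \<open>Sym\<close> into itself, its derivative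
        in a symmetric direction is symmetric. Hence the two summands of the derivative of
        \<open>F\<close> lie in complementary subspaces and vanish separately.\<close>
      have "((\<lambda>s. f (symm Z + s *\<^sub>R symm W)) has_vector_derivative ?D) (at 0)"
        using has_vector_derivative_along_line[of f _ "symm Z" 0 "symm W" UNIV] Ck_on_SucD[OF f UNIV_I, of "symm Z"] by simp
      then have DS: "?D \<in> Sym"
      proof (rule has_vector_derivative_mem_subspace[OF subspace_Sym])
        fix s :: real
        have "symm Z + s *\<^sub>R symm W \<in> Sym" by (intro subspace_add subspace_scale subspace_Sym symm_Sym)
        then show "f (symm Z + s *\<^sub>R symm W) \<in> Sym" using fS by blast
      qed auto
      have z: "?D + (W - symm W) = 0" using that by (simp add: DF)
      then have "symm (?D + (W - symm W)) = symm 0" by simp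
      then have "?D = 0"
        unfolding symm_linear(1) ss using DS linear_0[OF bounded_linear.linear[OF bounded_linear_symm]] by simp
      then have "symm W = 0" using inj[OF symm_Sym symm_Sym] by blast
      with z \<open>?D = 0\<close> show "W = 0" by simp
    qed
    then show ?thesis using linear_injective_0[OF lin] by blast
  qed
  show o: "open {Y. symm Y \<in> A}"
    using smooth_inverse(1)[OF open_UNIV CF GF injF] by (simp add: rF)
  have "Ck_on k {Y. symm Y \<in> A} G"
    using smooth_inverse(2)[OF open_UNIV CF GF injF] by (simp add: rF)
  then have "Ck_on k {Y. symm Y \<in> A} (\<lambda>Y. G Y + (-1) *\<^sub>R (Y - symm Y))"
    by (intro Ck_on_add[OF o] Ck_on_compose_linear[OF bounded_linear_scaleR_right o] Ck_on_linear[OF bl o])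
  then show "Ck_on k {Y. symm Y \<in> A} (\<lambda>Y. g (symm Y))"
    by (simp add: G_def)
qed

lemma frechet_derivative_mexp: "frechet_derivative mexp (at X) = dexp X"
  by (rule frechet_derivative_at[symmetric, OF mexp_has_derivative])

lemma smooth_mlog:
  shows "open {Y. symm Y \<in> SPD}" "Ck_on k {Y. symm Y \<in> SPD} (\<lambda>Y. mlog (symm Y))"
proof -
  have "SPD \<subseteq> (Sym :: (real^'n^'n) set)" using SPD_Sym by blast
  note * = smooth_inverse_Sym[of mexp SPD mlog, OF Ck_on_mexp_UNIV image_mexp_Sym this]
  show "open {Y :: real^'n^'n. symm Y \<in> SPD}" "Ck_on k {Y :: real^'n^'n. symm Y \<in> SPD} (\<lambda>Y. mlog (symm Y))"
    by (rule *; simp add: frechet_derivative_mexp dexp_eq_0)+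
qed

lemma symm_SPD: "y \<in> SPD \<Longrightarrow> symm y \<in> SPD" using SPD_Sym symm_ident by metis

text \<open>The derivative of the logarithm is given implicitly, as the solution of an equation for
  \<open>dexp\<close>; this is the form in which the estimates for \<open>dexp_sym\<close> apply.
  The derivative is taken within \<open>T\<close> so that endpoints of intervals are
  included.\<close>

lemma mlog_has_vector_derivative:
  fixes y :: "real \<Rightarrow> real^'n^'n"
  assumes y: "(y has_vector_derivative y') (at t within T)" and T: "t \<in> T" "at t within T \<noteq> bot"
    and SPD: "\<And>s. s \<in> T \<Longrightarrow> y s \<in> SPD"
  obtains c' where "((\<lambda>s. mlog (y s)) has_vector_derivative c') (at t within T)" "c' \<in> Sym"
    "dexp (mlog (y t)) c' = y'"
proof -
  let ?l = "\<lambda>Y :: real^'n^'n. mlog (symm Y)"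
  have "(?l has_derivative frechet_derivative ?l (at (y t))) (at (y t) within y ` T)"
    by (rule has_derivative_at_withinI[OF Ck_on_SucD[OF smooth_mlog(2)]]) (use symm_SPD SPD T in auto)
  from vector_derivative_diff_chain_within[OF y this]
  have "((\<lambda>s. ?l (y s)) has_vector_derivative frechet_derivative ?l (at (y t)) y') (at t within T)"
    by (simp add: o_def)
  then obtain c' where c: "((\<lambda>s. ?l (y s)) has_vector_derivative c') (at t within T)" by blast
  have c': "((\<lambda>s. mlog (y s)) has_vector_derivative c') (at t within T)"
    by (rule has_vector_derivative_transform[OF T(1) _ c]) (simp add: SPD SPD_Sym)
  have "c' \<in> Sym"
    by (rule has_vector_derivative_mem_subspace[OF subspace_Sym c' _ T]) (use SPD mlog_Sym in auto)
  moreover have "((\<lambda>s. y s) has_vector_derivative dexp (mlog (y t)) c') (at t within T)"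
    by (rule has_vector_derivative_transform[OF T(1) _ mexp_compose_has_vector_derivative[OF c']]) (use SPD in auto)
  then have "dexp (mlog (y t)) c' = y'" using y T(2) by (metis vector_derivative_unique_within)
  ultimately show thesis using that c' by blast
qed

lemma continuous_on_mlog: "continuous_on SPD (mlog :: real^'n^'n \<Rightarrow> _)"
proof -
  have "continuous_on {Y :: real^'n^'n. symm Y \<in> SPD} (\<lambda>Y. mlog (symm Y))"
    using smooth_mlog(2)[of 0] by simp
  then have "continuous_on (SPD :: (real^'n^'n) set) (\<lambda>Y. mlog (symm Y))"
    by (rule continuous_on_subset) (use symm_SPD in auto)
  then show ?thesis by (rule continuous_on_eq) (simp add: SPD_Sym)
qed

section \<open>The geodesic equation\<close>

lemma Ck_on_imp_continuous_on: "Ck_on k S f \<Longrightarrow> continuous_on S f"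
  by (induction k) (auto dest: Ck_on_Suc_imp simp del: Ck_on.simps(2))

lemma smooth_mapE:
  assumes "smooth_map S f" "x \<in> S"
  obtains U h where "open U" "x \<in> U" "\<And>k. Ck_on k U h" "\<And>y. y \<in> S \<inter> U \<Longrightarrow> h y = f y"
proof -
  have "\<exists>U h. open U \<and> x \<in> U \<and> (\<forall>k. Ck_on k U h) \<and> (\<forall>y\<in>S \<inter> U. h y = f y)"
    using assms by (simp add: smooth_map_def)
  then show thesis using that by auto
qed

lemma smooth_map_open:
  assumes "open U" "S \<subseteq> U" "\<And>k. Ck_on k U f"
  shows "smooth_map S f"
  unfolding smooth_map_def
proof
  fix x assume "x \<in> S"
  with assms show "\<exists>U h. open U \<and> x \<in> U \<and> (\<forall>k. Ck_on k U h) \<and> (\<forall>y\<in>S \<inter> U. h y = f y)"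
    by (intro exI[of _ U] exI[of _ f]) auto
qed

lemma smooth_map_subset_cong:
  assumes "smooth_map S f" "T \<subseteq> S" "\<And>x. x \<in> T \<Longrightarrow> f x = g x"
  shows "smooth_map T g"
  unfolding smooth_map_def
proof
  fix x assume x: "x \<in> T"
  then have "x \<in> S" using assms(2) by blast
  from smooth_mapE[OF assms(1) this] obtain U h where
    "open U" "x \<in> U" "\<And>k. Ck_on k U h" "\<And>y. y \<in> S \<inter> U \<Longrightarrow> h y = f y" by metis
  then show "\<exists>U h. open U \<and> x \<in> U \<and> (\<forall>k. Ck_on k U h) \<and> (\<forall>y\<in>T \<inter> U. h y = g y)"
    using assms(2,3) by (intro exI[of _ U] exI[of _ h]) auto
qed

lemma smooth_map_subset: "smooth_map S f \<Longrightarrow> T \<subseteq> S \<Longrightarrow> smooth_map T f"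
  by (rule smooth_map_subset_cong) auto

lemma smooth_map_cong: "smooth_map S f \<Longrightarrow> (\<And>x. x \<in> S \<Longrightarrow> f x = g x) \<Longrightarrow> smooth_map S g"
  by (rule smooth_map_subset_cong[OF _ subset_refl])

lemma smooth_map_compose:
  assumes f: "smooth_map S f" and g: "smooth_map T g" and fS: "f ` S \<subseteq> T"
  shows "smooth_map S (\<lambda>x. g (f x))"
  unfolding smooth_map_def
proof
  fix x assume x: "x \<in> S"
  obtain U h where U: "open U" "x \<in> U" "\<And>k. Ck_on k U h" "\<And>y. y \<in> S \<inter> U \<Longrightarrow> h y = f y"
    using smooth_mapE[OF f x] by metis
  have "f x \<in> T" using fS x by blast
  then obtain V l where V: "open V" "f x \<in> V" "\<And>k. Ck_on k V l" "\<And>y. y \<in> T \<inter> V \<Longrightarrow> l y = g y"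
    using smooth_mapE[OF g] by metis
  let ?W = "U \<inter> h -` V"
  have "continuous_on U h" using U(3)[of 0] by simp
  then have o: "open ?W" using U(1) V(1) continuous_open_preimage by blast
  have "Ck_on k ?W (\<lambda>x. l (h x))" for k
    by (rule Ck_on_compose[OF o V(1) _ Ck_on_subset[OF U(3)] V(3)]) auto
  moreover have "l (h y) = g (f y)" if "y \<in> S \<inter> ?W" for y
  proof -
    have "h y = f y" using that U(4) by blast
    moreover have "h y \<in> V" using that by blast
    ultimately show ?thesis using V(4)[of "f y"] fS that by auto
  qed
  moreover have "x \<in> ?W" using U V x by auto
  ultimately show "\<exists>U k. open U \<and> x \<in> U \<and> (\<forall>n. Ck_on n U k) \<and> (\<forall>y\<in>S \<inter> U. k y = g (f y))"
    using o by (intro exI[of _ ?W] exI[of _ "\<lambda>x. l (h x)"]) auto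
qed

lemma smooth_map_continuous_on:
  assumes "smooth_map S f" shows "continuous_on S f"
  unfolding continuous_on_eq_continuous_within
proof
  fix x assume x: "x \<in> S"
  obtain U h where U: "open U" "x \<in> U" "\<And>k. Ck_on k U h" "\<And>y. y \<in> S \<inter> U \<Longrightarrow> h y = f y"
    using smooth_mapE[OF assms x] by metis
  have "continuous (at x) h" using U(3)[of 0] U(1,2) by (simp add: continuous_on_eq_continuous_at)
  then have "continuous (at x within S) h" by (rule continuous_at_imp_continuous_within)
  then show "continuous (at x within S) f"
    by (rule continuous_transform_within_openin[where T=S and S="S \<inter> U"])
      (use U x in \<open>auto simp: openin_open\<close>)
qed

text \<open>Without isolated points in \<open>T\<close> the derivative within \<open>T\<close> is
  unique. It therefore agrees with the derivative of every local smooth extension, and the velocity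
  is smooth in turn.\<close>

lemma smooth_curve_velocity:
  assumes f: "smooth_map T f" and T: "\<And>t. t \<in> T \<Longrightarrow> at t within T \<noteq> bot"
  shows "\<And>t. t \<in> T \<Longrightarrow> (f has_vector_derivative velocity T f t) (at t within T)"
    "smooth_map T (velocity T f)"
proof -
  have local: "\<exists>U h. open U \<and> t \<in> U \<and> (\<forall>k. Ck_on k U h) \<and>
    (\<forall>s\<in>T \<inter> U. (f has_vector_derivative h s) (at s within T) \<and> velocity T f s = h s)" if t: "t \<in> T" for t
  proof -
    obtain U h where U: "open U" "t \<in> U" "\<And>k. Ck_on k U h" "\<And>y. y \<in> T \<inter> U \<Longrightarrow> h y = f y"
      using smooth_mapE[OF f t] by metis
    let ?h = "\<lambda>s. frechet_derivative h (at s) 1"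
    have "Ck_on k U ?h" for k using U(3)[of "Suc k"] by simp
    moreover have "(f has_vector_derivative ?h s) (at s within T) \<and> velocity T f s = ?h s" if s: "s \<in> T \<inter> U" for s
    proof -
      have d: "(h has_derivative frechet_derivative h (at s)) (at s)"
        using Ck_on_SucD[OF U(3)] s by blast
      have "(h has_vector_derivative ?h s) (at s)"
        using has_vector_derivative_along_line[of h "frechet_derivative h (at s)" 0 s 1 UNIV] d by simp
      then have hd: "(h has_vector_derivative ?h s) (at s within T)"
        by (rule has_vector_derivative_at_within)
      obtain e where e: "e > 0" "ball s e \<subseteq> U" using U(1) s openE by blast
      have "(f has_vector_derivative ?h s) (at s within T)"
        by (rule has_vector_derivative_transform_within[OF hd e(1)])
          (use s U(4) e in \<open>auto simp: subset_iff dist_commute\<close>)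
      moreover from this have "velocity T f s = ?h s"
        unfolding velocity_def using T s by (intro vector_derivative_within) auto
      ultimately show ?thesis by simp
    qed
    ultimately show ?thesis using U(1,2) by (intro exI[of _ U] exI[of _ ?h]) auto
  qed
  show "(f has_vector_derivative velocity T f t) (at t within T)" if "t \<in> T" for t
    using local[OF that] that by auto
  show "smooth_map T (velocity T f)"
    unfolding smooth_map_def
  proof
    fix t assume "t \<in> T"
    from local[OF this] obtain U h where "open U" "t \<in> U" "\<forall>k. Ck_on k U h" "\<forall>s\<in>T \<inter> U. velocity T f s = h s" by auto
    then show "\<exists>U h. open U \<and> t \<in> U \<and> (\<forall>k. Ck_on k U h) \<and> (\<forall>y\<in>T \<inter> U. h y = velocity T f y)"
      by (intro exI[of _ U] exI[of _ h]) auto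
  qed
qed

text \<open>The part of the definition of a geodesic that makes derivatives within \<open>T\<close>
  unique at every point of \<open>T\<close>.\<close>

definition nondegenerate_interval :: "real set \<Rightarrow> bool" where
  "nondegenerate_interval T \<longleftrightarrow> is_interval T \<and> (\<exists>a\<in>T. \<exists>b\<in>T. a < b)"

lemma nondegenerate_interval_limit:
  assumes "nondegenerate_interval T" "t \<in> T"
  shows "at t within T \<noteq> bot"
proof -
  have "t islimpt T"
    by (rule connected_imp_perfect)
      (use assms in \<open>auto simp: nondegenerate_interval_def is_interval_connected_1\<close>)
  then show ?thesis by (simp add: trivial_limit_within)
qed

text \<open>Smoothness of the inverse is known already; its derivative is read off by
  differentiating the constant product \<open>y ** matrix_inv y\<close>.\<close>

lemma matrix_inv_has_derivative:
  assumes "x \<in> GL"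
  shows "(matrix_inv has_derivative (\<lambda>h. - (matrix_inv x ** h ** matrix_inv x))) (at (x :: real^'n^'n))"
proof -
  let ?I = "frechet_derivative matrix_inv (at x)"
  have inv: "invertible x" using assms by (simp add: GL_def)
  have d: "(matrix_inv has_derivative ?I) (at x)" by (rule Ck_on_SucD[OF Ck_on_matrix_inv assms])
  have 1: "((\<lambda>y. y ** matrix_inv y) has_derivative (\<lambda>h. x ** ?I h + h ** matrix_inv x)) (at x)"
    by (rule mm.FDERIV[OF has_derivative_ident d])
  have 2: "((\<lambda>y. y ** matrix_inv y) has_derivative (\<lambda>h. 0)) (at x)"
    by (rule has_derivative_transform_within_open[OF has_derivative_const[of "mat 1"] open_GL assms])
      (simp add: matrix_inv_works GL_def)
  have eq: "x ** ?I h + h ** matrix_inv x = 0" for h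
    by (rule fun_cong[OF has_derivative_unique[OF 1 2]])
  have "?I h = - (matrix_inv x ** h ** matrix_inv x)" for h
  proof -
    have "matrix_inv x ** (x ** ?I h + h ** matrix_inv x) = 0" by (simp add: eq mm.zero_right)
    then have "?I h + matrix_inv x ** h ** matrix_inv x = 0"
      using matrix_inv_works(1)[OF inv] by (simp add: mm.add_right matrix_mul_assoc)
    then show ?thesis by (simp add: add_eq_0_iff2)
  qed
  then have "?I = (\<lambda>h. - (matrix_inv x ** h ** matrix_inv x))" by blast
  with d show ?thesis by simp
qed

text \<open>The line through \<open>v\<close> in direction \<open>a\<close> stays in the model space
  \<open>H\<close>, so the values of \<open>f\<close> on \<open>H\<close> near \<open>v\<close>
  determine the derivative, and any extension \<open>h\<close> computes it.\<close>

lemma dir_deriv_openin: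
  assumes H: "subspace H" and B: "open B" and v: "v \<in> H \<inter> B" and a: "a \<in> H"
    and eq: "\<And>x. x \<in> H \<inter> B \<Longrightarrow> f x = h x" and h: "(h has_derivative h') (at v)"
  shows "dir_deriv f v a = h' a"
proof -
  have "((\<lambda>s. h (v + s *\<^sub>R a)) has_vector_derivative h' a) (at 0)"
    using has_vector_derivative_along_line[of h h' v 0 a UNIV] h by simp
  moreover have "open ((\<lambda>s::real. v + s *\<^sub>R a) -` B)"
    by (intro open_vimage B continuous_intros)
  ultimately have "((\<lambda>s. f (v + s *\<^sub>R a)) has_vector_derivative h' a) (at 0)"
  proof (rule has_vector_derivative_transform_within_open)
    fix s assume "s \<in> (\<lambda>s::real. v + s *\<^sub>R a) -` B"
    then show "h (v + s *\<^sub>R a) = f (v + s *\<^sub>R a)"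
      using eq v a H by (simp add: subspace_add subspace_scale)
  qed (use v in auto)
  then show ?thesis unfolding dir_deriv_def by (rule vector_derivative_at)
qed

section \<open>Charts, tangent vectors and the covariant acceleration\<close>

lemma chart_onD:
  assumes "chart_on M U H V \<phi> \<psi>"
  shows "subspace H" "V \<subseteq> H" "U \<subseteq> M" "\<phi> ` U = V" "\<psi> ` V = U" "\<And>x. x \<in> U \<Longrightarrow> \<psi> (\<phi> x) = x"
    "smooth_map U \<phi>" "smooth_map V \<psi>"
proof -
  have *: "openin (top_of_set M) U" "subspace H" "openin (top_of_set H) V" "diffeomorphism U V \<phi> \<psi>"
    using assms by (simp_all add: chart_on_def)
  show "V \<subseteq> H" "U \<subseteq> M" using *(1,3) openin_imp_subset by blast+
  show "\<phi> ` U = V" "\<psi> ` V = U" "\<And>x. x \<in> U \<Longrightarrow> \<psi> (\<phi> x) = x" "smooth_map U \<phi>" "smooth_map V \<psi>"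
    using *(4) by (simp_all add: diffeomorphism_def)
qed (use assms in \<open>simp add: chart_on_def\<close>)

lemma chart_on_local:
  assumes chart: "chart_on M U H V \<phi> \<psi>" and p: "p \<in> U"
  obtains B h where "open B" "\<phi> p \<in> H \<inter> B" "H \<inter> B \<subseteq> V" "\<And>k. Ck_on k B h" "\<And>x. x \<in> H \<inter> B \<Longrightarrow> \<psi> x = h x"
proof -
  have \<phi>p: "\<phi> p \<in> V" using chart p by (auto simp: chart_on_def diffeomorphism_def)
  obtain B0 where B0: "open B0" "V = H \<inter> B0"
    using chart by (auto simp: chart_on_def openin_open)
  obtain B1 h where B1: "open B1" "\<phi> p \<in> B1" "\<And>k. Ck_on k B1 h" "\<And>y. y \<in> V \<inter> B1 \<Longrightarrow> h y = \<psi> y"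
    using smooth_mapE[OF chart_onD(8)[OF chart] \<phi>p] by metis
  show thesis
  proof (rule that[of "B0 \<inter> B1" h])
    show "Ck_on k (B0 \<inter> B1) h" for k by (rule Ck_on_subset[OF B1(3)]) auto
  qed (use B0 B1 \<phi>p in auto)
qed

text \<open>The geodesic equation is tested with vectors \<open>w\<close> of the model space. This
  converts the velocity of a curve in \<open>M\<close> into such a vector, namely the velocity of
  the curve read in the chart.\<close>

lemma chart_on_tangent:
  assumes chart: "chart_on M U H V \<phi> \<psi>" and p: "p \<in> U"
    and c: "(c has_vector_derivative c') (at 0)" "c 0 = p" and I: "open I" "0 \<in> I" "\<And>s. s \<in> I \<Longrightarrow> c s \<in> M"
  shows "\<exists>w\<in>H. dir_deriv \<psi> (\<phi> p) w = c'"
proof -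
  have H: "subspace H" and inv: "\<And>x. x \<in> U \<Longrightarrow> \<psi> (\<phi> x) = x" and \<phi>U: "\<phi> ` U = V" and VH: "V \<subseteq> H"
    using chart_onD[OF chart] by auto
  obtain B h where B: "open B" "\<phi> p \<in> H \<inter> B" "H \<inter> B \<subseteq> V" "\<And>k. Ck_on k B h" "\<And>x. x \<in> H \<inter> B \<Longrightarrow> \<psi> x = h x"
    using chart_on_local[OF chart p] by metis
  obtain A0 where A0: "open A0" "U = M \<inter> A0" using chart by (auto simp: chart_on_def openin_open)
  obtain A l where A: "open A" "p \<in> A" "\<And>k. Ck_on k A l" "\<And>y. y \<in> U \<inter> A \<Longrightarrow> l y = \<phi> y"
    using smooth_mapE[OF chart_onD(7)[OF chart] p] by metis
  have "continuous_on A l" using A(3)[of 0] by simp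
  then have oC: "open (A \<inter> A0 \<inter> l -` B)"
    using A(1) A0(1) B(1) continuous_open_preimage[of A l B] by (simp add: Int_assoc Int_left_commute open_Int)
  have pC: "p \<in> A \<inter> A0 \<inter> l -` B" using A p A0 B(2) by auto
  have "isCont c 0" using c(1) has_vector_derivative_continuous by blast
  then have "filterlim c (nhds (c 0)) (nhds 0)"
    by (simp only: isCont_def tendsto_at_iff_tendsto_nhds)
  from topological_tendstoD[OF this oC]
  have "\<forall>\<^sub>F s in nhds 0. c s \<in> A \<inter> A0 \<inter> l -` B" using pC c(2) by simp
  then obtain e1 where e1: "e1 > 0" "\<And>s. dist s 0 < e1 \<Longrightarrow> c s \<in> A \<inter> A0 \<inter> l -` B"
    unfolding eventually_nhds_metric by blast
  obtain e2 where e2: "e2 > 0" "ball 0 e2 \<subseteq> I" using I openE by blast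
  define J where "J = ball (0::real) (min e1 e2)"
  have J: "open J" "0 \<in> J" using e1 e2 by (auto simp: J_def)
  have cJ: "c s \<in> A" "c s \<in> U" "l (c s) \<in> B" "l (c s) = \<phi> (c s)" if "s \<in> J" for s
  proof -
    have *: "c s \<in> A \<inter> A0 \<inter> l -` B" "c s \<in> M"
      using that e1 e2 I(3) by (auto simp: J_def dist_commute subset_iff)
    then show "c s \<in> A" "c s \<in> U" "l (c s) \<in> B" by (auto simp: A0)
    with A(4) show "l (c s) = \<phi> (c s)" by blast
  qed
  have lp: "l p = \<phi> p" using cJ(4)[OF J(2)] c(2) by simp
  define w where "w = frechet_derivative l (at p) c'"
  have "(l has_derivative frechet_derivative l (at p)) (at (c 0))"
    using Ck_on_SucD[OF A(3,2)] c(2) by simp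
  then have u: "((\<lambda>s. l (c s)) has_vector_derivative w) (at 0)"
    using vector_derivative_diff_chain_within[OF c(1), of l "frechet_derivative l (at p)"]
    by (auto simp: w_def o_def intro: has_derivative_at_withinI)
  have at: "at (0::real) within J = at 0" using J at_within_open by blast
  have w: "w \<in> H"
  proof (rule has_vector_derivative_mem_subspace[OF H, of "\<lambda>s. l (c s)" w 0 J])
    show "((\<lambda>s. l (c s)) has_vector_derivative w) (at 0 within J)" using u by (simp add: at)
    show "l (c s) \<in> H" if "s \<in> J" for s using cJ[OF that] \<phi>U VH by auto
  qed (use J at in auto)
  have dh: "(h has_derivative frechet_derivative h (at (\<phi> p))) (at (\<phi> p))"
    using Ck_on_SucD[OF B(4)] B(2) by blast
  have "((\<lambda>s. h (l (c s))) has_vector_derivative frechet_derivative h (at (\<phi> p)) w) (at 0)"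
    using vector_derivative_diff_chain_within[OF u, of h "frechet_derivative h (at (\<phi> p))"] dh lp c(2)
    by (auto simp: o_def intro: has_derivative_at_withinI)
  then have "(c has_vector_derivative frechet_derivative h (at (\<phi> p)) w) (at 0)"
  proof (rule has_vector_derivative_transform_within_open[OF _ J])
    fix s assume s: "s \<in> J"
    have "\<phi> (c s) \<in> H \<inter> B" using cJ[OF s] \<phi>U VH by auto
    then show "h (l (c s)) = c s" using cJ[OF s] B(5) inv by metis
  qed
  then have "frechet_derivative h (at (\<phi> p)) w = c'" using c(1) vector_derivative_at by metis
  moreover have "dir_deriv \<psi> (\<phi> p) w = frechet_derivative h (at (\<phi> p)) w"
    by (rule dir_deriv_openin[OF H B(1,2) w B(5) dh])
  ultimately show ?thesis using w by auto
qed

lemmas trace_linear = linear_add[OF bounded_linear.linear[OF bounded_linear_trace]]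
  linear_diff[OF bounded_linear.linear[OF bounded_linear_trace]]
  linear_neg[OF bounded_linear.linear[OF bounded_linear_trace]]

lemma ai_metric_commute: "ai_metric x X Y = ai_metric x Y X"
  unfolding ai_metric_def by (metis matrix_mul_assoc trace_mul_sym)

lemma ai_metric_has_derivative:
  assumes x: "(x has_derivative x') (at u)" and X: "(X has_derivative X') (at u)" and Y: "(Y has_derivative Y') (at u)"
    and GL: "x u \<in> GL"
  defines "p \<equiv> matrix_inv (x u)"
  shows "((\<lambda>u. ai_metric (x u) (X u) (Y u)) has_derivative
    (\<lambda>h. ai_metric (x u) (X' h) (Y u) + ai_metric (x u) (X u) (Y' h)
      - trace (p ** x' h ** p ** X u ** p ** Y u) - trace (p ** X u ** p ** x' h ** p ** Y u))) (at u)"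
proof -
  have q: "((\<lambda>u. matrix_inv (x u)) has_derivative (\<lambda>h. - (p ** x' h ** p))) (at u)"
    using has_derivative_compose[OF x matrix_inv_has_derivative[OF GL]] by (simp add: p_def)
  have "((\<lambda>u. trace (matrix_inv (x u) ** X u ** matrix_inv (x u) ** Y u)) has_derivative
    (\<lambda>h. trace ((p ** X u ** p) ** Y' h + ((p ** X u) ** (- (p ** x' h ** p)) + (p ** X' h + (- (p ** x' h ** p)) ** X u) ** p) ** Y u))) (at u)"
    unfolding p_def
    by (intro bounded_linear.has_derivative[OF bounded_linear_trace] mm.FDERIV q[unfolded p_def] X Y)
  then show ?thesis
    by (simp add: ai_metric_def[abs_def] p_def[symmetric] mat_algebra trace_linear algebra_simps)
qed

lemma continuous_within_open_dist:
  fixes f :: "'a::metric_space \<Rightarrow> 'b::topological_space"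
  assumes "continuous (at t within T) f" "open A" "f t \<in> A"
  shows "\<exists>d>0. \<forall>s\<in>T. dist s t < d \<longrightarrow> f s \<in> A"
proof -
  obtain B where B: "open B" "t \<in> B" "\<And>s. s \<in> T \<Longrightarrow> s \<in> B \<Longrightarrow> f s \<in> A"
    using assms unfolding continuous_within_topological by meson
  obtain d where "d > 0" "ball t d \<subseteq> B" using B openE by blast
  then show ?thesis using B(3) by (intro exI[of _ d]) (auto simp: subset_iff dist_commute)
qed

text \<open>The covariant acceleration in the sense of the definition of \<^const>\<open>geodesic\<close>, expressed in
  ambient coordinates: only its component tangent to \<open>M\<close> enters.\<close>

lemma geodesic_equation:
  fixes \<gamma> :: "real \<Rightarrow> real^'n^'n"
  assumes chart: "chart_on M U H V \<phi> \<psi>" and M: "M \<subseteq> SPD" and \<gamma>: "smooth_map T \<gamma>"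
    and T: "nondegenerate_interval T" and \<gamma>M: "\<gamma> ` T \<subseteq> M" and t: "t \<in> T" "\<gamma> t \<in> U" and w: "w \<in> H"
  defines "u \<equiv> \<phi> \<circ> \<gamma>" and "\<gamma>' \<equiv> velocity T \<gamma>"
  shows "coord_metric ai_metric \<psi> (u t) (velocity T (velocity T u) t) w +
      christoffel (coord_metric ai_metric \<psi>) (u t) (velocity T u t) (velocity T u t) w =
    ai_metric (\<gamma> t) (velocity T \<gamma>' t - \<gamma>' t ** matrix_inv (\<gamma> t) ** \<gamma>' t) (dir_deriv \<psi> (u t) w)"
proof -
  have H: "subspace H" and inv: "\<And>x. x \<in> U \<Longrightarrow> \<psi> (\<phi> x) = x" and \<phi>U: "\<phi> ` U = V" and VH: "V \<subseteq> H"
    and smooth\<phi>: "smooth_map U \<phi>" and \<psi>V: "\<psi> ` V = U" and UM: "U \<subseteq> M"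
    using chart_onD[OF chart] by auto
  obtain B h where B: "open B" "\<phi> (\<gamma> t) \<in> H \<inter> B" "H \<inter> B \<subseteq> V" "\<And>k. Ck_on k B h" "\<And>x. x \<in> H \<inter> B \<Longrightarrow> \<psi> x = h x"
    using chart_on_local[OF chart t(2)] by metis
  obtain A0 where A0: "open A0" "U = M \<inter> A0" using chart by (auto simp: chart_on_def openin_open)
  have bot: "at s within T \<noteq> bot" if "s \<in> T" for s by (rule nondegenerate_interval_limit[OF T that])
  have "\<exists>d>0. \<forall>s\<in>T. dist s t < d \<longrightarrow> \<gamma> s \<in> U"
  proof -
    have "continuous (at t within T) \<gamma>" using smooth_map_continuous_on[OF \<gamma>] t continuous_on_eq_continuous_within by blast
    then have "\<exists>d>0. \<forall>s\<in>T. dist s t < d \<longrightarrow> \<gamma> s \<in> A0"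
      using continuous_within_open_dist[OF _ A0(1)] A0(2) t(2) by blast
    then show ?thesis using A0 \<gamma>M by blast
  qed
  then obtain d1 where d1: "d1 > 0" "\<And>s. s \<in> T \<Longrightarrow> dist s t < d1 \<Longrightarrow> \<gamma> s \<in> U" by blast
  define T1 where "T1 = T \<inter> ball t d1"
  have "continuous_on T1 u"
    unfolding u_def by (intro continuous_on_compose continuous_on_subset[OF smooth_map_continuous_on[OF \<gamma>]] continuous_on_subset[OF smooth_map_continuous_on[OF smooth\<phi>]])
      (use d1 in \<open>auto simp: T1_def dist_commute\<close>)
  then have "continuous (at t within T1) u" using t d1 by (simp add: continuous_on_eq_continuous_within T1_def)
  then have "\<exists>d>0. \<forall>s\<in>T1. dist s t < d \<longrightarrow> u s \<in> B"
    by (rule continuous_within_open_dist) (use B(1,2) in \<open>simp_all add: u_def\<close>)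
  then obtain d2 where d2: "d2 > 0" "\<And>s. s \<in> T1 \<Longrightarrow> dist s t < d2 \<Longrightarrow> u s \<in> B" by blast
  \<comment> \<open>On \<open>T'\<close> below, a relatively open part of \<open>T\<close> around
    \<open>t\<close>, the curve stays in the chart domain and its coordinates stay where
    \<open>\<psi>\<close> has the smooth extension \<open>h\<close>. Derivatives within
    \<open>T'\<close> and within \<open>T\<close> agree.\<close>
  define J where "J = ball t (min d1 d2)"
  define T' where "T' = T \<inter> J"
  have J: "open J" "t \<in> J" using d1 d2 by (auto simp: J_def)
  have T': "t \<in> T'" "T' \<subseteq> T" using t J by (auto simp: T'_def)
  have \<gamma>U: "\<gamma> s \<in> U" and uB: "u s \<in> H \<inter> B" if "s \<in> T'" for s
  proof -
    show "\<gamma> s \<in> U" using that d1 by (auto simp: T'_def J_def dist_commute)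
    then have "u s \<in> H" using \<phi>U VH by (auto simp: u_def)
    moreover have "u s \<in> B" using that d1 d2 by (auto simp: T'_def J_def T1_def dist_commute)
    ultimately show "u s \<in> H \<inter> B" by simp
  qed
  have at: "at s within T' = at s within T" if "s \<in> T'" for s
    by (rule at_within_nhd[of s J]) (use that J in \<open>auto simp: T'_def\<close>)
  have bot': "at s within T' \<noteq> bot" if "s \<in> T'" for s
    using at[OF that] bot T' that by auto
  have vel: "velocity T' f s = velocity T f s" if "s \<in> T'" for s and f :: "real \<Rightarrow> real^'n^'n"
    using at[OF that] by (simp add: velocity_def)
  have sm\<gamma>: "smooth_map T' \<gamma>" using smooth_map_subset[OF \<gamma> T'(2)] .
  have smu: "smooth_map T' u"
    unfolding u_def comp_def by (rule smooth_map_compose[OF sm\<gamma> smooth\<phi>]) (use \<gamma>U in auto)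
  define u' where "u' = velocity T u"
  define u'' where "u'' = velocity T u' t"
  have du: "(u has_vector_derivative u' s) (at s within T')" if "s \<in> T'" for s
    using smooth_curve_velocity(1)[OF smu bot' that] vel[OF that] by (simp add: u'_def)
  have smu': "smooth_map T' u'"
    by (rule smooth_map_cong[OF smooth_curve_velocity(2)[OF smu bot']]) (auto simp: u'_def vel)
  then have du': "(u' has_vector_derivative u'') (at t within T')"
    using smooth_curve_velocity(1)[OF smu' bot' T'(1)] vel[OF T'(1), of u'] by (simp add: u''_def)
  have u'H: "u' s \<in> H" if "s \<in> T'" for s
    by (rule has_vector_derivative_mem_subspace[OF H du[OF that] _ that bot'[OF that]]) (use uB in auto)
  have u''H: "u'' \<in> H"
    by (rule has_vector_derivative_mem_subspace[OF H du' u'H T'(1) bot'[OF T'(1)]])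
  \<comment> \<open>From here on \<open>\<psi>\<close> is replaced by \<open>h\<close>, whose
    derivatives exist in all directions of the ambient space. Velocity and acceleration of the curve
    are then expressed by the first and second derivatives of \<open>h\<close>.\<close>
  let ?D = "\<lambda>a v. frechet_derivative h (at v) a"
  let ?DD = "\<lambda>a b v. frechet_derivative (?D a) (at v) b"
  have Dh: "(h has_derivative (\<lambda>a. ?D a v)) (at v)" if "v \<in> B" for v using Ck_on_SucD[OF B(4) that] .
  have CD: "Ck_on k B (?D a)" for k a using B(4)[of "Suc k"] by simp
  have DDh: "(?D a has_derivative (\<lambda>b. ?DD a b v)) (at v)" if "v \<in> B" for v a using Ck_on_SucD[OF CD that] .
  have Dexp: "?D a v = (\<Sum>b\<in>Basis. (a \<bullet> b) *\<^sub>R ?D b v)" if "v \<in> B" for a v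
    by (rule linear_Basis_expansion[OF has_derivative_linear[OF Dh[OF that]]])
  have utB: "u t \<in> B" "u t \<in> H \<inter> B" using uB[OF T'(1)] by auto
  have DDexp: "?DD a c (u t) = (\<Sum>b\<in>Basis. (a \<bullet> b) *\<^sub>R ?DD b c (u t))" for a c
  proof -
    have "((\<lambda>v. \<Sum>b\<in>Basis. (a \<bullet> b) *\<^sub>R ?D b v) has_derivative (\<lambda>c. \<Sum>b\<in>Basis. (a \<bullet> b) *\<^sub>R ?DD b c (u t))) (at (u t))"
      by (intro has_derivative_sum has_derivative_scaleR_right DDh utB)
    then have "(?D a has_derivative (\<lambda>c. \<Sum>b\<in>Basis. (a \<bullet> b) *\<^sub>R ?DD b c (u t))) (at (u t))"
      by (rule has_derivative_transform_within_open[OF _ B(1) utB(1)]) (rule Dexp[symmetric])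
    from has_derivative_unique[OF this DDh[OF utB(1)]] show ?thesis by metis
  qed
  have \<gamma>h: "\<gamma> s = h (u s)" if "s \<in> T'" for s
    using inv[OF \<gamma>U[OF that]] B(5)[OF uB[OF that]] by (simp add: u_def)
  have v1: "\<gamma>' s = ?D (u' s) (u s)" if s: "s \<in> T'" for s
  proof -
    have "u s \<in> B" using uB[OF s] by simp
    from vector_derivative_diff_chain_within[OF du[OF s] has_derivative_at_withinI[OF Dh[OF this]]]
    have "((\<lambda>s. h (u s)) has_vector_derivative ?D (u' s) (u s)) (at s within T')" by (simp add: o_def)
    then have "(\<gamma> has_vector_derivative ?D (u' s) (u s)) (at s within T')"
      by (rule has_vector_derivative_transform[OF s, rotated]) (rule \<gamma>h)
    then have "velocity T' \<gamma> s = ?D (u' s) (u s)"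
      unfolding velocity_def by (intro vector_derivative_within bot' s)
    then show ?thesis by (simp add: \<gamma>'_def vel[OF s])
  qed
  have v2: "velocity T \<gamma>' t = ?D u'' (u t) + ?DD (u' t) (u' t) (u t)"
  proof -
    have "((\<lambda>s. ?D b (u s)) has_vector_derivative ?DD b (u' t) (u t)) (at t within T')" for b
      using vector_derivative_diff_chain_within[OF du[OF T'(1)] has_derivative_at_withinI[OF DDh[OF utB(1)]]] by (simp add: o_def)
    then have "((\<lambda>s. \<Sum>b\<in>Basis. (u' s \<bullet> b) *\<^sub>R ?D b (u s)) has_vector_derivative
        (\<Sum>b\<in>Basis. (u' t \<bullet> b) *\<^sub>R ?DD b (u' t) (u t) + (u'' \<bullet> b) *\<^sub>R ?D b (u t))) (at t within T')"
      by (intro has_vector_derivative_sum bounded_bilinear.has_vector_derivative[OF bounded_bilinear_scaleR]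
          bounded_linear.has_vector_derivative[OF bounded_linear_inner_left] du')
    also have "(\<Sum>b\<in>Basis. (u' t \<bullet> b) *\<^sub>R ?DD b (u' t) (u t) + (u'' \<bullet> b) *\<^sub>R ?D b (u t)) =
        ?DD (u' t) (u' t) (u t) + ?D u'' (u t)"
      unfolding sum.distrib DDexp[symmetric] Dexp[OF utB(1), symmetric] ..
    finally have "(\<gamma>' has_vector_derivative ?DD (u' t) (u' t) (u t) + ?D u'' (u t)) (at t within T')"
    proof (rule has_vector_derivative_transform[OF T'(1), rotated])
      fix s assume s: "s \<in> T'"
      then have "u s \<in> B" using uB by blast
      then show "\<gamma>' s = (\<Sum>b\<in>Basis. (u' s \<bullet> b) *\<^sub>R ?D b (u s))"
        by (rule trans[OF v1[OF s] Dexp])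
    qed
    then have "velocity T' \<gamma>' t = ?DD (u' t) (u' t) (u t) + ?D u'' (u t)"
      unfolding velocity_def by (intro vector_derivative_within bot' T'(1))
    then show ?thesis by (simp add: vel[OF T'(1)] add.commute)
  qed
  have dd: "dir_deriv \<psi> v a = ?D a v" if "v \<in> H \<inter> B" "a \<in> H" for v a
    using that by (intro dir_deriv_openin[OF H B(1) _ _ B(5)] Dh) auto
  have G: "coord_metric ai_metric \<psi> v a b = ai_metric (h v) (?D a v) (?D b v)" if "v \<in> H \<inter> B" "a \<in> H" "b \<in> H" for v a b
    using that B(5) by (simp add: coord_metric_def dd)
  have hut: "h (u t) = \<gamma> t" using \<gamma>h[OF T'(1)] by simp
  have GL: "h (u t) \<in> GL" using \<gamma>M M SPD_subset_GL t by (auto simp: hut)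
  define p where "p = matrix_inv (\<gamma> t)"
  have dG: "dir_deriv (\<lambda>v. coord_metric ai_metric \<psi> v a b) (u t) c =
      ai_metric (\<gamma> t) (?DD a c (u t)) (?D b (u t)) + ai_metric (\<gamma> t) (?D a (u t)) (?DD b c (u t))
      - trace (p ** ?D c (u t) ** p ** ?D a (u t) ** p ** ?D b (u t)) - trace (p ** ?D a (u t) ** p ** ?D c (u t) ** p ** ?D b (u t))"
    if "a \<in> H" "b \<in> H" "c \<in> H" for a b c
    unfolding p_def hut[symmetric]
    by (rule dir_deriv_openin[OF H B(1) utB(2) that(3) G[OF _ that(1,2)]
          ai_metric_has_derivative[OF Dh[OF utB(1)] DDh[OF utB(1)] DDh[OF utB(1)] GL]])
  \<comment> \<open>By this symmetry the mixed second derivatives cancel in the Christoffel symbol.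
    The cubic traces coincide by cyclic invariance; four enter with sign minus and two with sign
    plus, which after halving leaves a single one with sign minus.\<close>
  have sym: "?DD w (u' t) (u t) = ?DD (u' t) w (u t)"
    by (rule second_derivative_symmetric[OF B(1) B(4) utB(1)])
  let ?\<alpha> = "?D (u' t) (u t)" and ?\<omega> = "?D w (u t)"
  have u'tH: "u' t \<in> H" using u'H[OF T'(1)] .
  have c1: "trace (p ** ?\<omega> ** p ** ?\<alpha> ** p ** ?\<alpha>) = trace (p ** ?\<alpha> ** p ** ?\<alpha> ** p ** ?\<omega>)"
    using trace_mul_sym[of "p ** ?\<omega>" "p ** ?\<alpha> ** p ** ?\<alpha>"] by (simp add: matrix_mul_assoc)
  have c2: "trace (p ** ?\<alpha> ** p ** ?\<omega> ** p ** ?\<alpha>) = trace (p ** ?\<alpha> ** p ** ?\<alpha> ** p ** ?\<omega>)"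
    using trace_mul_sym[of "p ** ?\<alpha> ** p ** ?\<omega>" "p ** ?\<alpha>"] by (simp add: matrix_mul_assoc)
  have "christoffel (coord_metric ai_metric \<psi>) (u t) (u' t) (u' t) w =
     ai_metric (\<gamma> t) (?DD (u' t) (u' t) (u t)) ?\<omega> - trace (p ** ?\<alpha> ** p ** ?\<alpha> ** p ** ?\<omega>)"
    unfolding christoffel_def dG[OF u'tH w u'tH] dG[OF u'tH u'tH w] c1 c2 sym
    using ai_metric_commute[of "\<gamma> t" "?DD (u' t) w (u t)" ?\<alpha>] by (simp add: field_simps)
  moreover have "coord_metric ai_metric \<psi> (u t) u'' w = ai_metric (\<gamma> t) (?D u'' (u t)) ?\<omega>"
    using G[OF utB(2) u''H w] hut by simp
  moreover have "ai_metric (\<gamma> t) (velocity T \<gamma>' t - \<gamma>' t ** matrix_inv (\<gamma> t) ** \<gamma>' t) (dir_deriv \<psi> (u t) w) =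
     ai_metric (\<gamma> t) (?D u'' (u t)) ?\<omega> + ai_metric (\<gamma> t) (?DD (u' t) (u' t) (u t)) ?\<omega> - trace (p ** ?\<alpha> ** p ** ?\<alpha> ** p ** ?\<omega>)"
    unfolding v2 v1[OF T'(1)] dd[OF utB(2) w] ai_metric_def p_def[symmetric]
    by (simp add: mat_algebra trace_linear)
  ultimately show ?thesis by (simp add: u'_def u''_def)
qed

section \<open>Geodesics and distance of the affine-invariant metric\<close>

text \<open>The action of \<open>GL\<close> on \<open>SPD\<close> by isometries. Every point has the
  form \<open>congr g (mat 1)\<close>, so questions about \<open>SPD\<close> can be moved to the
  identity matrix.\<close>

definition congr :: "real^'n^'n \<Rightarrow> real^'n^'n \<Rightarrow> real^'n^'n" where
  "congr g y = g ** y ** transpose g"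

lemma bounded_linear_congr: "bounded_linear (congr g)"
  unfolding congr_def by (rule bounded_linear_compose[OF mm.bounded_linear_left mm.bounded_linear_right])

lemmas congr_linear = linear_add[OF bounded_linear.linear[OF bounded_linear_congr]]
  linear_diff[OF bounded_linear.linear[OF bounded_linear_congr]]
  linear_0[OF bounded_linear.linear[OF bounded_linear_congr]]

lemma congr_congr: "congr g (congr h y) = congr (g ** h) y"
  by (simp add: congr_def matrix_transpose_mul matrix_mul_assoc)

lemma congr_mat_1 [simp]: "congr (mat 1) y = y"
  by (simp add: congr_def)

lemma congr_inv:
  assumes "invertible g"
  shows "congr (matrix_inv g) (congr g y) = y" "congr g (congr (matrix_inv g) y) = y"
  by (simp_all add: congr_congr matrix_inv_works[OF assms])

lemma invertible_mat_1 [simp]: "invertible (mat 1 :: real^'n^'n)"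
  using matrix_inv_unique(1)[of "mat 1" "mat 1"] by simp

lemma matrix_inv_mat_1 [simp]: "matrix_inv (mat 1 :: real^'n^'n) = mat 1"
  using matrix_inv_unique(2)[of "mat 1" "mat 1"] by simp

lemma congr_Sym: "y \<in> Sym \<Longrightarrow> congr g y \<in> Sym"
  by (simp add: Sym_def congr_def matrix_transpose_mul matrix_mul_assoc)

lemma congr_SPD: "invertible g \<Longrightarrow> y \<in> SPD \<Longrightarrow> congr g y \<in> SPD"
  unfolding congr_def by (rule SPD_congruence)

lemma invertible_matrix_inv: "invertible g \<Longrightarrow> invertible (matrix_inv g :: real^'n^'n)"
  using matrix_inv_unique(1)[OF matrix_inv_works(1)] .

lemma congr_mexp:
  assumes "X \<in> Sym" shows "congr (mexp X) y = mexp X ** y ** mexp X"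
  using assms by (simp add: congr_def mexp_transpose Sym_transpose)

lemma matrix_inv_congr:
  assumes g: "invertible g" and y: "invertible y"
  shows "matrix_inv (congr g y) = transpose (matrix_inv g) ** matrix_inv y ** matrix_inv g"
proof (rule matrix_inv_unique(2))
  have t: "transpose g ** transpose (matrix_inv g) = mat 1"
    by (simp add: matrix_transpose_mul[symmetric] matrix_inv_works[OF g])
  have "congr g y ** (transpose (matrix_inv g) ** matrix_inv y ** matrix_inv g) =
      g ** y ** (transpose g ** transpose (matrix_inv g)) ** matrix_inv y ** matrix_inv g"
    by (simp add: congr_def matrix_mul_assoc)
  also have "\<dots> = g ** (y ** matrix_inv y) ** matrix_inv g" by (simp add: t matrix_mul_assoc)
  also have "\<dots> = mat 1" by (simp add: matrix_inv_works g y)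
  finally show "congr g y ** (transpose (matrix_inv g) ** matrix_inv y ** matrix_inv g) = mat 1" .
qed

lemma ai_metric_congr:
  assumes g: "invertible g" and y: "invertible y"
  shows "ai_metric (congr g y) (congr g A) (congr g B) = ai_metric y A B"
proof -
  let ?i = "matrix_inv g"
  have t: "transpose g ** transpose ?i = mat 1"
    by (simp add: matrix_transpose_mul[symmetric] matrix_inv_works[OF g])
  have "ai_metric (congr g y) (congr g A) (congr g B) =
    trace (transpose ?i ** matrix_inv y ** (?i ** g) ** A ** (transpose g ** transpose ?i) ** matrix_inv y ** (?i ** g) ** B ** transpose g)"
    unfolding ai_metric_def matrix_inv_congr[OF g y] by (simp add: congr_def matrix_mul_assoc)
  also have "\<dots> = trace (transpose ?i ** (matrix_inv y ** A ** matrix_inv y ** B ** transpose g))"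
    by (simp add: t matrix_inv_works[OF g] matrix_mul_assoc)
  also have "\<dots> = trace (matrix_inv y ** A ** matrix_inv y ** B ** (transpose g ** transpose ?i))"
    by (subst trace_mul_sym) (simp add: matrix_mul_assoc)
  finally show ?thesis by (simp add: t ai_metric_def)
qed

lemma ai_metric_mat_1: "A \<in> Sym \<Longrightarrow> ai_metric (mat 1) A B = A \<bullet> B"
  by (simp add: ai_metric_def inner_trace Sym_transpose)

lemma mexp_congr_half:
  assumes "Z \<in> Sym" shows "congr (mexp ((1/2) *\<^sub>R Z)) (mat 1) = mexp Z"
  using assms by (simp add: congr_mexp subspace_scale[OF subspace_Sym] mexp_double)

lemma dexp_congr:
  assumes "Z \<in> Sym" shows "dexp Z C = congr (mexp ((1/2) *\<^sub>R Z)) (dexp_sym Z C)"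
  using assms by (simp add: congr_mexp subspace_scale[OF subspace_Sym] dexp_eq)

lemma ai_metric_dexp:
  assumes "Z \<in> Sym" "C \<in> Sym"
  shows "ai_metric (mexp Z) (dexp Z C) (dexp Z C) = dexp_sym Z C \<bullet> dexp_sym Z C"
proof -
  have "ai_metric (mexp Z) (dexp Z C) (dexp Z C) =
    ai_metric (congr (mexp ((1/2) *\<^sub>R Z)) (mat 1)) (congr (mexp ((1/2) *\<^sub>R Z)) (dexp_sym Z C)) (congr (mexp ((1/2) *\<^sub>R Z)) (dexp_sym Z C))"
    by (simp only: mexp_congr_half[OF assms(1)] dexp_congr[OF assms(1)])
  also have "\<dots> = ai_metric (mat 1) (dexp_sym Z C) (dexp_sym Z C)"
    by (rule ai_metric_congr) simp_all
  finally show ?thesis using dexp_sym_Sym[OF assms] by (simp add: ai_metric_mat_1)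
qed

lemma ai_metric_eq_0:
  assumes x: "x \<in> SPD" and A: "A \<in> Sym" and 0: "ai_metric x A A = 0"
  shows "A = 0"
proof -
  let ?g = "mexp ((1/2) *\<^sub>R mlog x)"
  have g: "invertible ?g" by simp
  define A' where "A' = congr (matrix_inv ?g) A"
  have A': "A' \<in> Sym" unfolding A'_def by (rule congr_Sym[OF A])
  have A: "A = congr ?g A'" by (simp only: A'_def congr_inv[OF g])
  have "ai_metric (congr ?g (mat 1)) (congr ?g A') (congr ?g A') = ai_metric (mat 1) A' A'"
    by (rule ai_metric_congr) simp_all
  then have "A' \<bullet> A' = 0"
    using 0 x by (simp add: mexp_congr_half mlog_Sym A[symmetric] ai_metric_mat_1[OF A'])
  then show ?thesis by (simp add: A congr_linear)
qed

section \<open>Geodesics of the positive definite matrices\<close>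

lemma geodesicD:
  assumes "geodesic g M T \<gamma>"
  shows "nondegenerate_interval T" "smooth_map T \<gamma>" "\<gamma> ` T \<subseteq> M"
  using assms by (auto simp: geodesic_def nondegenerate_interval_def)

text \<open>The form of the geodesic equation without coordinates: whichever chart the definition
  supplies at \<open>t\<close>, \<open>chart_on_tangent\<close> provides the \<open>w\<close> that
  represents the test curve.\<close>

lemma geodesic_orthogonal:
  assumes geo: "geodesic ai_metric M T \<gamma>" and M: "M \<subseteq> SPD" and t: "t \<in> T"
    and c: "(c has_vector_derivative c') (at 0)" "c 0 = \<gamma> t" and I: "open I" "0 \<in> I" "\<And>s. s \<in> I \<Longrightarrow> c s \<in> M"
  shows "ai_metric (\<gamma> t) (velocity T (velocity T \<gamma>) t - velocity T \<gamma> t ** matrix_inv (\<gamma> t) ** velocity T \<gamma> t) c' = 0"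
proof -
  let ?eq = "\<lambda>\<phi> \<psi> w. coord_metric ai_metric \<psi> ((\<phi> \<circ> \<gamma>) t) (velocity T (velocity T (\<phi> \<circ> \<gamma>)) t) w +
      christoffel (coord_metric ai_metric \<psi>) ((\<phi> \<circ> \<gamma>) t) (velocity T (\<phi> \<circ> \<gamma>) t) (velocity T (\<phi> \<circ> \<gamma>) t) w = 0"
  have "\<exists>U H V \<phi> \<psi>. chart_on M U H V \<phi> \<psi> \<and> \<gamma> t \<in> U \<and> (\<forall>w\<in>H. ?eq \<phi> \<psi> w)"
    using geo unfolding geodesic_def Let_def by (elim conjE) (erule bspec[OF _ t])
  then obtain U H V \<phi> \<psi> where *: "chart_on M U H V \<phi> \<psi> \<and> \<gamma> t \<in> U \<and> (\<forall>w\<in>H. ?eq \<phi> \<psi> w)"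
    by (elim exE) (rule that)
  then have ch: "chart_on M U H V \<phi> \<psi>" "\<gamma> t \<in> U" and eq: "\<And>w. w \<in> H \<Longrightarrow> ?eq \<phi> \<psi> w"
    by simp_all
  obtain w where w: "w \<in> H" "dir_deriv \<psi> (\<phi> (\<gamma> t)) w = c'"
    using chart_on_tangent[OF ch c I] by auto
  show ?thesis
    using geodesic_equation[OF ch(1) M geodesicD(2,1,3)[OF geo] t ch(2) w(1)] eq[OF w(1)] w(2) by simp
qed

lemma velocity_Sym:
  assumes "nondegenerate_interval T" "smooth_map T \<gamma>" "\<And>t. t \<in> T \<Longrightarrow> \<gamma> t \<in> Sym" "t \<in> T"
  shows "velocity T \<gamma> t \<in> Sym"
proof (rule has_vector_derivative_mem_subspace[OF subspace_Sym])
  show "(\<gamma> has_vector_derivative velocity T \<gamma> t) (at t within T)"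
    by (rule smooth_curve_velocity(1)[OF assms(2) nondegenerate_interval_limit[OF assms(1)] assms(4)])
  show "at t within T \<noteq> bot" by (rule nondegenerate_interval_limit[OF assms(1,4)])
qed (use assms in auto)

text \<open>The covariant acceleration \<open>A\<close> is symmetric and \<open>SPD\<close> is open
  in \<open>Sym\<close>, so \<open>A\<close> itself is the velocity of a curve in
  \<open>SPD\<close>. Testing with it gives \<open>ai_metric (\<gamma> t) A A = 0\<close>.\<close>

lemma geodesic_SPD_acceleration:
  fixes \<gamma> :: "real \<Rightarrow> real^'n^'n"
  assumes geo: "geodesic ai_metric SPD T \<gamma>" and t: "t \<in> T"
  shows "velocity T (velocity T \<gamma>) t = velocity T \<gamma> t ** matrix_inv (\<gamma> t) ** velocity T \<gamma> t"
proof -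
  define A where "A = velocity T (velocity T \<gamma>) t - velocity T \<gamma> t ** matrix_inv (\<gamma> t) ** velocity T \<gamma> t"
  note T = geodesicD(1)[OF geo] and sm = geodesicD(2)[OF geo]
  have SPD: "\<gamma> s \<in> SPD" if "s \<in> T" for s using geodesicD(3)[OF geo] that by blast
  have v: "velocity T \<gamma> s \<in> Sym" if "s \<in> T" for s
    by (rule velocity_Sym[OF T sm SPD_Sym[OF SPD] that])
  have sm2: "smooth_map T (velocity T \<gamma>)" by (rule smooth_curve_velocity(2)[OF sm nondegenerate_interval_limit[OF T]])
  have "transpose (matrix_inv (\<gamma> t)) = matrix_inv (\<gamma> t)"
  proof -
    have "\<gamma> t = mexp (mlog (\<gamma> t))" using SPD[OF t] by simp
    then show ?thesis using Sym_transpose[OF mlog_Sym[OF SPD[OF t]]]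
      by (metis matrix_inv_mexp mexp_transpose linear_neg[OF linear_transpose])
  qed
  then have "velocity T \<gamma> t ** matrix_inv (\<gamma> t) ** velocity T \<gamma> t \<in> Sym"
    using Sym_transpose[OF v[OF t]] by (simp only: Sym_def matrix_transpose_mul matrix_mul_assoc mem_Collect_eq)
  moreover have "velocity T (velocity T \<gamma>) t \<in> Sym"
    by (rule velocity_Sym[OF T sm2 _ t]) (rule v)
  ultimately have A: "A \<in> Sym"
    unfolding A_def by (simp only: subspace_diff[OF subspace_Sym])
  note orth = geodesic_orthogonal[OF geo subset_refl t, folded A_def]
  have "ai_metric (\<gamma> t) A A = 0"
  proof (rule orth)
    show "((\<lambda>s. \<gamma> t + s *\<^sub>R A) has_vector_derivative A) (at 0)"
      by (auto intro!: derivative_eq_intros)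
    let ?I = "(\<lambda>s::real. \<gamma> t + s *\<^sub>R A) -` {Y. symm Y \<in> SPD}"
    show "open ?I" by (intro open_vimage smooth_mlog(1) continuous_intros)
    show "0 \<in> ?I" using SPD[OF t] symm_SPD by simp
    fix s assume "s \<in> ?I"
    moreover have "\<gamma> t + s *\<^sub>R A \<in> Sym" using SPD_Sym[OF SPD[OF t]] A by (intro subspace_add subspace_scale subspace_Sym)
    ultimately show "\<gamma> t + s *\<^sub>R A \<in> SPD" by simp
  qed simp
  then have "A = 0" by (rule ai_metric_eq_0[OF SPD[OF t] A])
  then show ?thesis by (simp add: A_def)
qed

lemma chart_on_SPD_id: "chart_on SPD SPD Sym SPD id id"
proof -
  have "SPD = Sym \<inter> {Y. symm Y \<in> SPD}" using SPD_Sym symm_SPD by fastforce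
  then have "openin (top_of_set Sym) SPD" using smooth_mlog(1) openin_open by blast
  moreover have "smooth_map SPD id"
    by (rule smooth_map_open[OF open_UNIV]) (auto intro!: Ck_on_linear bounded_linear_ident simp: id_def)
  ultimately show ?thesis
    by (simp add: chart_on_def subspace_Sym diffeomorphism_def)
qed

lemma geodesic_SPDI:
  fixes \<gamma> :: "real \<Rightarrow> real^'n^'n"
  assumes T: "nondegenerate_interval T" and sm: "smooth_map T \<gamma>" and SPD: "\<gamma> ` T \<subseteq> SPD"
    and ode: "\<And>t. t \<in> T \<Longrightarrow> velocity T (velocity T \<gamma>) t = velocity T \<gamma> t ** matrix_inv (\<gamma> t) ** velocity T \<gamma> t"
  shows "geodesic ai_metric SPD T \<gamma>"
  unfolding geodesic_def Let_def
proof (intro conjI ballI)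
  fix t assume t: "t \<in> T"
  have "\<gamma> t \<in> SPD" using SPD t by blast
  moreover have "\<forall>w\<in>Sym. coord_metric ai_metric id ((id \<circ> \<gamma>) t) (velocity T (velocity T (id \<circ> \<gamma>)) t) w +
      christoffel (coord_metric ai_metric id) ((id \<circ> \<gamma>) t) (velocity T (id \<circ> \<gamma>) t) (velocity T (id \<circ> \<gamma>) t) w = 0"
  proof
    fix w :: "real^'n^'n" assume w: "w \<in> Sym"
    show "coord_metric ai_metric id ((id \<circ> \<gamma>) t) (velocity T (velocity T (id \<circ> \<gamma>)) t) w +
      christoffel (coord_metric ai_metric id) ((id \<circ> \<gamma>) t) (velocity T (id \<circ> \<gamma>) t) (velocity T (id \<circ> \<gamma>) t) w = 0"
      using geodesic_equation[OF chart_on_SPD_id subset_refl sm T SPD t \<open>\<gamma> t \<in> SPD\<close> w] ode[OF t]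
      by (simp add: ai_metric_def mm.zero_left mm.zero_right linear_0[OF bounded_linear.linear[OF bounded_linear_trace]])
  qed
  ultimately show "\<exists>U H V \<phi> \<psi>. chart_on SPD U H V \<phi> \<psi> \<and> \<gamma> t \<in> U \<and>
     (\<forall>w\<in>H. coord_metric ai_metric \<psi> ((\<phi> \<circ> \<gamma>) t) (velocity T (velocity T (\<phi> \<circ> \<gamma>)) t) w +
       christoffel (coord_metric ai_metric \<psi>) ((\<phi> \<circ> \<gamma>) t) (velocity T (\<phi> \<circ> \<gamma>) t) (velocity T (\<phi> \<circ> \<gamma>) t) w = 0)"
    using chart_on_SPD_id by (intro exI[of _ SPD] exI[of _ Sym] exI[of _ id]) auto
qed (use T sm SPD in \<open>auto simp: nondegenerate_interval_def\<close>)

lemma velocity_eq: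
  "nondegenerate_interval T \<Longrightarrow> t \<in> T \<Longrightarrow> (f has_vector_derivative f') (at t within T) \<Longrightarrow> velocity T f t = f'"
  unfolding velocity_def by (rule vector_derivative_within[OF nondegenerate_interval_limit])

lemma velocity_cong:
  assumes "\<And>t. t \<in> T \<Longrightarrow> f t = g t" "t \<in> T"
  shows "velocity T f t = velocity T g t"
proof -
  have "(f has_vector_derivative d) (at t within T) \<longleftrightarrow> (g has_vector_derivative d) (at t within T)" for d
    using has_vector_derivative_transform[OF assms(2), of g f] has_vector_derivative_transform[OF assms(2), of f g] assms(1) by metis
  then show ?thesis by (simp add: velocity_def vector_derivative_def)
qed

definition geodesic_curve :: "real^'n^'n \<Rightarrow> real^'n^'n \<Rightarrow> real \<Rightarrow> real^'n^'n" where
  "geodesic_curve g B t = congr g (mexp (t *\<^sub>R B))"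

lemma nondegenerate_interval_cc:
  assumes "a < b" shows "nondegenerate_interval {a..b::real}"
proof -
  have "a \<in> {a..b}" "b \<in> {a..b}" using assms by auto
  with assms show ?thesis unfolding nondegenerate_interval_def using is_interval_cc by blast
qed

lemma nondegenerate_interval_01: "nondegenerate_interval {0..1::real}"
  by (rule nondegenerate_interval_cc) simp

lemma geodesic_curve_derivative:
  "(geodesic_curve g B has_vector_derivative congr g (B ** mexp (t *\<^sub>R B))) (at t within T)"
  unfolding geodesic_curve_def
  by (rule bounded_linear.has_vector_derivative[OF bounded_linear_congr mexp_has_vector_derivative])

lemma geodesic_curve_SPD: "invertible g \<Longrightarrow> B \<in> Sym \<Longrightarrow> geodesic_curve g B t \<in> SPD"
  unfolding geodesic_curve_def by (intro congr_SPD mexp_SPD subspace_scale subspace_Sym)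

lemma smooth_geodesic_curve: "smooth_map T (geodesic_curve g B)"
proof (rule smooth_map_open[OF open_UNIV subset_UNIV])
  show "Ck_on k UNIV (geodesic_curve g B)" for k
    unfolding geodesic_curve_def
    by (intro Ck_on_compose_linear[OF bounded_linear_congr open_UNIV] Ck_on_mexp open_UNIV Ck_on_linear bounded_linear_scaleR_left)
qed

lemma geodesic_geodesic_curve:
  assumes g: "invertible g" and B: "B \<in> Sym"
  shows "geodesic ai_metric SPD {0..1} (geodesic_curve g B)"
proof (rule geodesic_SPDI[OF nondegenerate_interval_01 smooth_geodesic_curve])
  show "geodesic_curve g B ` {0..1} \<subseteq> SPD" using geodesic_curve_SPD[OF g B] by blast
  fix t :: real assume t: "t \<in> {0..1}"
  have v: "velocity {0..1} (geodesic_curve g B) t = congr g (B ** mexp (t *\<^sub>R B))" if "t \<in> {0..1}" for t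
    by (rule velocity_eq[OF nondegenerate_interval_01 that geodesic_curve_derivative])
  have d: "((\<lambda>t. congr g (B ** mexp (t *\<^sub>R B))) has_vector_derivative congr g (B ** (B ** mexp (t *\<^sub>R B)))) (at t within {0..1})"
    by (intro bounded_linear.has_vector_derivative[OF bounded_linear_congr]
        bounded_linear.has_vector_derivative[OF mm.bounded_linear_right] mexp_has_vector_derivative)
  have a: "velocity {0..1} (velocity {0..1} (geodesic_curve g B)) t = congr g (B ** (B ** mexp (t *\<^sub>R B)))"
    using velocity_cong[of "{0..1}" "velocity {0..1} (geodesic_curve g B)" "\<lambda>t. congr g (B ** mexp (t *\<^sub>R B))" t] v t
      velocity_eq[OF nondegenerate_interval_01 t d] by simp
  have i: "matrix_inv (geodesic_curve g B t) = transpose (matrix_inv g) ** mexp (- (t *\<^sub>R B)) ** matrix_inv g"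
    by (simp add: geodesic_curve_def matrix_inv_congr[OF g])
  have tr: "transpose g ** transpose (matrix_inv g) = mat 1"
    by (simp add: matrix_transpose_mul[symmetric] matrix_inv_works[OF g])
  have "congr g (B ** mexp (t *\<^sub>R B)) ** (transpose (matrix_inv g) ** mexp (- (t *\<^sub>R B)) ** matrix_inv g) ** congr g (B ** mexp (t *\<^sub>R B))
    = g ** B ** mexp (t *\<^sub>R B) ** (transpose g ** transpose (matrix_inv g)) ** mexp (- (t *\<^sub>R B)) ** (matrix_inv g ** g) ** B ** mexp (t *\<^sub>R B) ** transpose g"
    by (simp add: congr_def matrix_mul_assoc)
  also have "\<dots> = congr g (B ** (B ** mexp (t *\<^sub>R B)))"
    by (simp add: congr_def tr matrix_inv_works[OF g] matrix_mul_assoc)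
  finally show "velocity {0..1} (velocity {0..1} (geodesic_curve g B)) t =
    velocity {0..1} (geodesic_curve g B) t ** matrix_inv (geodesic_curve g B t) ** velocity {0..1} (geodesic_curve g B) t"
    by (simp add: v[OF t] a i)
qed

text \<open>The geodesic equation says that \<open>\<eta>^-1 \<eta>'\<close> is a constant
  \<open>C\<close>. What remains is the linear equation \<open>\<eta>' = \<eta> C\<close>, and the
  end point determines \<open>C\<close>.\<close>

lemma geodesic_SPD_unique:
  fixes \<eta> :: "real \<Rightarrow> real^'n^'n"
  assumes geo: "geodesic ai_metric SPD {0..1} \<eta>" and g: "invertible g" and \<eta>0: "\<eta> 0 = congr g (mat 1)" and t: "t \<in> {0..1}"
  shows "\<eta> t = geodesic_curve g (mlog (congr (matrix_inv g) (\<eta> 1))) t"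
proof -
  let ?T = "{0..1::real}"
  note T = nondegenerate_interval_01 and sm = geodesicD(2)[OF geo]
  have SPD: "\<eta> s \<in> SPD" if "s \<in> ?T" for s using geodesicD(3)[OF geo] that by blast
  define v where "v = velocity ?T \<eta>"
  have d1: "(\<eta> has_vector_derivative v s) (at s within ?T)" if "s \<in> ?T" for s
    unfolding v_def by (rule smooth_curve_velocity(1)[OF sm nondegenerate_interval_limit[OF T] that])
  have sm2: "smooth_map ?T v" unfolding v_def by (rule smooth_curve_velocity(2)[OF sm nondegenerate_interval_limit[OF T]])
  have d2: "(v has_vector_derivative v s ** matrix_inv (\<eta> s) ** v s) (at s within ?T)" if "s \<in> ?T" for s
    using smooth_curve_velocity(1)[OF sm2 nondegenerate_interval_limit[OF T] that] geodesic_SPD_acceleration[OF geo that] by (simp add: v_def)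
  have di: "((\<lambda>s. matrix_inv (\<eta> s)) has_vector_derivative - (matrix_inv (\<eta> s) ** v s ** matrix_inv (\<eta> s))) (at s within ?T)" if "s \<in> ?T" for s
  proof -
    have "(matrix_inv has_derivative (\<lambda>h. - (matrix_inv (\<eta> s) ** h ** matrix_inv (\<eta> s)))) (at (\<eta> s) within \<eta> ` ?T)"
      by (rule has_derivative_at_withinI[OF matrix_inv_has_derivative[OF subsetD[OF SPD_subset_GL SPD[OF that]]]])
    from vector_derivative_diff_chain_within[OF d1[OF that] this] show ?thesis by (simp add: o_def)
  qed
  have "((\<lambda>s. matrix_inv (\<eta> s) ** v s) has_vector_derivative 0) (at s within ?T)" if "s \<in> ?T" for s
    using mm.has_vector_derivative[OF di[OF that] d2[OF that]] by (simp add: mat_algebra)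
  from has_vector_derivative_zero_constant[OF convex_real_interval(5) this]
  obtain C where C: "\<And>s. s \<in> ?T \<Longrightarrow> matrix_inv (\<eta> s) ** v s = C" by blast
  have vC: "v s = \<eta> s ** C" if "s \<in> ?T" for s
  proof -
    have "\<eta> s ** (matrix_inv (\<eta> s) ** v s) = v s"
      by (simp add: matrix_mul_assoc matrix_inv_works(2)[OF SPD_invertible[OF SPD[OF that]]])
    then show ?thesis by (simp add: C[OF that])
  qed
  have "\<eta> s = \<eta> 0 ** mexp (s *\<^sub>R C)" if "s \<in> ?T" for s
  proof (rule mexp_ode_unique[of ?T])
    show "(\<eta> has_vector_derivative \<eta> r ** C) (at r within ?T)" if "r \<in> ?T" for r
      using d1[OF that] by (simp only: vC[OF that])
  qed (use that is_interval_cc in auto)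
  \<comment> \<open>The initial velocity translated to the identity. It is symmetric, and
    \<open>C\<close> is its conjugate by \<open>transpose g\<close>, so the exponential of
    \<open>C\<close> can be expressed by that of \<open>S\<close>.\<close>
  moreover define S where "S = congr (matrix_inv g) (v 0)"
  have S: "S \<in> Sym"
    unfolding S_def v_def by (intro congr_Sym velocity_Sym[OF T sm]) (use SPD SPD_Sym in auto)
  have tr: "transpose g ** transpose (matrix_inv g) = mat 1" "transpose (matrix_inv g) ** transpose g = mat 1"
    by (simp_all add: matrix_transpose_mul[symmetric] matrix_inv_works[OF g])
  have C0: "C = transpose (matrix_inv g) ** S ** transpose g"
  proof -
    have "C = transpose (matrix_inv g) ** matrix_inv g ** v 0"
      using C[of 0] by (simp add: \<eta>0 matrix_inv_congr[OF g])
    also have "\<dots> = transpose (matrix_inv g) ** matrix_inv g ** v 0 ** (transpose (matrix_inv g) ** transpose g)"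
      by (simp add: tr)
    also have "\<dots> = transpose (matrix_inv g) ** S ** transpose g" by (simp add: S_def congr_def matrix_mul_assoc)
    finally show ?thesis .
  qed
  have mC: "mexp (s *\<^sub>R C) = transpose (matrix_inv g) ** mexp (s *\<^sub>R S) ** transpose g" for s
    using mexp_conj[OF tr(1), of "s *\<^sub>R S"] by (simp add: C0 mat_algebra)
  ultimately have eq: "\<eta> s = geodesic_curve g S s" if "s \<in> ?T" for s
  proof -
    have "\<eta> s = g ** (transpose g ** transpose (matrix_inv g)) ** mexp (s *\<^sub>R S) ** transpose g"
      using \<open>\<And>s. s \<in> ?T \<Longrightarrow> \<eta> s = \<eta> 0 ** mexp (s *\<^sub>R C)\<close>[OF that] by (simp add: \<eta>0 mC congr_def matrix_mul_assoc)
    then show ?thesis by (simp add: tr geodesic_curve_def congr_def)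
  qed
  have "mlog (congr (matrix_inv g) (\<eta> 1)) = S"
    using eq[of 1] S by (simp add: geodesic_curve_def congr_inv[OF g])
  then show ?thesis using eq[OF t] by simp
qed

section \<open>Lengths of curves and the distance function\<close>

lemma mlog_curve_length:
  fixes \<gamma> :: "real \<Rightarrow> real^'n^'n"
  assumes ab: "0 \<le> a" "a < b" "b \<le> 1" and sm: "smooth_map {a..b} \<gamma>" and SPD: "\<And>t. t \<in> {a..b} \<Longrightarrow> \<gamma> t \<in> SPD"
    and g: "invertible g"
  defines "speed \<equiv> \<lambda>t. sqrt (ai_metric (\<gamma> t) (velocity {0..1} \<gamma> t) (velocity {0..1} \<gamma> t))"
    and "c \<equiv> \<lambda>t. mlog (congr g (\<gamma> t))"
  shows "speed integrable_on {a..b}" "norm (c b - c a) \<le> integral {a..b} speed"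
proof -
  let ?T = "{a..b}"
  have T: "nondegenerate_interval ?T"
    by (rule nondegenerate_interval_cc[OF ab(2)])
  note bot = nondegenerate_interval_limit[OF T]
  define v where "v = velocity ?T \<gamma>"
  define sp where "sp t = sqrt (ai_metric (\<gamma> t) (v t) (v t))" for t
  have d: "(\<gamma> has_vector_derivative v t) (at t within ?T)" if "t \<in> ?T" for t
    unfolding v_def by (rule smooth_curve_velocity(1)[OF sm bot that])
  have cv: "continuous_on ?T v"
    unfolding v_def by (rule smooth_map_continuous_on[OF smooth_curve_velocity(2)[OF sm bot]])
  have "continuous_on GL (matrix_inv :: real^'n^'n \<Rightarrow> _)" using Ck_on_matrix_inv[of 0] by simp
  then have ci: "continuous_on ?T (\<lambda>t. matrix_inv (\<gamma> t))"
    by (rule continuous_on_compose2[OF _ smooth_map_continuous_on[OF sm]])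
      (auto intro!: subsetD[OF SPD_subset_GL] SPD)
  have csp: "continuous_on ?T sp"
    unfolding sp_def ai_metric_def
    by (intro continuous_on_real_sqrt bounded_linear.continuous_on[OF bounded_linear_trace] mm.continuous_on ci cv)
  have sp_int: "sp integrable_on ?T" by (rule integrable_continuous_interval[OF csp])
  \<comment> \<open>Length is defined with derivatives within the whole unit interval, but
    smoothness is given on \<open>{a..b}\<close> alone. The two speeds agree in the interior, and
    the end points do not affect the integral.\<close>
  have speed: "speed t = sp t" if "t \<in> ?T - {a, b}" for t
  proof -
    have t: "t \<in> {a<..<b}" using that by auto
    have "at t within ?T = at t within {0..1}"
      by (rule at_within_nhd[of t "{a<..<b}"]) (use t ab in auto)
    then show ?thesis by (simp add: speed_def sp_def v_def velocity_def)
  qed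
  have "(sp has_integral integral ?T sp) ?T" using sp_int by (rule integrable_integral)
  then have hi: "(speed has_integral integral ?T sp) ?T"
    by (rule has_integral_spike_finite[of "{a, b}", rotated 2]) (use speed in auto)
  then show "speed integrable_on ?T" by blast
  have "\<exists>c'. (c has_vector_derivative c') (at t within ?T) \<and> norm c' \<le> sp t" if t: "t \<in> ?T" for t
  proof -
    have "((\<lambda>t. congr g (\<gamma> t)) has_vector_derivative congr g (v t)) (at t within ?T)"
      by (rule bounded_linear.has_vector_derivative[OF bounded_linear_congr d[OF t]])
    from mlog_has_vector_derivative[OF this t bot[OF t]]
    obtain c' where c': "(c has_vector_derivative c') (at t within ?T)" "c' \<in> Sym" "dexp (c t) c' = congr g (v t)"
      unfolding c_def using congr_SPD[OF g SPD] by metis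
    have cS: "c t \<in> Sym" unfolding c_def by (intro mlog_Sym congr_SPD g SPD t)
    have mc: "mexp (c t) = congr g (\<gamma> t)" unfolding c_def by (intro mexp_mlog congr_SPD g SPD t)
    have "dexp_sym (c t) c' \<bullet> dexp_sym (c t) c' = ai_metric (\<gamma> t) (v t) (v t)"
      using ai_metric_dexp[OF cS c'(2)] ai_metric_congr[OF g SPD_invertible[OF SPD[OF t]], of "v t" "v t"] by (simp add: mc c'(3))
    then have "norm (dexp_sym (c t) c') = sp t" by (simp add: sp_def norm_eq_sqrt_inner)
    then show ?thesis using c'(1) norm_dexp_sym_ge[OF cS, of c'] by auto
  qed
  then obtain c' where c': "\<And>t. t \<in> ?T \<Longrightarrow> (c has_vector_derivative c' t) (at t within ?T)" "\<And>t. t \<in> ?T \<Longrightarrow> norm (c' t) \<le> sp t"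
    by metis
  have "(c' has_integral c b - c a) ?T"
    by (rule fundamental_theorem_of_calculus) (use ab c' in auto)
  then have "norm (c b - c a) \<le> integral ?T sp"
    using integral_norm_bound_integral[OF _ sp_int c'(2)] by (metis has_integral_integrable_integral)
  then show "norm (c b - c a) \<le> integral {a..b} speed"
    using hi by (simp add: has_integral_integrable_integral)
qed

lemma riem_length_ge:
  fixes \<gamma> :: "real \<Rightarrow> real^'n^'n"
  assumes ps: "piecewise_smooth \<gamma>" and SPD: "\<gamma> ` {0..1} \<subseteq> SPD" and g: "invertible g"
  shows "norm (mlog (congr g (\<gamma> 1)) - mlog (congr g (\<gamma> 0))) \<le> riem_length ai_metric \<gamma>"
proof -
  let ?s = "\<lambda>t. sqrt (ai_metric (\<gamma> t) (velocity {0..1} \<gamma> t) (velocity {0..1} \<gamma> t))" and ?c = "\<lambda>t. mlog (congr g (\<gamma> t))"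
  obtain B where B: "finite B" "\<And>a b. 0 \<le> a \<Longrightarrow> a < b \<Longrightarrow> b \<le> 1 \<Longrightarrow> {a<..<b} \<inter> B = {} \<Longrightarrow> smooth_map {a..b} \<gamma>"
    using ps unfolding piecewise_smooth_def by blast
  have "?s integrable_on {a..b} \<and> norm (?c b - ?c a) \<le> integral {a..b} ?s"
    if "0 \<le> a" "a < b" "b \<le> 1" for a b
    using that
  \<comment> \<open>Induction on the number of break points inside the interval: cutting at one of
    them leaves fewer on either side.\<close>
  proof (induction "card ({a<..<b} \<inter> B)" arbitrary: a b rule: less_induct)
    case less
    show ?case
    proof (cases "{a<..<b} \<inter> B = {}")
      case True
      have "\<gamma> t \<in> SPD" if "t \<in> {a..b}" for t using SPD less.prems that by auto
      with mlog_curve_length[OF less.prems B(2)[OF less.prems True] _ g] show ?thesis by blast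
    next
      case False
      then obtain m where m: "m \<in> {a<..<b}" "m \<in> B" by blast
      have "{a<..<m} \<inter> B \<subset> {a<..<b} \<inter> B" "{m<..<b} \<inter> B \<subset> {a<..<b} \<inter> B" using m by auto
      then have card: "card ({a<..<m} \<inter> B) < card ({a<..<b} \<inter> B)" "card ({m<..<b} \<inter> B) < card ({a<..<b} \<inter> B)"
        using B(1) by (auto intro!: psubset_card_mono)
      have 1: "?s integrable_on {a..m} \<and> norm (?c m - ?c a) \<le> integral {a..m} ?s"
        by (rule less.hyps[OF card(1)]) (use less.prems m in auto)
      have 2: "?s integrable_on {m..b} \<and> norm (?c b - ?c m) \<le> integral {m..b} ?s"
        by (rule less.hyps[OF card(2)]) (use less.prems m in auto)
      have i: "?s integrable_on {a..b}"
        by (rule Henstock_Kurzweil_Integration.integrable_combine[of a m b]) (use 1 2 m in auto)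
      moreover have "integral {a..m} ?s + integral {m..b} ?s = integral {a..b} ?s"
        by (rule Henstock_Kurzweil_Integration.integral_combine) (use i m in auto)
      moreover have "norm (?c b - ?c a) \<le> norm (?c b - ?c m) + norm (?c m - ?c a)"
        using norm_triangle_ineq[of "?c b - ?c m" "?c m - ?c a"] by simp
      ultimately show ?thesis using 1 2 by linarith
    qed
  qed
  from this[of 0 1] show ?thesis by (simp add: riem_length_def)
qed

lemma geodesic_curve_length:
  assumes g: "invertible g" and B: "B \<in> Sym"
  shows "riem_length ai_metric (geodesic_curve g B) = norm B"
proof -
  have "sqrt (ai_metric (geodesic_curve g B t) (velocity {0..1} (geodesic_curve g B) t) (velocity {0..1} (geodesic_curve g B) t)) = norm B"
    if t: "t \<in> {0..1}" for t
  proof -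
    have tB: "t *\<^sub>R B \<in> Sym" using B by (intro subspace_scale subspace_Sym)
    have "velocity {0..1} (geodesic_curve g B) t = congr g (B ** mexp (t *\<^sub>R B))"
      by (rule velocity_eq[OF nondegenerate_interval_01 t geodesic_curve_derivative])
    moreover have "dexp (t *\<^sub>R B) B = B ** mexp (t *\<^sub>R B)"
      by (rule dexp_commute) (simp add: mat_algebra)
    moreover have "dexp_sym (t *\<^sub>R B) B = B"
    proof (cases "t = 0")
      case False
      have "t *\<^sub>R dexp_sym (t *\<^sub>R B) B = t *\<^sub>R B" using dexp_sym_self[of "t *\<^sub>R B"] by (simp add: dexp_sym_linear)
      then show ?thesis using False by simp
    qed (simp add: dexp_sym_def cosh_ad_def Ad_def scaleR_2[symmetric])
    ultimately show ?thesis
      using ai_metric_congr[OF g, of "mexp (t *\<^sub>R B)" "B ** mexp (t *\<^sub>R B)" "B ** mexp (t *\<^sub>R B)"] ai_metric_dexp[OF tB B]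
      by (simp add: geodesic_curve_def norm_eq_sqrt_inner)
  qed
  then have "riem_length ai_metric (geodesic_curve g B) = integral {0..1::real} (\<lambda>t. norm B)"
    unfolding riem_length_def by (rule integral_cong)
  then show ?thesis by simp
qed

lemma piecewise_smooth_geodesic_curve: "piecewise_smooth (geodesic_curve g B)"
  unfolding piecewise_smooth_def
  by (intro conjI exI[of _ "{}"] smooth_map_continuous_on[OF smooth_geodesic_curve])
    (simp_all add: smooth_geodesic_curve)

text \<open>In \<open>riem_length_ge\<close> the congruence is free. The choice that moves the
  initial point to the identity, whose logarithm is 0, gives the lower bound \<open>norm B\<close>,
  and this is the length of the geodesic curve; the infimum is a minimum.\<close>

lemma spd_dist_curve:
  fixes g q :: "real^'n^'n"
  assumes g: "invertible g" and q: "q \<in> SPD"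
  defines "B \<equiv> mlog (congr (matrix_inv g) q)"
  shows "B \<in> Sym" "geodesic_curve g B 0 = congr g (mat 1)" "geodesic_curve g B 1 = q"
    "spd_dist (congr g (mat 1)) q = norm B"
proof -
  let ?i = "matrix_inv g"
  have iq: "congr ?i q \<in> SPD" by (intro congr_SPD invertible_matrix_inv g q)
  show B: "B \<in> Sym" unfolding B_def by (rule mlog_Sym[OF iq])
  show 0: "geodesic_curve g B 0 = congr g (mat 1)" by (simp add: geodesic_curve_def)
  show 1: "geodesic_curve g B 1 = q" using iq by (simp add: geodesic_curve_def B_def congr_inv[OF g])
  show "spd_dist (congr g (mat 1)) q = norm B"
    unfolding riem_dist_def
  proof (rule cInf_eq_minimum)
    show "norm B \<in> {riem_length ai_metric \<gamma> |\<gamma>. piecewise_smooth \<gamma> \<and> \<gamma> ` {0..1} \<subseteq> SPD \<and> \<gamma> 0 = congr g (mat 1) \<and> \<gamma> 1 = q}"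
      using geodesic_curve_length[OF g B] piecewise_smooth_geodesic_curve[of g B] geodesic_curve_SPD[OF g B] 0 1
      by (intro CollectI exI[of _ "geodesic_curve g B"]) auto
    fix x assume "x \<in> {riem_length ai_metric \<gamma> |\<gamma>. piecewise_smooth \<gamma> \<and> \<gamma> ` {0..1} \<subseteq> SPD \<and> \<gamma> 0 = congr g (mat 1) \<and> \<gamma> 1 = q}"
    then obtain \<gamma> where \<gamma>: "x = riem_length ai_metric \<gamma>" "piecewise_smooth \<gamma>" "\<gamma> ` {0..1} \<subseteq> SPD" "\<gamma> 0 = congr g (mat 1)" "\<gamma> 1 = q"
      by auto
    have "mlog (mat 1) = (0 :: real^'n^'n)" using mlog_mexp[OF subspace_0[OF subspace_Sym]] by simp
    then show "norm B \<le> x"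
      using riem_length_ge[OF \<gamma>(2,3) invertible_matrix_inv[OF g]] by (simp add: \<gamma> congr_inv[OF g] B_def)
  qed
qed

text \<open>Here \<open>riem_length_ge\<close> is taken with the identity congruence: any curve from
  \<open>exp A\<close> to \<open>exp B\<close>, seen in logarithmic coordinates, joins
  \<open>A\<close> to \<open>B\<close>.\<close>

lemma spd_dist_ge:
  fixes A B :: "real^'n^'n"
  assumes "A \<in> Sym" "B \<in> Sym"
  shows "norm (A - B) \<le> spd_dist (mexp A) (mexp B)"
proof -
  let ?g = "mexp ((1/2) *\<^sub>R A)"
  have g: "invertible ?g" by simp
  note c = spd_dist_curve[OF g mexp_SPD[OF assms(2)]]
  show ?thesis
    using riem_length_ge[OF piecewise_smooth_geodesic_curve _ invertible_mat_1, of ?g "mlog (congr (matrix_inv ?g) (mexp B))"]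
      geodesic_curve_SPD[OF g c(1)] geodesic_curve_length[OF g c(1)] c(2-4) assms
    by (simp add: image_subset_iff norm_minus_commute mexp_congr_half[OF assms(1)])
qed

lemma minimizing_geodesic_curve:
  assumes g: "invertible g" and q: "q \<in> SPD"
  shows "minimizing_geodesic ai_metric SPD (congr g (mat 1)) q (geodesic_curve g (mlog (congr (matrix_inv g) q)))"
  using spd_dist_curve[OF g q] geodesic_geodesic_curve[OF g] geodesic_curve_length[OF g]
  by (simp add: minimizing_geodesic_def)

lemma minimizing_geodesic_unique:
  assumes g: "invertible g" and min: "minimizing_geodesic ai_metric SPD (congr g (mat 1)) q \<eta>" and t: "t \<in> {0..1}"
  shows "\<eta> t = geodesic_curve g (mlog (congr (matrix_inv g) q)) t"
  using geodesic_SPD_unique[OF _ g _ t, of \<eta>] min by (simp add: minimizing_geodesic_def)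

section \<open>Lie triple systems and totally geodesic submanifolds\<close>

locale lie_triple =
  fixes E :: "(real^'n^'n) set"
  assumes subspace_E: "subspace E" and E_Sym: "E \<subseteq> Sym"
    and double_commutator: "\<And>X Y. X \<in> E \<Longrightarrow> Y \<in> E \<Longrightarrow> commutator X (commutator X Y) \<in> E"
begin

lemma E_SymD: "X \<in> E \<Longrightarrow> X \<in> Sym"
  using E_Sym by blast

lemma cosh_ad_E: "X \<in> E \<Longrightarrow> W \<in> E \<Longrightarrow> cosh_ad X s W \<in> E"
  by (rule cosh_ad_mem[OF subspace_E double_commutator])

lemma dexp_sym_E: "X \<in> E \<Longrightarrow> W \<in> E \<Longrightarrow> dexp_sym X W \<in> E"
  by (rule dexp_sym_mem[OF subspace_E cosh_ad_E])

end

lemma dexp_sym_dim: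
  assumes "X \<in> Sym"
  shows "dim (dexp_sym X ` S) = dim S"
proof (rule dim_image_eq)
  show "linear (dexp_sym X)" by (rule bounded_linear.linear[OF bounded_linear_dexp_sym])
  show "inj_on (dexp_sym X) (span S)" using dexp_sym_inj[OF assms] by (simp add: inj_on_def)
qed

lemma subspace_dexp_sym_image: "subspace S \<Longrightarrow> subspace (dexp_sym X ` S)"
  by (rule linear_subspace_image[OF bounded_linear.linear[OF bounded_linear_dexp_sym]])

text \<open>Injectivity and a count of dimensions. Equations for \<open>dexp_sym X\<close> with
  right-hand side in an invariant subspace can thus be solved inside that subspace.\<close>

lemma dexp_sym_onto:
  assumes X: "X \<in> Sym" and S: "subspace S" and inv: "dexp_sym X ` S \<subseteq> S"
  shows "dexp_sym X ` S = S"
  by (rule subspace_dim_equal[OF subspace_dexp_sym_image[OF S] S inv]) (simp add: dexp_sym_dim[OF X])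

text \<open>The hypothesis is the derivative of \<open>exp Z\<close> along
  \<open>y' = X y + y X\<close>; removing half an exponential on each side turns it into the
  differential equation for the logarithm.\<close>

lemma dexp_sym_eq_cosh:
  assumes "dexp Z C = X ** mexp Z + mexp Z ** X"
  shows "dexp_sym Z C = 2 *\<^sub>R cosh_ad Z (1/2) X"
proof -
  let ?h = "mexp ((1/2) *\<^sub>R Z)" and ?i = "mexp (- ((1/2) *\<^sub>R Z))"
  have "dexp_sym Z C = ?i ** dexp Z C ** ?i"
    by (simp add: dexp_eq matrix_mul_assoc)
  also have "\<dots> = ?i ** X ** (?h ** ?h) ** ?i + ?i ** (?h ** ?h) ** X ** ?i"
    by (simp add: assms mexp_double mat_algebra)
  also have "\<dots> = ?i ** X ** ?h + ?h ** X ** ?i"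
    by (simp add: matrix_mul_assoc)
  finally show ?thesis by (simp add: cosh_ad_def Ad_def add.commute)
qed

lemma Ck_on_lipschitz:
  fixes f :: "'a::euclidean_space \<Rightarrow> 'b::real_normed_vector"
  assumes f: "Ck_on (Suc 0) UNIV f"
  obtains L where "L \<ge> 0" "\<And>x y. x \<in> cball 0 R \<Longrightarrow> y \<in> cball 0 R \<Longrightarrow> norm (f x - f y) \<le> L * norm (x - y)"
proof -
  let ?D = "\<lambda>x v. frechet_derivative f (at x) v"
  have d: "(f has_derivative ?D x) (at x)" for x using Ck_on_SucD[OF f UNIV_I] .
  have "\<exists>K. \<forall>x\<in>cball 0 R. norm (?D x b) \<le> K" for b
  proof -
    have "continuous_on (cball 0 R) (\<lambda>x. ?D x b)" using f continuous_on_subset[of UNIV] by auto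
    then have "bounded ((\<lambda>x. ?D x b) ` cball 0 R)" by (intro compact_imp_bounded compact_continuous_image) auto
    then show ?thesis by (auto simp: bounded_iff)
  qed
  then obtain K where K: "\<And>b x. x \<in> cball 0 R \<Longrightarrow> norm (?D x b) \<le> K b" by metis
  define L where "L = \<bar>\<Sum>b\<in>Basis. K b\<bar>"
  have "norm (?D x v) \<le> L * norm v" if x: "x \<in> cball 0 R" for x v
  proof -
    have "norm (?D x v) = norm (\<Sum>b\<in>Basis. (v \<bullet> b) *\<^sub>R ?D x b)"
      using linear_Basis_expansion[OF has_derivative_linear[OF d], of x v] by simp
    also have "\<dots> \<le> (\<Sum>b\<in>Basis. \<bar>v \<bullet> b\<bar> * norm (?D x b))"
      by (rule norm_sum[THEN order_trans]) simp
    also have "\<dots> \<le> (\<Sum>b\<in>Basis. norm v * K b)"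
      by (intro sum_mono mult_mono Basis_le_norm K x) auto
    also have "\<dots> = norm v * (\<Sum>b\<in>Basis. K b)" by (simp add: sum_distrib_left)
    also have "\<dots> \<le> norm v * L" unfolding L_def by (intro mult_left_mono) auto
    finally show ?thesis by (simp add: mult.commute)
  qed
  then have "onorm (?D x) \<le> L" if "x \<in> cball 0 R" for x using that by (intro onorm_le) auto
  then have "norm (f x - f y) \<le> L * norm (x - y)" if "x \<in> cball 0 R" "y \<in> cball 0 R" for x y
    using that by (intro differentiable_bound[of "cball 0 R" f ?D L]) (auto intro: has_derivative_at_withinI d)
  then show thesis using that[of L] by (simp add: L_def)
qed

lemma Ck_on_scaled_mexp: "Ck_on k UNIV (\<lambda>A :: real^'n^'n. mexp (c *\<^sub>R A))"
  by (intro Ck_on_mexp open_UNIV Ck_on_linear bounded_linear_scaleR_right)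

lemma Ck_on_dexp_sym: "Ck_on k UNIV (\<lambda>A. dexp_sym A (W :: real^'n^'n))"
proof -
  have "Ck_on k UNIV (\<lambda>A. mexp ((-1/2) *\<^sub>R A) ** dexp A W ** mexp ((-1/2) *\<^sub>R A))"
    by (intro Ck_on_bilinear[OF bounded_bilinear_matrix_mult open_UNIV] Ck_on_scaled_mexp Ck_on_dexp)
  then show ?thesis by (simp add: dexp_eq matrix_mul_assoc)
qed

lemma Ck_on_cosh_ad: "Ck_on k UNIV (\<lambda>A. cosh_ad A s (W :: real^'n^'n))"
proof -
  have "Ck_on k UNIV (\<lambda>A. (1/2) *\<^sub>R (mexp (s *\<^sub>R A) ** W ** mexp ((-s) *\<^sub>R A) + mexp ((-s) *\<^sub>R A) ** W ** mexp (s *\<^sub>R A)))"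
    by (intro Ck_on_compose_linear[OF bounded_linear_scaleR_right open_UNIV] Ck_on_add open_UNIV
        Ck_on_bilinear[OF bounded_bilinear_matrix_mult open_UNIV] Ck_on_scaled_mexp Ck_on_const)
  then show ?thesis by (simp add: cosh_ad_def Ad_def)
qed

text \<open>By linearity in \<open>W\<close> the Lipschitz constants for the basis vectors add up.
  The bound compares \<open>dexp_sym\<close> at a point with \<open>dexp_sym\<close> at its
  projection onto \<open>E\<close>.\<close>

lemma dexp_sym_lipschitz:
  obtains L where "L \<ge> 0" "\<And>A B W :: real^'n^'n. A \<in> cball 0 R \<Longrightarrow> B \<in> cball 0 R \<Longrightarrow>
    norm (dexp_sym A W - dexp_sym B W) \<le> L * norm (A - B) * norm W"
proof -
  have "\<exists>L\<ge>0. \<forall>A\<in>cball 0 R. \<forall>B\<in>cball 0 R. norm (dexp_sym A b - dexp_sym B b) \<le> L * norm (A - B)" for b :: "real^'n^'n"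
    using Ck_on_lipschitz[OF Ck_on_dexp_sym, of R b] by metis
  then obtain L where L: "\<And>b. L b \<ge> 0" "\<And>b (A :: real^'n^'n) B. A \<in> cball 0 R \<Longrightarrow> B \<in> cball 0 R \<Longrightarrow> norm (dexp_sym A b - dexp_sym B b) \<le> L b * norm (A - B)"
    by metis
  have "norm (dexp_sym A W - dexp_sym B W) \<le> (\<Sum>b\<in>Basis. L b) * norm (A - B) * norm W"
    if AB: "A \<in> cball 0 R" "B \<in> cball 0 R" for A B W :: "real^'n^'n"
  proof -
    have "linear (\<lambda>W. dexp_sym A W - dexp_sym B W)"
      by (intro linear_compose_sub bounded_linear.linear[OF bounded_linear_dexp_sym])
    from linear_Basis_expansion[OF this, of W]
    have "norm (dexp_sym A W - dexp_sym B W) = norm (\<Sum>b\<in>Basis. (W \<bullet> b) *\<^sub>R (dexp_sym A b - dexp_sym B b))" by simp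
    also have "\<dots> \<le> (\<Sum>b\<in>Basis. \<bar>W \<bullet> b\<bar> * norm (dexp_sym A b - dexp_sym B b))"
      by (rule norm_sum[THEN order_trans]) simp
    also have "\<dots> \<le> (\<Sum>b\<in>Basis. norm W * (L b * norm (A - B)))"
      by (intro sum_mono mult_mono Basis_le_norm L AB) auto
    also have "\<dots> = (\<Sum>b\<in>Basis. L b) * norm (A - B) * norm W"
      by (simp add: sum_distrib_left sum_distrib_right mult_ac)
    finally show ?thesis .
  qed
  then show thesis using that[of "\<Sum>b\<in>Basis. L b"] L(1) by (simp add: sum_nonneg)
qed

context lie_triple
begin

text \<open>The logarithm \<open>Z\<close> of \<open>exp (tX) exp Y exp (tX)\<close> solves
  \<open>dexp_sym Z Z' = 2 cosh (ad Z / 2) X\<close>, a differential equation whose right-hand side is tangent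
  to \<open>E\<close> along \<open>E\<close>; hence the distance of \<open>Z\<close> to \<open>E\<close> satisfies a Gronwall inequality.\<close>

lemma congr_mexp_E:
  assumes X: "X \<in> E" and Y: "Y \<in> E"
  shows "congr (mexp X) (mexp Y) \<in> mexp ` E"
proof -
  let ?T = "{0..1::real}"
  note bot = nondegenerate_interval_limit[OF nondegenerate_interval_01]
  note XS = E_SymD[OF X] and YS = E_SymD[OF Y]
  obtain Q where Q: "bounded_linear Q" "\<And>x. Q x \<in> E" "\<And>x. Q x = x \<longleftrightarrow> x \<in> E"
    using obtain_projection[OF subspace_E] by metis
  define P where "P x = x - Q x" for x
  have P: "bounded_linear P" unfolding P_def by (intro bounded_linear_sub bounded_linear_ident Q)
  have P0: "P x = 0 \<longleftrightarrow> x \<in> E" for x using Q(3)[of x] by (auto simp: P_def)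
  obtain KQ where KQ: "KQ > 0" "\<And>x. norm (Q x) \<le> norm x * KQ" using bounded_linear.pos_bounded[OF Q(1)] by blast
  obtain KP where KP: "KP > 0" "\<And>x. norm (P x) \<le> norm x * KP" using bounded_linear.pos_bounded[OF P] by blast
  define y where "y t = mexp (t *\<^sub>R X) ** mexp Y ** mexp (t *\<^sub>R X)" for t
  have y_congr: "y t = congr (mexp (t *\<^sub>R X)) (mexp Y)" for t
    unfolding y_def by (rule congr_mexp[symmetric]) (intro subspace_scale subspace_Sym XS)
  have ySPD: "y t \<in> SPD" for t unfolding y_congr by (intro congr_SPD mexp_SPD YS invertible_mexp)
  have dy: "(y has_vector_derivative X ** y t + y t ** X) (at t within ?T)" for t
  proof -
    have "(y has_vector_derivative (mexp (t *\<^sub>R X) ** mexp Y) ** (mexp (t *\<^sub>R X) ** X) + (mexp (t *\<^sub>R X) ** 0 + (X ** mexp (t *\<^sub>R X)) ** mexp Y) ** mexp (t *\<^sub>R X)) (at t within ?T)"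
      unfolding y_def
      by (intro mm.has_vector_derivative mexp_has_vector_derivative mexp_has_vector_derivative' has_vector_derivative_const)
    then show ?thesis by (simp add: y_def mm.zero_right matrix_mul_assoc add.commute)
  qed
  define Z where "Z t = mlog (y t)" for t
  have ZS: "Z t \<in> Sym" for t unfolding Z_def by (rule mlog_Sym[OF ySPD])
  have mZ: "mexp (Z t) = y t" for t unfolding Z_def by (rule mexp_mlog[OF ySPD])
  have "\<exists>z. (Z has_vector_derivative z) (at t within ?T) \<and> dexp_sym (Z t) z = 2 *\<^sub>R cosh_ad (Z t) (1/2) X"
    if tT: "t \<in> ?T" for t
  proof -
    obtain z where z: "(Z has_vector_derivative z) (at t within ?T)" "dexp (Z t) z = X ** y t + y t ** X"
      using mlog_has_vector_derivative[OF dy tT bot[OF tT] ySPD] unfolding Z_def by metis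
    from z(2) have "dexp_sym (Z t) z = 2 *\<^sub>R cosh_ad (Z t) (1/2) X"
      by (intro dexp_sym_eq_cosh) (simp add: mZ)
    with z(1) show ?thesis by blast
  qed
  then obtain Z' where Z': "\<And>t. t \<in> ?T \<Longrightarrow> (Z has_vector_derivative Z' t) (at t within ?T)"
      "\<And>t. t \<in> ?T \<Longrightarrow> dexp_sym (Z t) (Z' t) = 2 *\<^sub>R cosh_ad (Z t) (1/2) X" by metis
  have "continuous_on ?T Z" by (rule continuous_on_vector_derivative) (rule Z'(1))
  then have "bounded (Z ` ?T)" by (intro compact_imp_bounded compact_continuous_image) auto
  then obtain R0 where "\<forall>x\<in>Z ` ?T. norm x \<le> R0" unfolding bounded_iff by blast
  then have R0: "\<And>t. t \<in> ?T \<Longrightarrow> norm (Z t) \<le> R0" by blast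
  \<comment> \<open>The ball has to contain the curve and also its projection to \<open>E\<close>,
    as the two are compared by Lipschitz estimates.\<close>
  define R where "R = max R0 (R0 * KQ)"
  have ZR: "Z t \<in> cball 0 R" "Q (Z t) \<in> cball 0 R" if "t \<in> ?T" for t
  proof -
    show "Z t \<in> cball 0 R" using R0[OF that] by (simp add: R_def)
    have "norm (Q (Z t)) \<le> R0 * KQ"
      by (rule order_trans[OF KQ(2) mult_right_mono[OF R0[OF that] less_imp_le[OF KQ(1)]]])
    then show "Q (Z t) \<in> cball 0 R" by (simp add: R_def)
  qed
  obtain L1 where L1: "L1 \<ge> 0" "\<And>A B W :: real^'n^'n. A \<in> cball 0 R \<Longrightarrow> B \<in> cball 0 R \<Longrightarrow>
    norm (dexp_sym A W - dexp_sym B W) \<le> L1 * norm (A - B) * norm W"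
    using dexp_sym_lipschitz by blast
  obtain L2 where L2: "L2 \<ge> 0" "\<And>A B. A \<in> cball 0 R \<Longrightarrow> B \<in> cball 0 R \<Longrightarrow>
    norm (cosh_ad A (1/2) X - cosh_ad B (1/2) X) \<le> L2 * norm (A - B)"
    using Ck_on_lipschitz[OF Ck_on_cosh_ad] by metis
  have "continuous_on (cball 0 R) (\<lambda>A. cosh_ad A (1/2) X)"
    using Ck_on_imp_continuous_on[OF Ck_on_cosh_ad] continuous_on_subset by blast
  then have "bounded ((\<lambda>A. cosh_ad A (1/2) X) ` cball 0 R)" by (intro compact_imp_bounded compact_continuous_image) auto
  then obtain K where "\<forall>x\<in>(\<lambda>A. cosh_ad A (1/2) X) ` cball 0 R. norm x \<le> K" unfolding bounded_iff by blast
  then have K: "\<And>A. A \<in> cball 0 R \<Longrightarrow> norm (cosh_ad A (1/2) X) \<le> K" by blast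
  define M where "M = KP * (2 * L2 + L1 * (2 * K))"
  have PZ': "norm (P (Z' t)) \<le> M * norm (P (Z t))" if t: "t \<in> ?T" for t
  proof -
    let ?A = "Z t" and ?B = "Q (Z t)"
    \<comment> \<open>At the projected point \<open>?B\<close> the same equation has a solution
      \<open>w\<close> in \<open>E\<close>, by invariance and \<open>dexp_sym_onto\<close>. As
      \<open>P\<close> annihilates \<open>w\<close>, it is enough to bound \<open>Z' t - w\<close>,
      and this is controlled by the distance of \<open>?A\<close> from \<open>?B\<close>, which is
      \<open>norm (P (Z t))\<close>.\<close>
    have BE: "?B \<in> E" by (rule Q)
    have "2 *\<^sub>R cosh_ad ?B (1/2) X \<in> E" by (intro subspace_scale subspace_E cosh_ad_E BE X)
    then obtain w where w: "w \<in> E" "dexp_sym ?B w = 2 *\<^sub>R cosh_ad ?B (1/2) X"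
      using dexp_sym_onto[OF E_SymD[OF BE] subspace_E] dexp_sym_E[OF BE] by (metis imageE image_subsetI)
    have "norm w \<le> norm (2 *\<^sub>R cosh_ad ?B (1/2) X)" using norm_dexp_sym_ge[OF E_SymD[OF BE], of w] w(2) by simp
    also have "\<dots> \<le> 2 * K" using K[OF ZR(2)[OF t]] by simp
    finally have nw: "norm w \<le> 2 * K" .
    have AB: "norm (?A - ?B) = norm (P (Z t))" by (simp add: P_def)
    have "dexp_sym ?A (Z' t - w) = 2 *\<^sub>R (cosh_ad ?A (1/2) X - cosh_ad ?B (1/2) X) - (dexp_sym ?A w - dexp_sym ?B w)"
      by (simp add: dexp_sym_linear Z'(2)[OF t] w(2) algebra_simps)
    then have "norm (dexp_sym ?A (Z' t - w)) \<le> 2 * norm (cosh_ad ?A (1/2) X - cosh_ad ?B (1/2) X) + norm (dexp_sym ?A w - dexp_sym ?B w)"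
      using norm_triangle_ineq4[of "2 *\<^sub>R (cosh_ad ?A (1/2) X - cosh_ad ?B (1/2) X)" "dexp_sym ?A w - dexp_sym ?B w"] by simp
    also have "\<dots> \<le> 2 * (L2 * norm (?A - ?B)) + L1 * norm (?A - ?B) * (2 * K)"
    proof -
      have "L1 * norm (?A - ?B) * norm w \<le> L1 * norm (?A - ?B) * (2 * K)"
        by (intro mult_left_mono nw mult_nonneg_nonneg L1(1) norm_ge_zero)
      then show ?thesis using L2(2)[OF ZR[OF t]] L1(2)[OF ZR[OF t], of w] by linarith
    qed
    also have "\<dots> = (2 * L2 + L1 * (2 * K)) * norm (P (Z t))" by (simp add: AB algebra_simps)
    finally have 1: "norm (Z' t - w) \<le> (2 * L2 + L1 * (2 * K)) * norm (P (Z t))"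
      using norm_dexp_sym_ge[OF ZS, of "Z' t - w" t] by linarith
    have "P (Z' t) = P (Z' t - w)" using P0[of w] w(1) by (simp add: linear_diff[OF bounded_linear.linear[OF P]])
    then have "norm (P (Z' t)) \<le> norm (Z' t - w) * KP" using KP(2) by metis
    also have "\<dots> \<le> ((2 * L2 + L1 * (2 * K)) * norm (P (Z t))) * KP" using 1 KP(1) by (intro mult_right_mono) auto
    finally show ?thesis by (simp add: M_def mult_ac)
  qed
  define g where "g t = P (Z t) \<bullet> P (Z t)" for t
  have "g 1 = 0"
  proof (rule gronwall_zero[of 1 g "\<lambda>t. P (Z t) \<bullet> P (Z' t) + P (Z' t) \<bullet> P (Z t)" "2 * M"])
    fix t assume t: "t \<in> ?T"
    have PZ: "((\<lambda>t. P (Z t)) has_vector_derivative P (Z' t)) (at t within ?T)"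
      by (rule bounded_linear.has_vector_derivative[OF P Z'(1)[OF t]])
    show "(g has_vector_derivative P (Z t) \<bullet> P (Z' t) + P (Z' t) \<bullet> P (Z t)) (at t within ?T)"
      unfolding g_def by (rule bounded_bilinear.has_vector_derivative[OF bounded_bilinear_inner PZ PZ])
    have "P (Z t) \<bullet> P (Z' t) \<le> norm (P (Z t)) * norm (P (Z' t))" by (rule norm_cauchy_schwarz)
    also have "\<dots> \<le> norm (P (Z t)) * (M * norm (P (Z t)))" by (intro mult_left_mono PZ' t) auto
    also have "\<dots> = M * g t" by (simp add: g_def dot_square_norm power2_eq_square)
    finally show "P (Z t) \<bullet> P (Z' t) + P (Z' t) \<bullet> P (Z t) \<le> (2 * M) * g t" by (simp add: inner_commute)
    show "g t \<ge> 0" by (simp add: g_def)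
  next
    show "g 0 = 0" using P0[of Y] Y YS by (simp add: g_def Z_def y_def)
  qed simp
  then have "Z 1 \<in> E" using P0 by (simp add: g_def)
  moreover have "congr (mexp X) (mexp Y) = mexp (Z 1)" using mZ[of 1] y_congr[of 1] by simp
  ultimately show ?thesis by blast
qed

lemma congr_E: "X \<in> E \<Longrightarrow> y \<in> mexp ` E \<Longrightarrow> congr (mexp X) y \<in> mexp ` E"
  using congr_mexp_E by blast

lemma image_E_SPD: "mexp ` E \<subseteq> SPD"
  using mexp_SPD E_SymD by blast

lemma mlog_image_E: "y \<in> mexp ` E \<Longrightarrow> mlog y \<in> E"
  using E_SymD by auto

lemma scale_E: "X \<in> E \<Longrightarrow> c *\<^sub>R X \<in> E"
  by (rule subspace_scale[OF subspace_E])

lemma neg_E: "X \<in> E \<Longrightarrow> - X \<in> E"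
  by (rule subspace_neg[OF subspace_E])

text \<open>Translating \<open>p\<close> to the identity preserves \<open>exp E\<close>, where the
  minimising geodesic is \<open>exp (t B)\<close> with \<open>B\<close> in \<open>E\<close>.
  Translating back preserves \<open>exp E\<close> again.\<close>

lemma geodesically_convex_E: "geodesically_convex ai_metric SPD (mexp ` E)"
  unfolding geodesically_convex_def
proof (intro ballI)
  fix p q assume "p \<in> mexp ` E" and q: "q \<in> mexp ` E"
  then obtain X where X: "X \<in> E" "p = mexp X" by blast
  let ?g = "mexp ((1/2) *\<^sub>R X)"
  have p: "p = congr ?g (mat 1)" using mexp_congr_half[OF E_SymD[OF X(1)]] X(2) by simp
  define B where "B = mlog (congr (matrix_inv ?g) q)"
  have qS: "q \<in> SPD" using q image_E_SPD by blast
  have "congr (mexp (- ((1/2) *\<^sub>R X))) q \<in> mexp ` E" by (intro congr_E neg_E scale_E X q)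
  then have B: "B \<in> E" unfolding B_def matrix_inv_mexp by (rule mlog_image_E)
  show "\<exists>\<gamma>. minimizing_geodesic ai_metric SPD p q \<gamma> \<and> \<gamma> ` {0..1} \<subseteq> mexp ` E \<and>
    (\<forall>\<eta>. minimizing_geodesic ai_metric SPD p q \<eta> \<longrightarrow> (\<forall>t\<in>{0..1}. \<eta> t = \<gamma> t))"
  proof (intro exI[of _ "geodesic_curve ?g B"] conjI allI impI ballI)
    show "minimizing_geodesic ai_metric SPD p q (geodesic_curve ?g B)"
      unfolding p B_def by (rule minimizing_geodesic_curve[OF invertible_mexp qS])
    show "geodesic_curve ?g B ` {0..1} \<subseteq> mexp ` E"
      unfolding geodesic_curve_def by (intro image_subsetI congr_mexp_E scale_E X B)
    show "\<eta> t = geodesic_curve ?g B t" if "minimizing_geodesic ai_metric SPD p q \<eta>" "t \<in> {0..1}" for \<eta> t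
      using minimizing_geodesic_unique[OF invertible_mexp that(1)[unfolded p] that(2)] by (simp add: B_def)
  qed
qed

lemma dexp_0 [simp]: "dexp 0 W = W"
  using dexp_commute[of 0 W] by (simp add: mm.zero_left mm.zero_right)

text \<open>After translating \<open>\<gamma> t\<close> to the identity, \<open>y = exp c\<close> with \<open>c\<close> in \<open>E\<close> and \<open>c = 0\<close> at time
  \<open>t\<close>. There the covariant acceleration \<open>y'' - y' y'\<close> is the derivative of the \<open>E\<close>-valued
  curve \<open>exp (-c/2) y' exp (-c/2) = dexp_sym c c'\<close>, so it is tangent to \<open>E\<close>.\<close>

lemma geodesic_E_imp_SPD:
  assumes geo: "geodesic ai_metric (mexp ` E) T \<gamma>"
  shows "geodesic ai_metric SPD T \<gamma>"
proof (rule geodesic_SPDI[OF geodesicD(1,2)[OF geo]])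
  note T = geodesicD(1)[OF geo] and sm = geodesicD(2)[OF geo] and \<gamma>E = geodesicD(3)[OF geo]
  note bot = nondegenerate_interval_limit[OF T]
  show "\<gamma> ` T \<subseteq> SPD" using \<gamma>E image_E_SPD by blast
  fix t assume t: "t \<in> T"
  define A where "A = velocity T (velocity T \<gamma>) t - velocity T \<gamma> t ** matrix_inv (\<gamma> t) ** velocity T \<gamma> t"
  obtain X where X: "X \<in> E" "\<gamma> t = mexp X" using \<gamma>E t by blast
  define a where "a = mexp ((1/2) *\<^sub>R X)"
  define i where "i = mexp (- ((1/2) *\<^sub>R X))"
  have inv: "invertible a" "matrix_inv a = i" by (simp_all add: a_def i_def)
  have \<gamma>t: "\<gamma> t = congr a (mat 1)" using mexp_congr_half[OF E_SymD[OF X(1)]] X(2) by (simp add: a_def)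
  define A' where "A' = congr i A"
  have A: "A = congr a A'" using congr_inv(2)[OF inv(1)] by (simp add: A'_def inv)
  \<comment> \<open>The geodesic equation of \<open>exp E\<close> makes the translated acceleration
    orthogonal to \<open>E\<close>. It will also turn out to lie in \<open>E\<close>, hence to
    vanish.\<close>
  have orth: "A' \<bullet> B = 0" if B: "B \<in> E" and A'S: "A' \<in> Sym" for B
  proof -
    have "((\<lambda>s. congr a (mexp (s *\<^sub>R B))) has_vector_derivative congr a (B ** mexp (0 *\<^sub>R B))) (at 0)"
      by (rule bounded_linear.has_vector_derivative[OF bounded_linear_congr mexp_has_vector_derivative])
    then have d: "((\<lambda>s. congr a (mexp (s *\<^sub>R B))) has_vector_derivative congr a B) (at 0)" by simp
    have "ai_metric (\<gamma> t) A (congr a B) = 0"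
      unfolding A_def
      by (rule geodesic_orthogonal[OF geo image_E_SPD t d _ open_UNIV UNIV_I])
        (use \<gamma>t in \<open>auto simp: a_def intro!: congr_mexp_E scale_E X B\<close>)
    then have "ai_metric (congr a (mat 1)) (congr a A') (congr a B) = 0" by (simp add: \<gamma>t A)
    then show ?thesis by (simp add: ai_metric_congr[OF inv(1)] ai_metric_mat_1[OF A'S])
  qed
  define y where "y s = congr i (\<gamma> s)" for s
  define v where "v s = congr i (velocity T \<gamma> s)" for s
  have yE: "y s \<in> mexp ` E" if "s \<in> T" for s
    unfolding y_def i_def by (intro congr_E neg_E scale_E X) (use \<gamma>E that in blast)
  have ySPD: "y s \<in> SPD" if "s \<in> T" for s using yE[OF that] image_E_SPD by blast
  have dy: "(y has_vector_derivative v s) (at s within T)" if "s \<in> T" for s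
    unfolding y_def v_def
    by (rule bounded_linear.has_vector_derivative[OF bounded_linear_congr smooth_curve_velocity(1)[OF sm bot that]])
  have dv: "(v has_vector_derivative congr i (velocity T (velocity T \<gamma>) t)) (at t within T)"
    unfolding v_def
    by (rule bounded_linear.has_vector_derivative[OF bounded_linear_congr smooth_curve_velocity(1)[OF smooth_curve_velocity(2)[OF sm bot] bot t]])
  define c where "c s = mlog (y s)" for s
  have cE: "c s \<in> E" if "s \<in> T" for s unfolding c_def by (rule mlog_image_E[OF yE[OF that]])
  have "\<exists>z. (c has_vector_derivative z) (at s within T) \<and> dexp (c s) z = v s" if "s \<in> T" for s
    using mlog_has_vector_derivative[OF dy[OF that] that bot[OF that] ySPD] unfolding c_def by metis
  then obtain c' where c': "\<And>s. s \<in> T \<Longrightarrow> (c has_vector_derivative c' s) (at s within T)" "\<And>s. s \<in> T \<Longrightarrow> dexp (c s) (c' s) = v s"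
    by metis
  have c'E: "c' s \<in> E" if "s \<in> T" for s
    by (rule has_vector_derivative_mem_subspace[OF subspace_E c'(1)[OF that] cE that bot[OF that]])
  have yt: "y t = mat 1" using congr_inv(1)[OF inv(1), of "mat 1"] by (simp add: y_def \<gamma>t inv)
  have ct: "c t = 0" using mlog_mexp[OF subspace_0[OF subspace_Sym]] by (simp add: c_def yt)
  have c't: "c' t = v t" using c'(2)[OF t] by (simp add: ct)
  define q where "q s = mexp ((-1/2) *\<^sub>R c s) ** v s ** mexp ((-1/2) *\<^sub>R c s)" for s
  have qE: "q s \<in> E" if "s \<in> T" for s
  proof -
    have "q s = dexp_sym (c s) (c' s)"
      unfolding q_def c'(2)[OF that, symmetric] by (simp add: dexp_eq matrix_mul_assoc)
    then show ?thesis using dexp_sym_E[OF cE[OF that] c'E[OF that]] by simp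
  qed
  have dm: "((\<lambda>s. mexp ((-1/2) *\<^sub>R c s)) has_vector_derivative (-1/2) *\<^sub>R v t) (at t within T)"
    using mexp_compose_has_vector_derivative[OF bounded_linear.has_vector_derivative[OF bounded_linear_scaleR_right[of "-1/2"] c'(1)[OF t]]]
    by (simp add: ct c't)
  \<comment> \<open>At time \<open>t\<close> both exponentials are the identity. Each outer factor
    contributes \<open>-1/2\<close> times the square of \<open>v t\<close>, together the quadratic
    term of the covariant acceleration.\<close>
  have "(q has_vector_derivative mexp ((-1/2) *\<^sub>R c t) ** v t ** ((-1/2) *\<^sub>R v t) +
      (mexp ((-1/2) *\<^sub>R c t) ** congr i (velocity T (velocity T \<gamma>) t) + ((-1/2) *\<^sub>R v t) ** v t) ** mexp ((-1/2) *\<^sub>R c t)) (at t within T)"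
    unfolding q_def by (intro mm.has_vector_derivative dm dv)
  then have "(q has_vector_derivative congr i (velocity T (velocity T \<gamma>) t) - v t ** v t) (at t within T)"
    by (simp add: ct mat_algebra)
  moreover have "A' = congr i (velocity T (velocity T \<gamma>) t) - v t ** v t"
  proof -
    have ti: "transpose i = i"
      unfolding i_def by (rule Sym_transpose[OF mexp_Sym]) (intro E_SymD neg_E scale_E X)
    have "matrix_inv (\<gamma> t) = i ** i"
      using matrix_inv_congr[OF inv(1) invertible_mat_1] by (simp add: \<gamma>t inv ti)
    then show ?thesis
      by (simp add: A'_def A_def v_def congr_def ti mat_algebra)
  qed
  ultimately have "(q has_vector_derivative A') (at t within T)" by simp
  then have A'E: "A' \<in> E" by (rule has_vector_derivative_mem_subspace[OF subspace_E _ qE t bot[OF t]])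
  then have "A' \<bullet> A' = 0" using orth E_SymD by blast
  then have "A = 0" by (simp add: A congr_linear)
  then show "velocity T (velocity T \<gamma>) t = velocity T \<gamma> t ** matrix_inv (\<gamma> t) ** velocity T \<gamma> t"
    by (simp add: A_def)
qed

end

section \<open>Submanifold structure, and necessity of the double commutator condition\<close>

lemma mlog_image_mexp:
  assumes "E \<subseteq> Sym"
  shows "mlog ` mexp ` E = E"
proof -
  have "(\<lambda>x. mlog (mexp x)) ` E = (\<lambda>x. x) ` E"
    by (rule image_cong[OF refl]) (rule mlog_mexp, use assms in blast)
  then show ?thesis by (simp add: image_image)
qed

lemma diffeomorphism_mlog: "diffeomorphism SPD Sym mlog (mexp :: real^'n^'n \<Rightarrow> _)"
  unfolding diffeomorphism_def
proof (intro conjI ballI)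
  show "mlog ` SPD = (Sym :: (real^'n^'n) set)"
    using mlog_image_mexp[OF subset_refl] by (simp add: image_mexp_Sym)
  show "smooth_map SPD (mlog :: real^'n^'n \<Rightarrow> _)"
  proof (rule smooth_map_cong)
    show "smooth_map SPD (\<lambda>Y :: real^'n^'n. mlog (symm Y))"
      by (rule smooth_map_open[OF smooth_mlog(1) _ smooth_mlog(2)]) (use symm_SPD in blast)
  qed (simp add: SPD_Sym)
  show "smooth_map Sym (mexp :: real^'n^'n \<Rightarrow> _)"
    by (rule smooth_map_open[OF open_UNIV subset_UNIV Ck_on_mexp_UNIV])
qed (auto simp: image_mexp_Sym)

text \<open>The logarithm is a global slice chart: it straightens \<open>exp E\<close> to the linear
  subspace \<open>E\<close> of \<open>Sym\<close>.\<close>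

lemma submanifold_mexp_image:
  fixes E :: "(real^'n^'n) set"
  assumes E: "subspace E" "E \<subseteq> Sym"
  shows "submanifold (mexp ` E) SPD"
proof -
  have ch: "chart_on SPD SPD Sym Sym mlog (mexp :: real^'n^'n \<Rightarrow> _)"
    by (simp add: chart_on_def subspace_Sym diffeomorphism_mlog)
  have sub: "mexp ` E \<subseteq> SPD" using E(2) mexp_SPD by blast
  have img: "mlog ` (SPD \<inter> mexp ` E) = Sym \<inter> E"
  proof -
    have "SPD \<inter> mexp ` E = mexp ` E" "Sym \<inter> E = E" using sub E(2) by blast+
    then show ?thesis using mlog_image_mexp[OF E(2)] by simp
  qed
  show ?thesis
    unfolding submanifold_def
  proof (intro conjI exI[of _ "dim E"] ballI)
    fix p assume "p \<in> mexp ` E"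
    with sub have "p \<in> SPD" by blast
    with ch E img
    show "\<exists>U H V \<phi> \<psi> L. chart_on SPD U H V \<phi> \<psi> \<and> p \<in> U \<and> subspace L \<and> L \<subseteq> H \<and> dim L = dim E \<and> \<phi> ` (U \<inter> mexp ` E) = V \<inter> L"
      by (intro exI[of _ SPD] exI[of _ Sym] exI[of _ mlog] exI[of _ mexp] exI[of _ E] conjI) simp_all
  qed (rule sub)
qed

lemma commutator_adjoint: "X \<in> Sym \<Longrightarrow> commutator X W \<bullet> V = W \<bullet> commutator X V"
  using inner_mult_left[of X W V] inner_mult_right[of W X V]
  by (simp add: commutator_def inner_diff_left inner_diff_right Sym_transpose)

text \<open>The geodesic from \<open>exp X\<close> to \<open>exp Y\<close> stays in \<open>exp E\<close>. Its initial velocity shows that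
  \<open>log (exp (-X/2) exp Y exp (-X/2))\<close> lies in the image of \<open>E\<close> under \<open>dexp_sym X\<close>; differentiating
  with respect to \<open>Y\<close> at \<open>0\<close> gives the claim.\<close>

lemma convex_imp_dexp_sym_square:
  fixes E :: "(real^'n^'n) set"
  assumes E: "subspace E" "E \<subseteq> Sym" and conv: "geodesically_convex ai_metric SPD (mexp ` E)" and X: "X \<in> E"
  shows "dexp_sym X ` dexp_sym X ` E = E"
proof -
  have ES: "W \<in> Sym" if "W \<in> E" for W using E(2) that by blast
  let ?g = "mexp ((1/2) *\<^sub>R X)" and ?i = "mexp (- ((1/2) *\<^sub>R X))" and ?T = "{0..1::real}"
  note XS = ES[OF X]
  have 0: "(0::real) \<in> ?T" by simp
  note bot = nondegenerate_interval_limit[OF nondegenerate_interval_01 0]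
  have p: "mexp X = congr ?g (mat 1)" using mexp_congr_half[OF XS] by simp
  have mem: "mlog (congr ?i (mexp Y)) \<in> dexp_sym X ` E" if Y: "Y \<in> E" for Y
  proof -
    define B where "B = mlog (congr ?i (mexp Y))"
    have YS: "mexp Y \<in> SPD" by (rule mexp_SPD[OF ES[OF Y]])
    have BS: "B \<in> Sym" unfolding B_def by (intro mlog_Sym congr_SPD YS invertible_mexp)
    have min: "minimizing_geodesic ai_metric SPD (mexp X) (mexp Y) (geodesic_curve ?g B)"
      using minimizing_geodesic_curve[OF invertible_mexp YS, of "(1/2) *\<^sub>R X"] by (simp add: B_def p)
    obtain \<gamma> where \<gamma>: "\<gamma> ` ?T \<subseteq> mexp ` E" "\<And>\<eta>. minimizing_geodesic ai_metric SPD (mexp X) (mexp Y) \<eta> \<Longrightarrow> (\<forall>t\<in>?T. \<eta> t = \<gamma> t)"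
      using conv X Y unfolding geodesically_convex_def by blast
    have inE: "geodesic_curve ?g B t \<in> mexp ` E" if "t \<in> ?T" for t
      using \<gamma>(2)[OF min] \<gamma>(1) that by (metis image_subset_iff)
    have d: "(geodesic_curve ?g B has_vector_derivative congr ?g B) (at 0 within ?T)"
      using geodesic_curve_derivative[of ?g B 0 ?T] by simp
    obtain k where k: "((\<lambda>t. mlog (geodesic_curve ?g B t)) has_vector_derivative k) (at 0 within ?T)"
      "dexp (mlog (geodesic_curve ?g B 0)) k = congr ?g B"
      using mlog_has_vector_derivative[OF d 0 bot geodesic_curve_SPD[OF invertible_mexp BS]] by metis
    have "k \<in> E"
    proof (rule has_vector_derivative_mem_subspace[OF E(1) k(1) _ 0 bot])
      fix s assume "s \<in> ?T"
      from inE[OF this] show "mlog (geodesic_curve ?g B s) \<in> E" using ES by auto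
    qed
    moreover have "mlog (geodesic_curve ?g B 0) = X"
      by (simp add: geodesic_curve_def p[symmetric] XS)
    then have "congr ?g (dexp_sym X k) = congr ?g B" using k(2) dexp_congr[OF XS, of k] by simp
    then have "dexp_sym X k = B" using congr_inv(1)[OF invertible_mexp] by metis
    ultimately show ?thesis unfolding B_def by (metis image_eqI)
  qed
  \<comment> \<open>Along \<open>Y = s W\<close> the logarithm starts at \<open>- X\<close>, so its
    derivative \<open>b\<close> satisfies \<open>dexp_sym (- X) b = W\<close>. As
    \<open>dexp_sym\<close> is even in \<open>X\<close>, this supplies the second factor
    \<open>dexp_sym X\<close>.\<close>
  have sub: "W \<in> dexp_sym X ` dexp_sym X ` E" if W: "W \<in> E" for W
  proof -
    have SPD: "congr ?i (mexp (s *\<^sub>R W)) \<in> SPD" for s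
      by (intro congr_SPD mexp_SPD subspace_scale subspace_Sym ES W invertible_mexp)
    have "((\<lambda>s. congr ?i (mexp (s *\<^sub>R W))) has_vector_derivative congr ?i (W ** mexp (0 *\<^sub>R W))) (at 0 within ?T)"
      by (rule bounded_linear.has_vector_derivative[OF bounded_linear_congr mexp_has_vector_derivative])
    then have d: "((\<lambda>s. congr ?i (mexp (s *\<^sub>R W))) has_vector_derivative congr ?i W) (at 0 within ?T)" by simp
    obtain b where b: "((\<lambda>s. mlog (congr ?i (mexp (s *\<^sub>R W)))) has_vector_derivative b) (at 0 within ?T)"
      "dexp (mlog (congr ?i (mexp (0 *\<^sub>R W)))) b = congr ?i W"
      using mlog_has_vector_derivative[OF d 0 bot SPD] by metis
    have "b \<in> dexp_sym X ` E"
      by (rule has_vector_derivative_mem_subspace[OF subspace_dexp_sym_image[OF E(1)] b(1) _ 0 bot])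
        (intro mem subspace_scale E W)
    moreover have nX: "- X \<in> Sym" by (rule subspace_neg[OF subspace_Sym XS])
    have "mlog (congr ?i (mexp (0 *\<^sub>R W))) = - X"
      using mexp_congr_half[OF nX] nX by simp
    then have "congr ?i (dexp_sym X b) = congr ?i W" using b(2) dexp_congr[OF nX, of b] by (simp add: dexp_sym_minus)
    then have "dexp_sym X b = W" using congr_inv(1)[OF invertible_mexp] by metis
    ultimately show ?thesis by blast
  qed
  show ?thesis
    by (rule subspace_dim_equal[symmetric])
      (use E sub in \<open>auto intro!: subspace_dexp_sym_image simp: dexp_sym_dim[OF XS]\<close>)
qed

text \<open>The orthogonality relation below holds for all small \<open>\<tau>\<close>; its expansion at \<open>\<tau> = 0\<close> starts with
  \<open>\<tau>\<^sup>4 / 3\<close> times the inner product of \<open>[X, [X, W]]\<close> and \<open>V\<close>.\<close>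

lemma double_commutator_orthogonal:
  fixes X W V :: "real^'n^'n"
  assumes X: "X \<in> Sym"
    and orth: "\<And>\<tau>. \<tau> \<in> {0..1} \<Longrightarrow> integral {0..\<tau>} (\<lambda>s. cosh_ad X s W) \<bullet> integral {0..\<tau>} (\<lambda>s. cosh_ad X s V) = 0"
  shows "commutator X (commutator X W) \<bullet> V = 0"
proof -
  let ?T = "{0..1::real}"
  define J where "J U \<tau> = integral {0..\<tau>} (\<lambda>s. cosh_ad X s U)" for U \<tau>
  define C where "C U \<tau> = cosh_ad X \<tau> U" for U \<tau>
  define S where "S U \<tau> = commutator X (sinh_ad X \<tau> U)" for U \<tau>
  define D where "D U \<tau> = commutator X (commutator X (cosh_ad X \<tau> U))" for U \<tau>
  have dJ: "(J U has_vector_derivative C U \<tau>) (at \<tau> within ?T)" if "\<tau> \<in> ?T" for U \<tau>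
    unfolding J_def C_def by (rule integral_has_vector_derivative[OF continuous_on_cosh_ad that])
  have dC: "(C U has_vector_derivative S U \<tau>) (at \<tau> within ?T)" for U \<tau>
    unfolding C_def S_def by (rule cosh_ad_has_vector_derivative)
  have dS: "(S U has_vector_derivative D U \<tau>) (at \<tau> within ?T)" for U \<tau>
    unfolding S_def D_def
    by (rule bounded_linear.has_vector_derivative[OF cm.bounded_linear_right sinh_ad_has_vector_derivative])
  have dD: "(D U has_vector_derivative commutator X (commutator X (S U \<tau>))) (at \<tau> within ?T)" for U \<tau>
    unfolding D_def S_def
    by (intro bounded_linear.has_vector_derivative[OF cm.bounded_linear_right] cosh_ad_has_vector_derivative)
  have ip: "((\<lambda>\<tau>. f \<tau> \<bullet> g \<tau>) has_vector_derivative f \<tau> \<bullet> g' + f' \<bullet> g \<tau>) (at \<tau> within ?T)"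
    if "(f has_vector_derivative f') (at \<tau> within ?T)" "(g has_vector_derivative g') (at \<tau> within ?T)" for f g f' g' and \<tau>
    by (rule bounded_bilinear.has_vector_derivative[OF bounded_bilinear_inner that])
  \<comment> \<open>A function vanishing on the interval has zero derivative within it at every
    point, end points included. This is used four times, the last time at 0.\<close>
  have zero: "f' = 0" if "(f has_vector_derivative f') (at \<tau> within ?T)" "\<And>\<tau>. \<tau> \<in> ?T \<Longrightarrow> f \<tau> = 0" "\<tau> \<in> ?T" for f :: "real \<Rightarrow> real" and f' \<tau>
    using has_vector_derivative_mem_subspace[of "{0}", OF _ that(1) _ that(3) nondegenerate_interval_limit[OF nondegenerate_interval_01 that(3)]] that(2)
    by (simp add: subspace_single_0)
  have f0: "J W \<tau> \<bullet> J V \<tau> = 0" if "\<tau> \<in> ?T" for \<tau> using orth[OF that] by (simp add: J_def)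
  have f1: "J W \<tau> \<bullet> C V \<tau> + C W \<tau> \<bullet> J V \<tau> = 0" if "\<tau> \<in> ?T" for \<tau>
    by (rule zero[OF ip[OF dJ[OF that] dJ[OF that]] f0 that])
  have f2: "(J W \<tau> \<bullet> S V \<tau> + C W \<tau> \<bullet> C V \<tau>) + (C W \<tau> \<bullet> C V \<tau> + S W \<tau> \<bullet> J V \<tau>) = 0" if "\<tau> \<in> ?T" for \<tau>
    by (rule zero[OF has_vector_derivative_add[OF ip[OF dJ[OF that] dC] ip[OF dC dJ[OF that]]] f1 that])
  have f3: "((J W \<tau> \<bullet> D V \<tau> + C W \<tau> \<bullet> S V \<tau>) + (C W \<tau> \<bullet> S V \<tau> + S W \<tau> \<bullet> C V \<tau>)) +
     ((C W \<tau> \<bullet> S V \<tau> + S W \<tau> \<bullet> C V \<tau>) + (S W \<tau> \<bullet> C V \<tau> + D W \<tau> \<bullet> J V \<tau>)) = 0" if "\<tau> \<in> ?T" for \<tau>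
    by (rule zero[OF has_vector_derivative_add[OF has_vector_derivative_add[OF ip[OF dJ[OF that] dS] ip[OF dC dC]]
          has_vector_derivative_add[OF ip[OF dC dC] ip[OF dS dJ[OF that]]]] f2 that])
  have 0: "(0::real) \<in> ?T" by simp
  have CS: "((\<lambda>\<tau>. C W \<tau> \<bullet> S V \<tau>) has_vector_derivative C W 0 \<bullet> D V 0 + S W 0 \<bullet> S V 0) (at 0 within ?T)"
    by (rule ip[OF dC dS])
  have SC: "((\<lambda>\<tau>. S W \<tau> \<bullet> C V \<tau>) has_vector_derivative S W 0 \<bullet> S V 0 + D W 0 \<bullet> C V 0) (at 0 within ?T)"
    by (rule ip[OF dS dC])
  note f4 = zero[OF has_vector_derivative_add[OF has_vector_derivative_add[OF has_vector_derivative_add[OF ip[OF dJ[OF 0] dD] CS] has_vector_derivative_add[OF CS SC]]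
          has_vector_derivative_add[OF has_vector_derivative_add[OF CS SC] has_vector_derivative_add[OF SC ip[OF dD dJ[OF 0]]]]] f3 0]
  \<comment> \<open>Since \<open>J U \<tau>\<close> expands as
    \<open>\<tau> U + \<tau>^3 / 6 [X, [X, U]]\<close> up to higher order, the fourth derivative at
    0 gives each of the two mixed terms the weight \<open>4! / 6 = 4\<close>.\<close>
  have "J U 0 = 0" "C U 0 = U" "S U 0 = 0" "D U 0 = commutator X (commutator X U)" for U
    by (simp_all add: J_def C_def S_def D_def cm.zero_right)
  with f4 have "4 * (W \<bullet> commutator X (commutator X V)) + 4 * (commutator X (commutator X W) \<bullet> V) = 0" by simp
  moreover have "W \<bullet> commutator X (commutator X V) = commutator X (commutator X W) \<bullet> V"
    by (simp add: commutator_adjoint[OF X])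
  ultimately show ?thesis by simp
qed

text \<open>For \<open>V\<close> orthogonal to \<open>E\<close> and
  \<open>L = dexp_sym (t X)\<close>, invariance of \<open>E\<close> under \<open>L^2\<close> and
  self-adjointness give \<open>L W \<bullet> L V = 0\<close> for all \<open>t\<close>, which is the
  hypothesis of \<open>double_commutator_orthogonal\<close>.\<close>

lemma convex_imp_double_commutator:
  fixes E :: "(real^'n^'n) set"
  assumes E: "subspace E" "E \<subseteq> Sym" and conv: "geodesically_convex ai_metric SPD (mexp ` E)"
    and X: "X \<in> E" and W: "W \<in> E"
  shows "commutator X (commutator X W) \<in> E"
proof -
  have "commutator X (commutator X W) \<bullet> V = 0" if V: "\<forall>y\<in>E. y \<bullet> V = 0" for V
  proof (rule double_commutator_orthogonal)
    show "X \<in> Sym" using X E by blast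
    fix \<tau> :: real assume \<tau>: "\<tau> \<in> {0..1}"
    show "integral {0..\<tau>} (\<lambda>s. cosh_ad X s W) \<bullet> integral {0..\<tau>} (\<lambda>s. cosh_ad X s V) = 0"
    proof (cases "\<tau> = 0")
      case False
      \<comment> \<open>Twice \<open>\<tau>\<close> because \<open>dexp_sym_scaled\<close>
        integrates up to \<open>t / 2\<close>.\<close>
      define t where "t = 2 * \<tau>"
      have t: "t > 0" "t / 2 = \<tau>" using \<tau> False by (auto simp: t_def)
      have tX: "t *\<^sub>R X \<in> E" using X E(1) by (rule subspace_scale[rotated])
      then have tXS: "t *\<^sub>R X \<in> Sym" using E(2) by blast
      have "dexp_sym (t *\<^sub>R X) (dexp_sym (t *\<^sub>R X) W) \<in> E"
        using convex_imp_dexp_sym_square[OF E conv tX] W by blast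
      then have "dexp_sym (t *\<^sub>R X) W \<bullet> dexp_sym (t *\<^sub>R X) V = 0"
        using V dexp_sym_adjoint[OF tXS, of "dexp_sym (t *\<^sub>R X) W" V] by simp
      then have "(t *\<^sub>R dexp_sym (t *\<^sub>R X) W) \<bullet> (t *\<^sub>R dexp_sym (t *\<^sub>R X) V) = 0" by simp
      then show ?thesis unfolding dexp_sym_scaled[OF t(1)] t(2) by simp
    qed simp
  qed
  then show ?thesis using mem_subspace_iff_orthogonal[OF E(1)] by blast
qed

section \<open>The decomposition of positive definite matrices\<close>

text \<open>Both sides are evaluated by the distance formula, with base points \<open>g ** h\<close>
  and \<open>h\<close>; the two logarithms are those of the same matrix.\<close>

lemma spd_dist_congr:
  fixes g f q :: "real^'n^'n"
  assumes g: "invertible g" and f: "f \<in> SPD" and q: "q \<in> SPD"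
  shows "spd_dist (congr g f) (congr g q) = spd_dist f q"
proof -
  define h where "h = mexp ((1/2) *\<^sub>R mlog f)"
  have h: "invertible h" by (simp add: h_def)
  have fh: "f = congr h (mat 1)" using mexp_congr_half[OF mlog_Sym[OF f]] f by (simp add: h_def)
  have gh: "invertible (g ** h)" by (rule invertible_mult[OF g h])
  have "g ** h ** (matrix_inv h ** matrix_inv g) = g ** (h ** matrix_inv h) ** matrix_inv g"
    by (simp add: matrix_mul_assoc)
  also have "\<dots> = mat 1" by (simp add: matrix_inv_works g h)
  finally have i: "matrix_inv (g ** h) = matrix_inv h ** matrix_inv g" by (rule matrix_inv_unique(2))
  have "spd_dist (congr g f) (congr g q) = norm (mlog (congr (matrix_inv (g ** h)) (congr g q)))"
    using spd_dist_curve(4)[OF gh congr_SPD[OF g q]] by (simp add: fh congr_congr)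
  also have "congr (matrix_inv (g ** h)) (congr g q) = congr (matrix_inv h) (congr (matrix_inv g) (congr g q))"
    by (simp add: i congr_congr matrix_mul_assoc)
  also have "\<dots> = congr (matrix_inv h) q" by (simp add: congr_inv[OF g])
  finally show ?thesis using spd_dist_curve(4)[OF h q] by (simp add: fh)
qed

lemma spd_dist_mat_1: "v \<in> Sym \<Longrightarrow> spd_dist (mexp v) (mat 1) = norm v"
proof -
  assume v: "v \<in> Sym"
  then have nv: "- v \<in> Sym" by (rule subspace_neg[OF subspace_Sym])
  have "spd_dist (congr (mexp ((1/2) *\<^sub>R v)) (mat 1)) (mat 1) = norm (mlog (congr (mexp ((1/2) *\<^sub>R - v)) (mat 1)))"
    using spd_dist_curve(4)[OF invertible_mexp mat_1_SPD, of "(1/2) *\<^sub>R v"] by simp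
  then show ?thesis unfolding mexp_congr_half[OF v] mexp_congr_half[OF nv] using nv by simp
qed

lemma mem_sym_perp:
  assumes "E \<subseteq> Sym"
  shows "v \<in> sym_perp E \<longleftrightarrow> v \<in> Sym \<and> (\<forall>X\<in>E. X \<bullet> v = 0)"
proof -
  have "trace (X ** v) = X \<bullet> v" if "X \<in> E" for X
    using that assms by (simp add: inner_trace Sym_transpose[OF subsetD[OF assms]])
  then show ?thesis by (auto simp: sym_perp_def)
qed

text \<open>First variation: the norm of this logarithm is the distance from \<open>exp v\<close> to
  \<open>exp (s B)\<close>, so \<open>\<beta>\<close> governs how the distance changes as the second
  point leaves the identity in direction \<open>B\<close>.\<close>

lemma mlog_congr_derivative:
  fixes B v :: "real^'n^'n"
  assumes v: "v \<in> Sym" and B: "B \<in> Sym"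
  obtains \<beta> where "((\<lambda>s. mlog (congr (mexp (- ((1/2) *\<^sub>R v))) (mexp (s *\<^sub>R B)))) has_vector_derivative \<beta>) (at 0)"
    "dexp_sym v \<beta> = B"
proof -
  let ?i = "mexp (- ((1/2) *\<^sub>R v))"
  have nv: "- v \<in> Sym" using v by (rule subspace_neg[OF subspace_Sym])
  have SPD: "congr ?i (mexp (s *\<^sub>R B)) \<in> SPD" for s
    by (intro congr_SPD mexp_SPD subspace_scale subspace_Sym B invertible_mexp)
  have "((\<lambda>s. congr ?i (mexp (s *\<^sub>R B))) has_vector_derivative congr ?i (B ** mexp (0 *\<^sub>R B))) (at 0)"
    by (rule bounded_linear.has_vector_derivative[OF bounded_linear_congr mexp_has_vector_derivative])
  then have d: "((\<lambda>s. congr ?i (mexp (s *\<^sub>R B))) has_vector_derivative congr ?i B) (at 0)" by simp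
  have nbot: "at (0::real) \<noteq> bot" by simp
  obtain \<beta> where \<beta>: "((\<lambda>s. mlog (congr ?i (mexp (s *\<^sub>R B)))) has_vector_derivative \<beta>) (at 0)"
    "dexp (mlog (congr ?i (mexp (0 *\<^sub>R B)))) \<beta> = congr ?i B"
    using mlog_has_vector_derivative[OF d UNIV_I nbot SPD] by metis
  have "mlog (congr ?i (mexp (0 *\<^sub>R B))) = - v"
    using mexp_congr_half[OF nv] nv by simp
  then have "congr ?i (dexp_sym v \<beta>) = congr ?i B"
    using \<beta>(2) dexp_congr[OF nv, of \<beta>] by (simp add: dexp_sym_minus)
  then have "dexp_sym v \<beta> = B" using congr_inv(1)[OF invertible_mexp] by metis
  with \<beta>(1) show thesis by (rule that)
qed

context lie_triple
begin

abbreviation F where "F \<equiv> sym_perp E"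

lemmas mem_F = mem_sym_perp[OF E_Sym]

lemma F_SymD: "v \<in> F \<Longrightarrow> v \<in> Sym"
  by (simp add: mem_F)

lemma mexp_square_E:
  assumes "u \<in> E" shows "mexp u ** mexp u \<in> mexp ` E"
  using mexp_double[of "2 *\<^sub>R u"] scale_E[OF assms, of 2] by auto

text \<open>Translation by \<open>exp (- u)\<close> preserves \<open>exp E\<close> and reduces to
  \<open>u = 0\<close>. There the distance from \<open>exp v\<close> to \<open>exp B\<close> is at
  least \<open>norm (v - B)\<close>, which by Pythagoras exceeds \<open>norm v\<close> unless
  \<open>B = 0\<close>.\<close>

lemma spd_dist_E:
  assumes u: "u \<in> E" and v: "v \<in> F" and q: "q \<in> mexp ` E"
  shows "norm v \<le> spd_dist (congr (mexp u) (mexp v)) q"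
    "spd_dist (congr (mexp u) (mexp v)) q = norm v \<longleftrightarrow> q = mexp u ** mexp u"
proof -
  define B where "B = mlog (congr (mexp (- u)) q)"
  have m: "congr (mexp (- u)) q \<in> mexp ` E" by (intro congr_E neg_E u q)
  then have B: "B \<in> E" unfolding B_def by (rule mlog_image_E)
  have "mexp B = congr (mexp (- u)) q" unfolding B_def using m image_E_SPD by auto
  then have qB: "q = congr (mexp u) (mexp B)" using congr_inv(2)[OF invertible_mexp, of u q] by simp
  have eq: "spd_dist (congr (mexp u) (mexp v)) q = spd_dist (mexp v) (mexp B)"
    unfolding qB by (rule spd_dist_congr[OF invertible_mexp mexp_SPD[OF F_SymD[OF v]] mexp_SPD[OF E_SymD[OF B]]])
  have ge: "norm (v - B) \<le> spd_dist (congr (mexp u) (mexp v)) q"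
    unfolding eq by (rule spd_dist_ge[OF F_SymD[OF v] E_SymD[OF B]])
  have "B \<bullet> v = 0" using v B by (simp add: mem_F)
  then have eqn: "(norm (v - B))\<^sup>2 = (norm v)\<^sup>2 + (norm B)\<^sup>2"
    by (simp add: power2_norm_eq_inner inner_diff_left inner_diff_right inner_commute)
  have le: "norm v \<le> norm (v - B)" by (rule power2_le_imp_le) (simp_all add: eqn)
  have B0: "B = 0" if "norm (v - B) = norm v" using eqn that by simp
  show "norm v \<le> spd_dist (congr (mexp u) (mexp v)) q" using ge le by simp
  show "spd_dist (congr (mexp u) (mexp v)) q = norm v \<longleftrightarrow> q = mexp u ** mexp u"
  proof
    assume "spd_dist (congr (mexp u) (mexp v)) q = norm v"
    then have "B = 0" using ge le B0 by simp
    then show "q = mexp u ** mexp u" by (simp add: qB congr_mexp[OF E_SymD[OF u]])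
  next
    assume "q = mexp u ** mexp u"
    then have "congr (mexp u) (mexp B) = congr (mexp u) (mat 1)"
      using qB by (simp add: congr_mexp[OF E_SymD[OF u]])
    then have "mexp B = mat 1" using congr_inv(1)[OF invertible_mexp] by metis
    then show "spd_dist (congr (mexp u) (mexp v)) q = norm v"
      using eq spd_dist_mat_1[OF F_SymD[OF v]] by simp
  qed
qed

lemma is_projection_iff:
  assumes u: "u \<in> E" and v: "v \<in> F"
  shows "is_projection (mexp ` E) (congr (mexp u) (mexp v)) p \<longleftrightarrow> p = mexp u ** mexp u"
proof -
  let ?x = "congr (mexp u) (mexp v)"
  have 1: "spd_dist ?x (mexp u ** mexp u) = norm v"
    using spd_dist_E(2)[OF u v mexp_square_E[OF u]] by simp
  have "riem_dist_set ai_metric SPD ?x (mexp ` E) = norm v"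
    unfolding riem_dist_set_def
  proof (rule cInf_eq_minimum)
    show "norm v \<in> spd_dist ?x ` (mexp ` E)"
      using 1 mexp_square_E[OF u] by (metis image_eqI)
    fix d assume "d \<in> spd_dist ?x ` (mexp ` E)"
    then show "norm v \<le> d" using spd_dist_E(1)[OF u v] by blast
  qed
  then show ?thesis
    unfolding is_projection_def using spd_dist_E(2)[OF u v] mexp_square_E[OF u] by metis
qed

lemma decomposition_unique:
  assumes "u \<in> E" "v \<in> F" "u' \<in> E" "v' \<in> F" and eq: "congr (mexp u) (mexp v) = congr (mexp u') (mexp v')"
  shows "u = u'" "v = v'"
proof -
  have "mexp u ** mexp u = mexp u' ** mexp u'"
    using is_projection_iff[OF assms(1,2)] is_projection_iff[OF assms(3,4)] eq by metis
  then have "mexp u = mexp u'"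
    by (rule SPD_square_inj[OF mexp_SPD[OF E_SymD[OF assms(1)]] mexp_SPD[OF E_SymD[OF assms(3)]]])
  then show u: "u = u'" using mexp_eq_iff[OF E_SymD[OF assms(1)] E_SymD[OF assms(3)]] by simp
  have "mexp v = mexp v'" using eq u congr_inv(1)[OF invertible_mexp] by metis
  then show "v = v'" using mexp_eq_iff[OF F_SymD[OF assms(2)] F_SymD[OF assms(4)]] by simp
qed

text \<open>Minimise the distance from \<open>x\<close> to \<open>exp E\<close>; the first-order condition at a minimiser
  \<open>e e\<close> says that the logarithm of \<open>e\<^sup>-\<^sup>1 x e\<^sup>-\<^sup>1\<close> is orthogonal to \<open>E\<close>.\<close>

lemma decomposition_exists:
  assumes x: "x \<in> SPD"
  obtains u v where "u \<in> E" "v \<in> F" "x = congr (mexp u) (mexp v)"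
proof -
  define g where "g = mexp ((1/2) *\<^sub>R mlog x)"
  have g: "invertible g" by (simp add: g_def)
  have xg: "x = congr g (mat 1)" using mexp_congr_half[OF mlog_Sym[OF x]] x by (simp add: g_def)
  define h where "h u = norm (mlog (congr (matrix_inv g) (mexp u)))" for u
  have hd: "h u = spd_dist x (mexp u)" if "u \<in> Sym" for u
    using spd_dist_curve(4)[OF g mexp_SPD[OF that]] by (simp add: xg h_def)
  have h_ge: "norm (mlog x - u) \<le> h u" if "u \<in> Sym" for u
    using spd_dist_ge[OF mlog_Sym[OF x] that] x hd[OF that] by simp
  have "continuous_on E (\<lambda>u. congr (matrix_inv g) (mexp u))"
    by (rule bounded_linear.continuous_on[OF bounded_linear_congr continuous_on_mexp])
  then have "continuous_on E (\<lambda>u. mlog (congr (matrix_inv g) (mexp u)))"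
    by (rule continuous_on_compose2[OF continuous_on_mlog])
      (auto intro!: congr_SPD invertible_matrix_inv g mexp_SPD E_SymD)
  then have ch: "continuous_on E h" unfolding h_def by (rule continuous_on_norm)
  \<comment> \<open>Outside this ball \<open>h_ge\<close> makes \<open>h\<close> larger than
    \<open>h 0\<close>, so a minimum over the compact set \<open>K\<close>, which contains 0, is a
    minimum over \<open>E\<close>.\<close>
  define K where "K = E \<inter> cball (mlog x) (h 0)"
  have 0: "0 \<in> E" by (rule subspace_0[OF subspace_E])
  have "compact K" unfolding K_def using closed_subspace[OF subspace_E] by (intro closed_Int_compact compact_cball)
  moreover have zero_K: "0 \<in> K" using h_ge[OF E_SymD[OF 0]] 0 by (simp add: K_def dist_norm)
  moreover have "continuous_on K h" using ch by (rule continuous_on_subset) (simp add: K_def)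
  ultimately obtain u0 where u0: "u0 \<in> K" "\<And>u. u \<in> K \<Longrightarrow> h u0 \<le> h u"
    using continuous_attains_inf[of K h] by blast
  have u0E: "u0 \<in> E" using u0(1) by (simp add: K_def)
  have min: "h u0 \<le> h u" if u: "u \<in> E" for u
  proof (cases "u \<in> K")
    case False
    then have "h 0 < norm (mlog x - u)" using u by (simp add: K_def dist_norm)
    also have "\<dots> \<le> h u" by (rule h_ge[OF E_SymD[OF u]])
    finally show ?thesis using u0(2)[OF zero_K] by simp
  qed (rule u0(2))
  \<comment> \<open>Halved because the nearest point \<open>exp u0\<close> is to be the square of
    \<open>e = exp u\<close>.\<close>
  define u where "u = (1/2) *\<^sub>R u0"
  have u: "u \<in> E" unfolding u_def by (rule scale_E[OF u0E])
  have ii: "invertible (mexp (- u))" by simp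
  define v where "v = mlog (congr (mexp (- u)) x)"
  have v: "v \<in> Sym" unfolding v_def by (intro mlog_Sym congr_SPD ii x)
  have "mexp v = congr (mexp (- u)) x" unfolding v_def by (intro mexp_mlog congr_SPD ii x)
  then have xv: "x = congr (mexp u) (mexp v)" using congr_inv(2)[OF invertible_mexp, of u x] by simp
  have "B \<bullet> v = 0" if B: "B \<in> E" for B
  proof -
    obtain \<beta> where \<beta>: "((\<lambda>s. mlog (congr (mexp (- ((1/2) *\<^sub>R v))) (mexp (s *\<^sub>R B)))) has_vector_derivative \<beta>) (at 0)"
      "dexp_sym v \<beta> = B" using mlog_congr_derivative[OF v E_SymD[OF B]] by metis
    define b where "b s = mlog (congr (mexp (- ((1/2) *\<^sub>R v))) (mexp (s *\<^sub>R B)))" for s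
    have nv: "- v \<in> Sym" using v by (rule subspace_neg[OF subspace_Sym])
    have b0: "b 0 = - v" using mexp_congr_half[OF nv] nv by (simp add: b_def)
    have sBS: "mexp (s *\<^sub>R B) \<in> SPD" for s by (intro mexp_SPD E_SymD scale_E B)
    have nb: "norm (b s) = spd_dist x (congr (mexp u) (mexp (s *\<^sub>R B)))" for s
    proof -
      have "spd_dist (mexp v) (mexp (s *\<^sub>R B)) = norm (b s)"
        using spd_dist_curve(4)[OF invertible_mexp sBS, of "(1/2) *\<^sub>R v"] by (simp add: mexp_congr_half[OF v] b_def)
      then show ?thesis unfolding xv using spd_dist_congr[OF invertible_mexp mexp_SPD[OF v] sBS] by simp
    qed
    have le: "norm (b 0) \<le> norm (b s)" for s
    proof -
      obtain w where w: "w \<in> E" "congr (mexp u) (mexp (s *\<^sub>R B)) = mexp w"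
        using congr_mexp_E[OF u scale_E[OF B, of s]] by blast
      have "norm (b 0) = h u0"
        using nb[of 0] mexp_congr_half[OF E_SymD[OF u0E]] hd[OF E_SymD[OF u0E]] by (simp add: u_def)
      also have "\<dots> \<le> h w" by (rule min[OF w(1)])
      finally show ?thesis using nb[of s] hd[OF E_SymD[OF w(1)]] w(2) by simp
    qed
    have "((\<lambda>s. b s \<bullet> b s) has_vector_derivative b 0 \<bullet> \<beta> + \<beta> \<bullet> b 0) (at 0)"
      by (rule bounded_bilinear.has_vector_derivative[OF bounded_bilinear_inner]) (use \<beta>(1) in \<open>simp_all add: b_def\<close>)
    then have "((\<lambda>s. b s \<bullet> b s) has_real_derivative b 0 \<bullet> \<beta> + \<beta> \<bullet> b 0) (at 0)"
      by (simp add: has_real_derivative_iff_has_vector_derivative)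
    moreover have "\<forall>s. \<bar>0 - s\<bar> < 1 \<longrightarrow> b 0 \<bullet> b 0 \<le> b s \<bullet> b s"
      using le by (simp add: dot_square_norm)
    ultimately have "b 0 \<bullet> \<beta> + \<beta> \<bullet> b 0 = 0" using DERIV_local_min[of _ _ 0 1] by fastforce
    \<comment> \<open>The minimum is attained at \<open>s = 0\<close>. Orthogonality to
      \<open>\<beta>\<close> passes to \<open>B = dexp_sym v \<beta>\<close>, since
      \<open>dexp_sym v\<close> is self-adjoint and fixes \<open>v\<close>.\<close>
    then have "v \<bullet> \<beta> = 0" by (simp add: b0 inner_commute)
    then have "dexp_sym v v \<bullet> \<beta> = 0" by (simp add: dexp_sym_self)
    then show ?thesis using dexp_sym_adjoint[OF v, of v \<beta>] \<beta>(2) by (simp add: inner_commute)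
  qed
  then have "v \<in> F" using v by (simp add: mem_F)
  then show thesis using that u xv by blast
qed

section \<open>Triple commutators and the differential of the decomposition\<close>

lemma commutator_anticommute: "commutator Y Z = - commutator Z Y"
  by (simp add: commutator_def)

text \<open>Polarising the double commutator puts \<open>[X, [Y, Z]] + [Y, [X, Z]]\<close> in
  \<open>E\<close>. Subtracting the analogous sum for \<open>Z, X\<close> and \<open>Y\<close>, the
  Jacobi identity leaves \<open>3 [X, [Y, Z]]\<close>.\<close>

lemma triple_commutator:
  assumes X: "X \<in> E" and Y: "Y \<in> E" and Z: "Z \<in> E"
  shows "commutator X (commutator Y Z) \<in> E"
proof -
  let ?T = "\<lambda>X Y Z. commutator X (commutator Y Z)"
  have sym: "?T X Y Z + ?T Y X Z \<in> E" if "X \<in> E" "Y \<in> E" "Z \<in> E" for X Y Z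
  proof -
    have "?T (X + Y) (X + Y) Z - ?T X X Z - ?T Y Y Z \<in> E"
      by (intro subspace_diff subspace_E double_commutator subspace_add that)
    then show ?thesis by (simp add: cm.add_left cm.add_right algebra_simps)
  qed
  have "3 *\<^sub>R ?T X Y Z = (?T X Y Z + ?T Y X Z) - (?T Z X Y + ?T X Z Y)"
  proof -
    have "?T X Y Z + ?T Y Z X + ?T Z X Y = 0"
      by (simp add: commutator_def mat_algebra)
    moreover have "?T Y Z X = - ?T Y X Z" "?T X Z Y = - ?T X Y Z"
      by (simp_all add: commutator_anticommute[of Z X] commutator_anticommute[of Z Y] cm.minus_right)
    moreover have "(3::real) *\<^sub>R ?T X Y Z = ?T X Y Z + ?T X Y Z + ?T X Y Z" by (simp add: vec_eq_iff)
    ultimately show ?thesis by (simp add: algebra_simps)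
  qed
  moreover have "(?T X Y Z + ?T Y X Z) - (?T Z X Y + ?T X Z Y) \<in> E"
    by (intro subspace_diff subspace_E sym X Y Z)
  ultimately have "(1/3) *\<^sub>R (3 *\<^sub>R ?T X Y Z) \<in> E" using scale_E by metis
  then show ?thesis by simp
qed

end

lemma commutator_cosh_ad: "commutator X (cosh_ad X s W) = cosh_ad X s (commutator X W)"
proof -
  have c: "mexp (s *\<^sub>R X) ** X = X ** mexp (s *\<^sub>R X)" for s
    by (rule mexp_commute_general) (simp add: mat_algebra)
  have Ad: "commutator X (Ad X s W) = Ad X s (commutator X W)" for s
  proof -
    have "mexp (- (s *\<^sub>R X)) ** X = X ** mexp (- (s *\<^sub>R X))" using c[of "- s"] by simp
    then have "mexp (s *\<^sub>R X) ** W ** (mexp (- (s *\<^sub>R X)) ** X) = mexp (s *\<^sub>R X) ** W ** (X ** mexp (- (s *\<^sub>R X)))" by simp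
    then show ?thesis
      by (simp add: Ad_def commutator_def mat_algebra c)
  qed
  show ?thesis by (simp add: cosh_ad_def cm.scaleR_right cm.add_right Ad)
qed

text \<open>\<open>sinh (x/2)\<close> is \<open>x/2\<close> times \<open>sinh (x/2) / (x/2)\<close>,
  in either order. The first form exhibits a bracket with \<open>X\<close>, the second one an image
  of \<open>dexp_sym X\<close>.\<close>

lemma sinh_ad_half:
  "sinh_ad X (1/2) W = (1/2) *\<^sub>R commutator X (dexp_sym X W)"
  "sinh_ad X (1/2) W = (1/2) *\<^sub>R dexp_sym X (commutator X W)"
proof -
  have "((\<lambda>s. commutator X (cosh_ad X s W)) has_integral sinh_ad X (1/2) W - sinh_ad X 0 W) {0..1/2}"
    by (rule fundamental_theorem_of_calculus) (auto intro: sinh_ad_has_vector_derivative)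
  then have hi: "((\<lambda>s. commutator X (cosh_ad X s W)) has_integral sinh_ad X (1/2) W) {0..1/2}" by simp
  have "((\<lambda>s. commutator X (cosh_ad X s W)) has_integral commutator X (integral {0..1/2} (\<lambda>s. cosh_ad X s W))) {0..1/2}"
    using has_integral_linear[OF integrable_integral[OF integrable_cosh_ad] cm.bounded_linear_right] by (simp add: o_def)
  from has_integral_unique[OF hi this]
  show "sinh_ad X (1/2) W = (1/2) *\<^sub>R commutator X (dexp_sym X W)" by (simp add: dexp_sym_def cm.scaleR_right)
  from integral_unique[OF hi]
  show "sinh_ad X (1/2) W = (1/2) *\<^sub>R dexp_sym X (commutator X W)" by (simp add: dexp_sym_def commutator_cosh_ad)
qed

text \<open>By the addition formula a product of two hyperbolic cosines is the mean of two others,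
  each at least the identity; integrating over one of the parameters preserves the bound.\<close>

lemma cosh_ad_dexp_sym_ge:
  assumes X: "X \<in> Sym"
  shows "cosh_ad X (1/2) (dexp_sym X W) \<bullet> W \<ge> W \<bullet> W"
proof -
  have "W \<bullet> W \<le> cosh_ad X s W \<bullet> cosh_ad X (1/2) W" for s
  proof -
    have "cosh_ad X s W \<bullet> cosh_ad X (1/2) W = cosh_ad X s (cosh_ad X (1/2) W) \<bullet> W"
      using cosh_ad_adjoint[OF X, of s "cosh_ad X (1/2) W" W] by (simp add: inner_commute)
    also have "\<dots> = (cosh_ad X (s + 1/2) W \<bullet> W + cosh_ad X (s - 1/2) W \<bullet> W) / 2"
      by (simp add: cosh_ad_cosh_ad inner_add_left)
    finally show ?thesis using cosh_ad_ge[OF X, of W "s + 1/2"] cosh_ad_ge[OF X, of W "s - 1/2"] by simp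
  qed
  then have "integral {0..1/2::real} (\<lambda>s. W \<bullet> W) \<le> integral {0..1/2} (\<lambda>s. cosh_ad X s W \<bullet> cosh_ad X (1/2) W)"
    by (intro integral_le) (auto intro!: integrable_continuous_interval continuous_intros continuous_on_cosh_ad)
  then have "W \<bullet> W \<le> dexp_sym X W \<bullet> cosh_ad X (1/2) W" by (simp add: dexp_sym_inner)
  then show ?thesis using cosh_ad_adjoint[OF X, of "1/2" "dexp_sym X W" W] by simp
qed

context lie_triple
begin

text \<open>Injectivity of the differential of \<open>(u, v) \<mapsto> exp u exp v exp u\<close>. Translated to the identity, a
  kernel element gives \<open>2 cosh (ad v / 2) s = - dexp_sym v c\<close>, where \<open>s\<close> in \<open>E\<close> is the symmetric
  part of \<open>exp (-u) dexp u a\<close> and \<open>c\<close> is orthogonal to \<open>E\<close>; positivity forces \<open>s = 0\<close>.\<close>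

lemma decomposition_derivative_injective:
  assumes u: "u \<in> E" and v: "v \<in> F" and a: "a \<in> E" and b: "b \<in> F"
    and eq: "dexp u a ** mexp v ** mexp u + mexp u ** dexp v b ** mexp u + mexp u ** mexp v ** dexp u a = 0"
  shows "a = 0" "b = 0"
proof -
  let ?h = "mexp ((1/2) *\<^sub>R u)" and ?hi = "mexp (- ((1/2) *\<^sub>R u))"
  let ?k = "mexp ((1/2) *\<^sub>R v)" and ?ki = "mexp (- ((1/2) *\<^sub>R v))"
  define d where "d = dexp_sym u a"
  have dE: "d \<in> E" unfolding d_def by (rule dexp_sym_E[OF u a])
  have uS: "u \<in> Sym" and vS: "v \<in> Sym" using E_SymD[OF u] F_SymD[OF v] by auto
  define s where "s = cosh_ad u (1/2) d"
  define \<sigma> where "\<sigma> = sinh_ad u (1/2) d"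
  have sE: "s \<in> E" unfolding s_def by (rule cosh_ad_E[OF u dE])
  have hh: "mexp (- u) = ?hi ** ?hi" "mexp v = ?k ** ?k"
    using mexp_double[of "- u"] mexp_double[of v] by simp_all
  \<comment> \<open>Here \<open>s\<close> is symmetric and \<open>\<sigma>\<close> antisymmetric.
    Multiplying the kernel equation by \<open>exp (- u)\<close> on both sides leaves
    \<open>s - \<sigma>\<close> to the left of \<open>exp v\<close> and \<open>s + \<sigma>\<close>
    to its right.\<close>
  have plus: "Ad u (1/2) d = s + \<sigma>" and minus: "Ad u (- (1/2)) d = s - \<sigma>"
    by (simp_all add: s_def \<sigma>_def cosh_ad_def sinh_ad_def scaleR_add_right[symmetric] scaleR_diff_right[symmetric] scaleR_2[symmetric])
  have al: "mexp (- u) ** dexp u a = Ad u (- (1/2)) d"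
    by (simp add: hh dexp_eq Ad_def d_def matrix_mul_assoc)
  have ar: "dexp u a ** mexp (- u) = Ad u (1/2) d"
    by (simp add: hh dexp_eq Ad_def d_def matrix_mul_assoc)
  have "mexp (- u) ** (dexp u a ** mexp v ** mexp u + mexp u ** dexp v b ** mexp u + mexp u ** mexp v ** dexp u a) ** mexp (- u) = 0"
    by (simp add: eq mm.zero_left mm.zero_right)
  then have "(mexp (- u) ** dexp u a) ** mexp v + dexp v b + mexp v ** (dexp u a ** mexp (- u)) = 0"
    by (simp add: mat_algebra)
  then have "(s - \<sigma>) ** mexp v + dexp v b + mexp v ** (s + \<sigma>) = 0"
    by (simp only: al ar plus minus)
  then have "(s - \<sigma>) ** (?k ** ?k) + ?k ** dexp_sym v b ** ?k + (?k ** ?k) ** (s + \<sigma>) = 0"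
    by (simp only: hh(2) dexp_eq)
  then have "?ki ** ((s - \<sigma>) ** (?k ** ?k) + ?k ** dexp_sym v b ** ?k + (?k ** ?k) ** (s + \<sigma>)) ** ?ki = 0"
    by (simp add: mm.zero_left mm.zero_right)
  then have "?ki ** (s - \<sigma>) ** ?k + dexp_sym v b + ?k ** (s + \<sigma>) ** ?ki = 0"
    by (simp add: mm.add_left mm.add_right matrix_mul_assoc)
  then have "(Ad v (- (1/2)) (s - \<sigma>) + Ad v (1/2) (s + \<sigma>)) + dexp_sym v b = 0"
    by (simp add: Ad_def add_ac)
  moreover have "Ad v (- (1/2)) (s - \<sigma>) + Ad v (1/2) (s + \<sigma>) = 2 *\<^sub>R cosh_ad v (1/2) s + 2 *\<^sub>R sinh_ad v (1/2) \<sigma>"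
    by (simp add: cosh_ad_def sinh_ad_def Ad_linear)
  moreover have "2 *\<^sub>R sinh_ad v (1/2) \<sigma> = dexp_sym v (commutator v \<sigma>)"
    by (simp add: sinh_ad_half(2))
  ultimately have "2 *\<^sub>R cosh_ad v (1/2) s + (dexp_sym v (commutator v \<sigma>) + dexp_sym v b) = 0"
    by (simp only: add.assoc)
  then have key: "2 *\<^sub>R cosh_ad v (1/2) s = - dexp_sym v (commutator v \<sigma> + b)"
    by (simp only: dexp_sym_linear(1) eq_neg_iff_add_eq_0)
  have \<sigma>: "\<sigma> = (1/2) *\<^sub>R commutator u (dexp_sym u d)" by (simp add: \<sigma>_def sinh_ad_half(1))
  \<comment> \<open>By the preceding formula \<open>\<sigma>\<close> is a bracket of two elements of
    \<open>E\<close>. Hence \<open>[z, \<sigma>]\<close> is a triple commutator in \<open>E\<close>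
    and orthogonal to \<open>v\<close>; moving the bracket across the inner product gives the
    claim.\<close>
  have "commutator v \<sigma> \<bullet> z = 0" if z: "z \<in> E" for z
  proof -
    have "commutator v \<sigma> \<bullet> z = - (\<sigma> \<bullet> commutator z v)"
      using commutator_adjoint[OF vS, of \<sigma> z] by (simp add: commutator_anticommute[of v z])
    also have "\<dots> = - (commutator z \<sigma> \<bullet> v)" using commutator_adjoint[OF E_SymD[OF z], of \<sigma> v] by simp
    also have "commutator z \<sigma> \<in> E"
      unfolding \<sigma> cm.scaleR_right by (intro scale_E triple_commutator z u dexp_sym_E dE)
    then have "commutator z \<sigma> \<bullet> v = 0" using v by (simp add: mem_F)
    finally show ?thesis by simp
  qed
  then have c: "(commutator v \<sigma> + b) \<bullet> s = 0" using sE b by (simp add: inner_add_left mem_F inner_commute[of b])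
  have "dexp_sym v ` Sym = Sym"
    using dexp_sym_onto[OF vS subspace_Sym] dexp_sym_Sym[OF vS] by blast
  \<comment> \<open>Chosen so that pairing \<open>key\<close> with \<open>\<beta>\<close> moves
    \<open>dexp_sym v\<close> from the right-hand side onto \<open>\<beta>\<close> and gives a
    product with \<open>s\<close>, which is 0 by \<open>c\<close>; the left-hand side is at least
    \<open>2 * (\<beta> \<bullet> \<beta>)\<close>.\<close>
  then obtain \<beta> where \<beta>: "dexp_sym v \<beta> = s" using E_SymD[OF sE] by (metis imageE)
  have "2 * (cosh_ad v (1/2) s \<bullet> \<beta>) = - (dexp_sym v (commutator v \<sigma> + b) \<bullet> \<beta>)"
    using arg_cong[OF key, of "\<lambda>y. y \<bullet> \<beta>"] by simp
  also have "\<dots> = 0" using dexp_sym_adjoint[OF vS, of "commutator v \<sigma> + b" \<beta>] c \<beta> by simp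
  finally have "\<beta> \<bullet> \<beta> \<le> 0" using cosh_ad_dexp_sym_ge[OF vS, of \<beta>] \<beta> by simp
  then have "\<beta> = 0" by (metis inner_eq_zero_iff inner_ge_zero order_antisym)
  then have s0: "s = 0" using \<beta> by (simp add: dexp_sym_linear)
  have "d \<bullet> d \<le> 0" using cosh_ad_ge[OF uS, of d "1/2"] s0 by (simp add: s_def)
  then have "d = 0" by (metis inner_eq_zero_iff inner_ge_zero order_antisym)
  then show a0: "a = 0" using dexp_sym_eq_0[OF uS] by (simp add: d_def)
  have "dexp u 0 = 0" using dexp_eq_0[OF uS, of 0] by simp
  then have "mexp u ** dexp v b ** mexp u = 0" using eq a0 by (simp add: mm.zero_left mm.zero_right)
  then have "mexp (- u) ** (mexp u ** dexp v b ** mexp u) ** mexp (- u) = 0" by (simp add: mm.zero_left mm.zero_right)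
  then have "dexp v b = 0" by (simp add: matrix_mul_assoc)
  then show "b = 0" using dexp_eq_0[OF vS] by simp
qed

section \<open>Smoothness of the inverse of the decomposition\<close>

definition proj_E where
  "proj_E = (SOME Q. bounded_linear Q \<and> (\<forall>x. Q x \<in> E) \<and> (\<forall>x. \<forall>y\<in>E. (x - Q x) \<bullet> y = 0) \<and> (\<forall>x. Q x = x \<longleftrightarrow> x \<in> E))"

lemma proj_E:
  shows bounded_linear_proj_E: "bounded_linear proj_E" and proj_E_mem: "proj_E x \<in> E"
    and proj_E_orth: "y \<in> E \<Longrightarrow> (x - proj_E x) \<bullet> y = 0" and proj_E_ident: "proj_E x = x \<longleftrightarrow> x \<in> E"
proof -
  have "\<exists>Q. bounded_linear Q \<and> (\<forall>x. Q x \<in> E) \<and> (\<forall>x. \<forall>y\<in>E. (x - Q x) \<bullet> y = 0) \<and> (\<forall>x. Q x = x \<longleftrightarrow> x \<in> E)"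
    using obtain_projection[OF subspace_E] by metis
  from someI_ex[OF this, folded proj_E_def]
  show "bounded_linear proj_E" "proj_E x \<in> E" "y \<in> E \<Longrightarrow> (x - proj_E x) \<bullet> y = 0" "proj_E x = x \<longleftrightarrow> x \<in> E" by auto
qed

lemma diff_proj_E_mem: "Z \<in> Sym \<Longrightarrow> Z - proj_E Z \<in> F"
  using proj_E_orth[of _ Z] by (simp add: mem_F inner_commute subspace_diff[OF subspace_Sym] E_SymD[OF proj_E_mem])

lemma proj_E_F: "v \<in> F \<Longrightarrow> proj_E v = 0"
proof -
  assume v: "v \<in> F"
  have "proj_E v \<bullet> v = 0" using v proj_E_mem[of v] by (simp add: mem_F)
  then have "proj_E v \<bullet> proj_E v = 0"
    using proj_E_orth[OF proj_E_mem[of v], of v] inner_diff_left[of v "proj_E v" "proj_E v"] inner_commute[of v "proj_E v"] by linarith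
  then show ?thesis by simp
qed

lemmas proj_E_linear = linear_add[OF bounded_linear.linear[OF bounded_linear_proj_E]]
  linear_diff[OF bounded_linear.linear[OF bounded_linear_proj_E]]

lemma proj_E_add: "u \<in> E \<Longrightarrow> v \<in> F \<Longrightarrow> proj_E (u + v) = u"
  using proj_E_ident[of u] by (simp add: proj_E_linear proj_E_F)

text \<open>The pair \<open>(u, v)\<close> is encoded as the single matrix \<open>u + v\<close>,
  since \<open>Sym\<close> is the orthogonal sum of \<open>E\<close> and \<open>F\<close>. The
  decomposition thus becomes a map from \<open>Sym\<close> onto \<open>SPD\<close>, to which
  \<open>smooth_inverse_Sym\<close> applies.\<close>

definition efe where "efe Z = mexp (proj_E Z) ** mexp (Z - proj_E Z) ** mexp (proj_E Z)"

definition efe_inv where "efe_inv = inv_into Sym efe"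

lemma efe_congr: "efe Z = congr (mexp (proj_E Z)) (mexp (Z - proj_E Z))"
  by (simp add: efe_def congr_mexp[OF E_SymD[OF proj_E_mem]])

lemma efe_add: "u \<in> E \<Longrightarrow> v \<in> F \<Longrightarrow> efe (u + v) = mexp u ** mexp v ** mexp u"
  by (simp add: efe_def proj_E_add)

lemma efe_image: "efe ` Sym = SPD"
proof (intro equalityI subsetI)
  fix x assume "x \<in> efe ` Sym"
  then show "x \<in> SPD"
    by (auto simp: efe_congr intro!: congr_SPD mexp_SPD F_SymD diff_proj_E_mem)
next
  fix x :: "real^'n^'n" assume "x \<in> SPD"
  then obtain u v where uv: "u \<in> E" "v \<in> F" "x = congr (mexp u) (mexp v)" using decomposition_exists by metis
  then have "x = efe (u + v)" by (simp add: efe_congr proj_E_add)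
  moreover have "u + v \<in> Sym" by (intro subspace_add subspace_Sym E_SymD F_SymD uv)
  ultimately show "x \<in> efe ` Sym" by blast
qed

lemma efe_inv_efe: "Z \<in> Sym \<Longrightarrow> efe_inv (efe Z) = Z"
  unfolding efe_inv_def
proof (rule inv_into_f_f)
  show "inj_on efe Sym"
  proof (rule inj_onI)
    fix Y Z assume "Y \<in> Sym" "Z \<in> Sym" "efe Y = efe Z"
    then have "proj_E Y = proj_E Z" "Y - proj_E Y = Z - proj_E Z"
      using decomposition_unique[OF proj_E_mem diff_proj_E_mem proj_E_mem diff_proj_E_mem, of Y Z] by (simp_all add: efe_congr)
    then show "Y = Z" by simp
  qed
qed

lemma efe_has_derivative:
  "(efe has_derivative (\<lambda>W. mexp (proj_E X) ** mexp (X - proj_E X) ** dexp (proj_E X) (proj_E W) +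
     (mexp (proj_E X) ** dexp (X - proj_E X) (W - proj_E W) + dexp (proj_E X) (proj_E W) ** mexp (X - proj_E X)) ** mexp (proj_E X))) (at X)"
proof -
  have 1: "((\<lambda>Z. mexp (proj_E Z)) has_derivative (\<lambda>W. dexp (proj_E X) (proj_E W))) (at X)"
    by (rule has_derivative_compose[OF bounded_linear_imp_has_derivative[OF bounded_linear_proj_E] mexp_has_derivative])
  have bl: "bounded_linear (\<lambda>Z. Z - proj_E Z)" by (intro bounded_linear_sub bounded_linear_ident bounded_linear_proj_E)
  have 2: "((\<lambda>Z. mexp (Z - proj_E Z)) has_derivative (\<lambda>W. dexp (X - proj_E X) (W - proj_E W))) (at X)"
    by (rule has_derivative_compose[OF bounded_linear_imp_has_derivative[OF bl] mexp_has_derivative])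
  show ?thesis unfolding efe_def[abs_def] by (intro mm.FDERIV 1 2)
qed

lemma smooth_efe_inv:
  shows "Ck_on k {Y. symm Y \<in> SPD} (\<lambda>Y. efe_inv (symm Y))"
proof (rule smooth_inverse_Sym(2)[OF _ efe_image _ efe_inv_efe])
  have bl: "bounded_linear (\<lambda>Z. Z - proj_E Z)" by (intro bounded_linear_sub bounded_linear_ident bounded_linear_proj_E)
  show "Ck_on k UNIV efe" for k
    unfolding efe_def[abs_def]
    by (intro Ck_on_bilinear[OF bounded_bilinear_matrix_mult open_UNIV] Ck_on_mexp open_UNIV Ck_on_linear bl bounded_linear_proj_E)
  show "SPD \<subseteq> (Sym :: (real^'n^'n) set)" using SPD_Sym by blast
  fix X W :: "real^'n^'n" assume X: "X \<in> Sym" and W: "W \<in> Sym" and 0: "frechet_derivative efe (at X) W = 0"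
  have "mexp (proj_E X) ** mexp (X - proj_E X) ** dexp (proj_E X) (proj_E W) +
     (mexp (proj_E X) ** dexp (X - proj_E X) (W - proj_E W) + dexp (proj_E X) (proj_E W) ** mexp (X - proj_E X)) ** mexp (proj_E X) = 0"
    using 0 by (simp only: frechet_derivative_at[OF efe_has_derivative, symmetric])
  then have "dexp (proj_E X) (proj_E W) ** mexp (X - proj_E X) ** mexp (proj_E X) + mexp (proj_E X) ** dexp (X - proj_E X) (W - proj_E W) ** mexp (proj_E X)
     + mexp (proj_E X) ** mexp (X - proj_E X) ** dexp (proj_E X) (proj_E W) = 0"
    by (simp add: mm.add_left algebra_simps)
  from decomposition_derivative_injective[OF proj_E_mem diff_proj_E_mem[OF X] proj_E_mem diff_proj_E_mem[OF W] this]
  show "W = 0" by simp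
qed

section \<open>The decomposition of the general linear group\<close>

text \<open>Read off from \<open>transpose g ** g = exp W exp (2 V) exp W\<close>, whence the factor
  1/2; \<open>k\<close> is what remains of \<open>g\<close>. On \<open>GL\<close> the Gram matrix is
  symmetric already, and \<open>symm\<close> matches the open domain on which \<open>efe_inv\<close>
  is known to be smooth.\<close>

definition polar :: "real^'n^'n \<Rightarrow> (real^'n^'n) \<times> (real^'n^'n) \<times> (real^'n^'n)" where
  "polar g = (let Z = efe_inv (symm (transpose g ** g)); W = proj_E Z; V = (1/2) *\<^sub>R (Z - proj_E Z) in
     (g ** mexp (- W) ** mexp (- V), V, W))"

lemma scale_F: "v \<in> F \<Longrightarrow> c *\<^sub>R v \<in> F"
  by (simp add: mem_F subspace_scale[OF subspace_Sym])

lemma gram_SPD: "g \<in> GL \<Longrightarrow> transpose g ** g \<in> SPD" for g :: "real^'n^'n"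
  using SPD_congruence[OF mat_1_SPD, of "transpose g"] transpose_invertible[of g] by (simp add: GL_def)

text \<open>The orthogonal factor cancels in the Gram matrix, and uniqueness of the decomposition in
  \<open>SPD\<close> then determines \<open>W\<close> and \<open>2 V\<close>.\<close>

lemma gram_kvw:
  assumes k: "k \<in> Orth" and V: "V \<in> F" and W: "W \<in> E"
  shows "transpose (k ** mexp V ** mexp W) ** (k ** mexp V ** mexp W) = efe (W + 2 *\<^sub>R V)"
proof -
  have "transpose k ** k = mat 1" using k by (simp add: Orth_def orthogonal_matrix)
  moreover have "transpose (mexp V) = mexp V" "transpose (mexp W) = mexp W"
    by (simp_all add: Sym_transpose[OF mexp_Sym] F_SymD[OF V] E_SymD[OF W])
  then have "transpose (k ** mexp V ** mexp W) ** (k ** mexp V ** mexp W) = mexp W ** mexp V ** (transpose k ** k) ** mexp V ** mexp W"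
    by (simp add: matrix_transpose_mul matrix_mul_assoc)
  ultimately have "transpose (k ** mexp V ** mexp W) ** (k ** mexp V ** mexp W) = mexp W ** (mexp V ** mexp V) ** mexp W"
    by (simp add: matrix_mul_assoc)
  also have "mexp V ** mexp V = mexp (2 *\<^sub>R V)" using mexp_double[of "2 *\<^sub>R V"] by simp
  finally show ?thesis by (simp only: efe_add[OF W scale_F[OF V]])
qed

lemma polar_kvw:
  assumes k: "k \<in> Orth" and V: "V \<in> F" and W: "W \<in> E"
  shows "polar (k ** mexp V ** mexp W) = (k, V, W)"
proof -
  have Z: "W + 2 *\<^sub>R V \<in> Sym" by (intro subspace_add subspace_Sym E_SymD F_SymD scale_F V W)
  then have "efe (W + 2 *\<^sub>R V) \<in> Sym" using efe_image SPD_Sym by blast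
  then have "efe_inv (symm (transpose (k ** mexp V ** mexp W) ** (k ** mexp V ** mexp W))) = W + 2 *\<^sub>R V"
    unfolding gram_kvw[OF assms] by (simp add: efe_inv_efe[OF Z])
  then show ?thesis
    unfolding polar_def Let_def by (simp add: proj_E_add[OF W scale_F[OF V]])
qed

lemma polar_GL:
  assumes g: "g \<in> GL" and kvw: "polar g = (k, V, W)"
  shows "k \<in> Orth" "V \<in> F" "W \<in> E" "g = k ** mexp V ** mexp W"
proof -
  define Z where "Z = efe_inv (symm (transpose g ** g))"
  have x: "transpose g ** g \<in> SPD" by (rule gram_SPD[OF g])
  then obtain Y where Y: "Y \<in> Sym" "efe Y = transpose g ** g" using efe_image by (metis imageE)
  then have "Z = Y" using efe_inv_efe[OF Y(1)] SPD_Sym[OF x] by (simp add: Z_def)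
  then have Z: "Z \<in> Sym" "efe Z = transpose g ** g" using Y by simp_all
  have eq: "W = proj_E Z" "V = (1/2) *\<^sub>R (Z - proj_E Z)" "k = g ** mexp (- W) ** mexp (- V)"
    using kvw by (auto simp: polar_def Let_def Z_def)
  show W: "W \<in> E" unfolding eq by (rule proj_E_mem)
  show V: "V \<in> F" unfolding eq by (intro scale_F diff_proj_E_mem Z)
  show "g = k ** mexp V ** mexp W" unfolding eq(3) by (simp add: matrix_mul_assoc)
  have VV: "mexp (- V) ** mexp (Z - proj_E Z) ** mexp (- V) = mat 1"
  proof -
    have "mexp (Z - proj_E Z) = mexp V ** mexp V" using mexp_double[of "Z - proj_E Z"] by (simp only: eq(2))
    then show ?thesis by (simp add: matrix_mul_assoc)
  qed
  have "transpose (mexp (- V)) = mexp (- V)" "transpose (mexp (- W)) = mexp (- W)"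
    by (simp_all add: Sym_transpose[OF mexp_Sym] subspace_neg[OF subspace_Sym] F_SymD[OF V] E_SymD[OF W])
  then have "transpose k ** k = mexp (- V) ** mexp (- W) ** (transpose g ** g) ** mexp (- W) ** mexp (- V)"
    unfolding eq(3) by (simp add: matrix_transpose_mul matrix_mul_assoc)
  also have "\<dots> = mexp (- V) ** mexp (Z - proj_E Z) ** mexp (- V)"
    unfolding Z(2)[symmetric] efe_def eq(1)[symmetric] by (simp add: matrix_mul_assoc)
  finally show "k \<in> Orth" using VV by (simp add: Orth_def orthogonal_matrix)
qed

lemma kvw_GL:
  assumes "k \<in> Orth" shows "k ** mexp V ** mexp W \<in> GL"
  using assms by (auto simp: GL_def Orth_def orthogonal_matrix_def invertible_def intro!: invertible_mult[unfolded invertible_def] invertible_mexp[unfolded invertible_def])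

lemma GL_decomposition:
  assumes g: "g \<in> GL"
  shows "\<exists>!(k, V, W). k \<in> Orth \<and> V \<in> F \<and> W \<in> E \<and> g = k ** mexp V ** mexp W"
proof (rule ex1I[of _ "polar g"])
  show "case polar g of (k, V, W) \<Rightarrow> k \<in> Orth \<and> V \<in> F \<and> W \<in> E \<and> g = k ** mexp V ** mexp W"
    using polar_GL[OF g] by (cases "polar g") auto
  show "y = polar g" if "case y of (k, V, W) \<Rightarrow> k \<in> Orth \<and> V \<in> F \<and> W \<in> E \<and> g = k ** mexp V ** mexp W" for y
    using that polar_kvw by (cases y) auto
qed

text \<open>Both directions are restrictions of maps smooth on open sets of the ambient spaces, as
  \<open>smooth_map\<close> asks: multiplication on all triples, and \<open>polar\<close> with
  exponentials where the symmetrised Gram matrix is positive definite.\<close>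

lemma GL_diffeomorphic: "(GL :: (real^'n^'n) set) diffeomorphic (Orth :: (real^'n^'n) set) \<times> mexp ` F \<times> mexp ` E"
proof -
  let ?P = "(Orth :: (real^'n^'n) set) \<times> mexp ` F \<times> mexp ` E"
  define \<Phi> where "\<Phi> g = (case polar g of (k, V, W) \<Rightarrow> (k, mexp V, mexp W))" for g
  define \<Psi> where "\<Psi> y = fst y ** fst (snd y) ** snd (snd y)" for y :: "(real^'n^'n) \<times> (real^'n^'n) \<times> (real^'n^'n)"
  have \<Psi>\<Phi>: "\<Psi> (\<Phi> g) = g" and \<Phi>P: "\<Phi> g \<in> ?P" if "g \<in> GL" for g
    using polar_GL[OF that] by (cases "polar g"; auto simp: \<Phi>_def \<Psi>_def)+
  have \<Phi>\<Psi>: "\<Phi> (\<Psi> y) = y" and \<Psi>GL: "\<Psi> y \<in> GL" if "y \<in> ?P" for y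
    using that by (auto simp: \<Phi>_def \<Psi>_def polar_kvw kvw_GL)
  have "smooth_map ?P \<Psi>"
  proof (rule smooth_map_open[OF open_UNIV subset_UNIV])
    show "Ck_on k UNIV \<Psi>" for k
      unfolding \<Psi>_def
      by (intro Ck_on_bilinear[OF bounded_bilinear_matrix_mult open_UNIV] Ck_on_linear open_UNIV bounded_linear_fst
          bounded_linear_compose[OF bounded_linear_fst bounded_linear_snd] bounded_linear_compose[OF bounded_linear_snd bounded_linear_snd])
  qed
  moreover have "smooth_map GL \<Phi>"
  proof (rule smooth_map_open)
    let ?V = "{Y :: real^'n^'n. symm Y \<in> SPD}"
    let ?G = "\<lambda>g :: real^'n^'n. transpose g ** g"
    have CG: "Ck_on k S ?G" if "open S" for k S
      by (intro Ck_on_bilinear[OF bounded_bilinear_matrix_mult] Ck_on_linear bounded_linear_transpose bounded_linear_ident that)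
    show oU: "open (?G -` ?V)"
    proof (rule open_vimage[OF smooth_mlog(1)])
      show "continuous_on UNIV ?G" using CG[of UNIV 0] by simp
    qed
    show "GL \<subseteq> ?G -` ?V" using gram_SPD symm_SPD by auto
    fix k
    have CZ: "Ck_on k (?G -` ?V) (\<lambda>g. efe_inv (symm (?G g)))"
      by (rule Ck_on_compose[OF oU smooth_mlog(1) _ CG[OF oU] smooth_efe_inv]) auto
    have bl: "bounded_linear (\<lambda>Z. c *\<^sub>R (Z - proj_E Z))" for c
      by (intro bounded_linear_compose[OF bounded_linear_scaleR_right] bounded_linear_sub bounded_linear_ident bounded_linear_proj_E)
    have bn: "bounded_linear (\<lambda>Z. - proj_E Z)" by (rule bounded_linear_minus[OF bounded_linear_proj_E])
    note CZl = Ck_on_compose_linear[OF _ oU CZ]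
    have "Ck_on k (?G -` ?V) (\<lambda>g. (g ** mexp (- proj_E (efe_inv (symm (?G g)))) ** mexp ((-1/2) *\<^sub>R (efe_inv (symm (?G g)) - proj_E (efe_inv (symm (?G g))))),
       mexp ((1/2) *\<^sub>R (efe_inv (symm (?G g)) - proj_E (efe_inv (symm (?G g))))), mexp (proj_E (efe_inv (symm (?G g))))))"
      by (intro Ck_on_Pair oU Ck_on_mexp CZl[OF bl] CZl[OF bn] CZl[OF bounded_linear_proj_E]
          Ck_on_bilinear[OF bounded_bilinear_matrix_mult oU] Ck_on_linear bounded_linear_ident)
    then show "Ck_on k (?G -` ?V) \<Phi>"
      unfolding \<Phi>_def[abs_def] polar_def Let_def by simp
  qed
  moreover have "\<Phi> ` GL = ?P"
  proof (intro equalityI image_subsetI subsetI)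
    show "\<Phi> g \<in> ?P" if "g \<in> GL" for g by (rule \<Phi>P[OF that])
    show "y \<in> \<Phi> ` GL" if "y \<in> ?P" for y using \<Phi>\<Psi>[OF that] \<Psi>GL[OF that] by (metis image_eqI)
  qed
  moreover have "\<Psi> ` ?P = GL"
  proof (intro equalityI image_subsetI subsetI)
    show "\<Psi> y \<in> GL" if "y \<in> ?P" for y by (rule \<Psi>GL[OF that])
    show "g \<in> \<Psi> ` ?P" if "g \<in> GL" for g using \<Psi>\<Phi>[OF that] \<Phi>P[OF that] by (metis image_eqI)
  qed
  ultimately have "diffeomorphism GL ?P \<Phi> \<Psi>"
    using \<Psi>\<Phi> \<Phi>\<Psi> by (simp add: diffeomorphism_def)
  then show ?thesis unfolding diffeomorphic_def by blast
qed

section \<open>Decomposition, projection and square root in the form of the theorem\<close>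

lemma SPD_decomposition:
  assumes x: "x \<in> SPD"
  shows "\<exists>!(e, f). e \<in> mexp ` E \<and> f \<in> mexp ` F \<and> x = e ** f ** e"
    "\<exists>!p. is_projection (mexp ` E) x p"
    "\<And>e f p. e \<in> mexp ` E \<and> f \<in> mexp ` F \<and> x = e ** f ** e \<and> is_projection (mexp ` E) x p \<Longrightarrow> e = spd_sqrt p"
proof -
  have congr: "mexp u ** f ** mexp u = congr (mexp u) f" if "u \<in> E" for u f
    using congr_mexp[OF E_SymD[OF that]] by simp
  obtain u v where uv: "u \<in> E" "v \<in> F" "x = congr (mexp u) (mexp v)" using decomposition_exists[OF x] by metis
  show "\<exists>!(e, f). e \<in> mexp ` E \<and> f \<in> mexp ` F \<and> x = e ** f ** e"
  proof (rule ex1I[of _ "(mexp u, mexp v)"])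
    show "case (mexp u, mexp v) of (e, f) \<Rightarrow> e \<in> mexp ` E \<and> f \<in> mexp ` F \<and> x = e ** f ** e"
      using uv by (simp add: congr)
    fix y assume "case y of (e, f) \<Rightarrow> e \<in> mexp ` E \<and> f \<in> mexp ` F \<and> x = e ** f ** e"
    then obtain u' v' where y: "y = (mexp u', mexp v')" "u' \<in> E" "v' \<in> F" "x = mexp u' ** mexp v' ** mexp u'"
      by (cases y) auto
    then have "congr (mexp u') (mexp v') = congr (mexp u) (mexp v)"
      using uv(3) congr[OF y(2), of "mexp v'"] by metis
    from decomposition_unique[OF y(2,3) uv(1,2) this] y(1)
    show "y = (mexp u, mexp v)" by simp
  qed
  show "\<exists>!p. is_projection (mexp ` E) x p"
    unfolding uv(3) is_projection_iff[OF uv(1,2)] by blast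
  fix e f p assume *: "e \<in> mexp ` E \<and> f \<in> mexp ` F \<and> x = e ** f ** e \<and> is_projection (mexp ` E) x p"
  then obtain u' v' where e: "e = mexp u'" "f = mexp v'" "u' \<in> E" "v' \<in> F" by blast
  have "congr (mexp u') (mexp v') = x" using * e(1,2) congr[OF e(3), of "mexp v'"] by metis
  then have "is_projection (mexp ` E) (congr (mexp u') (mexp v')) p" using * by metis
  then have p: "p = e ** e" using is_projection_iff[OF e(3,4)] e(1) by simp
  have eS: "e \<in> SPD" by (simp add: e(1) mexp_SPD E_SymD e(3))
  show "e = spd_sqrt p"
    unfolding spd_sqrt_def p
    by (rule the_equality[symmetric]) (auto simp: eS intro: SPD_square_inj)
qed

end

theorem theorem1p1:
  fixes E F :: "(real^'n^'n) set"
  assumes "subspace E" and "E \<subseteq> Sym" and "F = sym_perp E"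
  shows
    "(totally_geodesic_submanifold ai_metric SPD (mexp ` E) \<and>
      geodesically_convex ai_metric SPD (mexp ` E)
        \<longleftrightarrow> (\<forall>X\<in>E. \<forall>Y\<in>E. commutator X (commutator X Y) \<in> E))
   \<and> ((\<forall>X\<in>E. \<forall>Y\<in>E. commutator X (commutator X Y) \<in> E) \<longrightarrow>
        (\<forall>x\<in>SPD.
           (\<exists>!(e, f). e \<in> mexp ` E \<and> f \<in> mexp ` F \<and> x = e ** f ** e) \<and>
           (\<exists>!p. is_projection (mexp ` E) x p) \<and>
           (\<forall>e f p. e \<in> mexp ` E \<and> f \<in> mexp ` F \<and> x = e ** f ** e \<and>
              is_projection (mexp ` E) x p \<longrightarrow> e = spd_sqrt p)))
   \<and> ((\<forall>X\<in>E. \<forall>Y\<in>E. commutator X (commutator X Y) \<in> E) \<longrightarrow>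
        (\<forall>g\<in>GL. \<exists>!(k, V, W). k \<in> Orth \<and> V \<in> F \<and> W \<in> E \<and> g = k ** mexp V ** mexp W) \<and>
        (GL :: (real^'n^'n) set) diffeomorphic (Orth :: (real^'n^'n) set) \<times> mexp ` F \<times> mexp ` E)"
proof -
  have lts: "lie_triple E" if "\<forall>X\<in>E. \<forall>Y\<in>E. commutator X (commutator X Y) \<in> E"
    using assms that by unfold_locales auto
  have "totally_geodesic_submanifold ai_metric SPD (mexp ` E) \<and> geodesically_convex ai_metric SPD (mexp ` E)"
    if *: "\<forall>X\<in>E. \<forall>Y\<in>E. commutator X (commutator X Y) \<in> E"
    unfolding totally_geodesic_submanifold_def
    using submanifold_mexp_image[OF assms(1,2)] lie_triple.geodesic_E_imp_SPD[OF lts[OF *]]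
      lie_triple.geodesically_convex_E[OF lts[OF *]] by blast
  moreover have "\<forall>X\<in>E. \<forall>Y\<in>E. commutator X (commutator X Y) \<in> E"
    if "geodesically_convex ai_metric SPD (mexp ` E)"
    using convex_imp_double_commutator[OF assms(1,2) that] by blast
  ultimately show ?thesis
    unfolding assms(3)
    by (intro conjI iffI impI ballI allI lie_triple.SPD_decomposition[OF lts] lie_triple.GL_decomposition[OF lts]
        lie_triple.GL_diffeomorphic[OF lts]) blast+
qed

end
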